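(* Let $H\in(1/2,1)$, let $W=\{W(t),t\in[0,1]\}$ be a standard Wiener process with respect to the filtration $\mathbb{F}$, and let $B^H=\{B^H(t),t\in[0,1]\}$ be an $\mathbb{F}$-adapted fractional Brownian motion with Hurst index $H$ (no independence or other assumption on the joint law of $B^H$ and $W$ is imposed). Assume that the filtration $\mathbb{F}$ is left-continuous at $1$, i.e. $\sigma\big(\bigcup_{t<1}\mathcal{F}_t\big)=\mathcal{F}_1$. Then for any $\mathcal{F}_1$-measurable random variable $\xi$ there exists an $\mathbb{F}$-adapted process $\psi$ such that $$\int_0^1\psi(t)\,d\big(B^H(t)+W(t)\big)=\xi$$ almost surely.
   Context: $(\Omega,\mathcal{F},\mathbb{F}=\{\mathcal{F}_t,t\in[0,1]\},P)$ is a stochastic basis (filtered probability space). The integral $\int\psi\,d(B^H+W)$ means $\int\psi\,dB^H+\int\psi\,dW$, where the integral with respect to $W$ is the classical It\^o integral (defined for adapted integrands with $\int_0^1\psi(t)^2dt<\infty$ a.s.) and the integral with respect to $B^H$ is the pathwise generalized Lebesgue--Stieltjes integral, defined as follows. For $f,g:[a,b]\to\mathbb{R}$ and $\beta\in(0,1)$ put $$(D_{a+}^{\beta}f)(x)=\frac{1}{\Gamma(1-\beta)}\Big(\frac{f(x)}{(x-a)^\beta}+\beta\int_a^x\frac{f(x)-f(u)}{(x-u)^{\beta+1}}du\Big),$$ $$(D_{b-}^{1-\beta}g)(x)=\frac{e^{i\pi(1-\beta)}}{\Gamma(\beta)}\Big(\frac{g(x)}{(b-x)^{1-\beta}}+(1-\beta)\int_x^b\frac{g(x)-g(u)}{(u-x)^{2-\beta}}du\Big),$$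 and $g_{b-}(x)=g(x)-g(b)$. If $D_{a+}^\beta f\in L_1[a,b]$ and $D_{b-}^{1-\beta}g_{b-}\in L_\infty[a,b]$, then $$\int_a^b f(x)\,dg(x)=e^{i\pi\beta}\int_a^b(D_{a+}^\beta f)(x)(D_{b-}^{1-\beta}g_{b-})(x)\,dx.$$ If $g$ is $\alpha$-H\"older continuous on $[a,b]$ and $\beta\in(1-\alpha,1)$, the integral is well defined for $f$ with $$\|f\|_{\beta;[a,b]}=\int_a^b\Big(\frac{|f(t)|}{(t-a)^\beta}+\int_a^t\frac{|f(t)-f(s)|}{(t-s)^{\beta+1}}ds\Big)dt<\infty,$$ and these are the admissible integrands. The paths of $B^H$ are a.s. $\alpha$-H\"older for every $\alpha<H$, so any $\beta\in(1-H,1)$ may be used. The assertion of the theorem includes the existence of both integrals on $[0,1]$. *)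

theory Defs
  imports "HOL-Probability.Probability"
begin

section \<open>Filtrations and processes on the time interval \<open>[0,1]\<close>\<close>

text \<open>
  Processes are functions \<open>X :: real \<Rightarrow> 'a \<Rightarrow> real\<close> (time first); only their values at times in
  \<open>[0,1]\<close> matter.  The library locale \<open>filtration\<close> is indexed by a whole type, hence the variant
  below.  The usual conditions (completeness, right continuity) are not required.
\<close>

definition stochastic_basis :: "'a measure \<Rightarrow> (real \<Rightarrow> 'a measure) \<Rightarrow> bool" where
  "stochastic_basis M F \<longleftrightarrow>
     prob_space M \<and>
     (\<forall>t\<in>{0..1}. subalgebra M (F t)) \<and>
     (\<forall>s t. 0 \<le> s \<longrightarrow> s \<le> t \<longrightarrow> t \<le> 1 \<longrightarrow> sets (F s) \<subseteq> sets (F t))"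

definition left_continuous_at_1 :: "'a measure \<Rightarrow> (real \<Rightarrow> 'a measure) \<Rightarrow> bool" where
  "left_continuous_at_1 M F \<longleftrightarrow>
     sigma_sets (space M) (\<Union>t\<in>{0..<1}. sets (F t)) = sets (F 1)"

definition adapted :: "(real \<Rightarrow> 'a measure) \<Rightarrow> (real \<Rightarrow> 'a \<Rightarrow> real) \<Rightarrow> bool" where
  "adapted F X \<longleftrightarrow> (\<forall>t\<in>{0..1}. X t \<in> borel_measurable (F t))"

definition ae_continuous_paths :: "'a measure \<Rightarrow> (real \<Rightarrow> 'a \<Rightarrow> real) \<Rightarrow> bool" where
  "ae_continuous_paths M X \<longleftrightarrow> (AE \<omega> in M. continuous_on {0..1} (\<lambda>t. X t \<omega>))"

definition wiener_process ::
  "'a measure \<Rightarrow> (real \<Rightarrow> 'a measure) \<Rightarrow> (real \<Rightarrow> 'a \<Rightarrow> real) \<Rightarrow> bool" where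
  "wiener_process M F W \<longleftrightarrow>
     adapted F W \<and>
     (AE \<omega> in M. W 0 \<omega> = 0) \<and>
     (\<forall>s t. 0 \<le> s \<longrightarrow> s < t \<longrightarrow> t \<le> 1 \<longrightarrow>
        distributed M lborel (\<lambda>\<omega>. W t \<omega> - W s \<omega>) (normal_density 0 (sqrt (t - s))) \<and>
        prob_space.indep_set M (sets (F s))
          {(\<lambda>\<omega>. W t \<omega> - W s \<omega>) -` A \<inter> space M | A. A \<in> sets borel}) \<and>
     ae_continuous_paths M W"

text \<open>Normal random variables; a variance equal to zero is allowed.\<close>

definition gaussian_rv :: "'a measure \<Rightarrow> ('a \<Rightarrow> real) \<Rightarrow> bool" where
  "gaussian_rv M X \<longleftrightarrow>
     X \<in> borel_measurable M \<and>
     ((\<exists>\<mu> \<sigma>. \<sigma> > 0 \<and> distributed M lborel X (normal_density \<mu> \<sigma>)) \<or>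
      (\<exists>\<mu>. AE \<omega> in M. X \<omega> = \<mu>))"

definition gaussian_process :: "'a measure \<Rightarrow> (real \<Rightarrow> 'a \<Rightarrow> real) \<Rightarrow> bool" where
  "gaussian_process M X \<longleftrightarrow>
     (\<forall>T c. finite T \<longrightarrow> T \<subseteq> {0..1} \<longrightarrow> gaussian_rv M (\<lambda>\<omega>. \<Sum>t\<in>T. c t * X t \<omega>))"

text \<open>
  Path continuity means that a continuous version is taken; Hoelder continuity of the paths of
  every order below \<open>H\<close> is then a consequence (Kolmogorov) and is not part of the definition.
\<close>

definition fractional_brownian_motion ::
  "'a measure \<Rightarrow> real \<Rightarrow> (real \<Rightarrow> 'a \<Rightarrow> real) \<Rightarrow> bool" where
  "fractional_brownian_motion M H B \<longleftrightarrow>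
     gaussian_process M B \<and>
     (\<forall>t\<in>{0..1}. (LINT \<omega>|M. B t \<omega>) = 0) \<and>
     (\<forall>s\<in>{0..1}. \<forall>t\<in>{0..1}.
        (LINT \<omega>|M. B s \<omega> * B t \<omega>) =
          (s powr (2 * H) + t powr (2 * H) - \<bar>t - s\<bar> powr (2 * H)) / 2) \<and>
     ae_continuous_paths M B"


section \<open>The generalized Lebesgue--Stieltjes integral\<close>

text \<open>
  Left- and right-sided Weyl derivatives of order \<open>\<beta>\<close>.  The integral below uses the right-sided
  one with order \<open>1 - \<beta>\<close>.  Since Bochner integrals that do not converge have value \<open>0\<close>, the
  convergence of the inner integrals is required separately in \<open>gls_integrable\<close>.
\<close>

definition left_kernel :: "real \<Rightarrow> (real \<Rightarrow> real) \<Rightarrow> real \<Rightarrow> real \<Rightarrow> real" where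
  "left_kernel \<beta> f x u = (f x - f u) / (x - u) powr (\<beta> + 1)"

definition right_kernel :: "real \<Rightarrow> (real \<Rightarrow> real) \<Rightarrow> real \<Rightarrow> real \<Rightarrow> real" where
  "right_kernel \<beta> g x u = (g x - g u) / (u - x) powr (\<beta> + 1)"

definition left_deriv :: "real \<Rightarrow> real \<Rightarrow> (real \<Rightarrow> real) \<Rightarrow> real \<Rightarrow> real" where
  "left_deriv \<beta> a f x =
     1 / Gamma (1 - \<beta>) *
       (f x / (x - a) powr \<beta> + \<beta> * (LINT u:{a..x}|lborel. left_kernel \<beta> f x u))"

definition right_deriv :: "real \<Rightarrow> real \<Rightarrow> (real \<Rightarrow> real) \<Rightarrow> real \<Rightarrow> complex" where
  "right_deriv \<beta> b g x =
     exp (\<i> * complex_of_real (pi * \<beta>)) / complex_of_real (Gamma (1 - \<beta>)) *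
       complex_of_real
         (g x / (b - x) powr \<beta> + \<beta> * (LINT u:{x..b}|lborel. right_kernel \<beta> g x u))"

definition gls_integrable ::
  "real \<Rightarrow> real \<Rightarrow> real \<Rightarrow> (real \<Rightarrow> real) \<Rightarrow> (real \<Rightarrow> real) \<Rightarrow> bool" where
  "gls_integrable \<beta> a b f g \<longleftrightarrow>
     (let gb = (\<lambda>x. g x - g b) in
       (AE x in lborel. x \<in> {a..b} \<longrightarrow> set_integrable lborel {a..x} (left_kernel \<beta> f x)) \<and>
       set_integrable lborel {a..b} (left_deriv \<beta> a f) \<and>
       (AE x in lborel. x \<in> {a..b} \<longrightarrow>
          set_integrable lborel {x..b} (right_kernel (1 - \<beta>) gb x)) \<and>
       set_borel_measurable lborel {a..b} (right_deriv (1 - \<beta>) b gb) \<and>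
       (\<exists>C. AE x in lborel. x \<in> {a..b} \<longrightarrow> cmod (right_deriv (1 - \<beta>) b gb x) \<le> C))"

definition gls_integral ::
  "real \<Rightarrow> real \<Rightarrow> real \<Rightarrow> (real \<Rightarrow> real) \<Rightarrow> (real \<Rightarrow> real) \<Rightarrow> complex" where
  "gls_integral \<beta> a b f g =
     exp (\<i> * complex_of_real (pi * \<beta>)) *
       (LINT x:{a..b}|lborel.
          complex_of_real (left_deriv \<beta> a f x) * right_deriv (1 - \<beta>) b (\<lambda>x. g x - g b) x)"

definition frac_norm :: "real \<Rightarrow> real \<Rightarrow> real \<Rightarrow> (real \<Rightarrow> real) \<Rightarrow> ennreal" where
  "frac_norm \<beta> a b f =
     (\<integral>\<^sup>+t\<in>{a..b}. (ennreal (\<bar>f t\<bar> / (t - a) powr \<beta>) +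
        (\<integral>\<^sup>+s\<in>{a..t}. ennreal (\<bar>f t - f s\<bar> / (t - s) powr (\<beta> + 1)) \<partial>lborel)) \<partial>lborel)"

definition gls_admissible :: "real \<Rightarrow> real \<Rightarrow> real \<Rightarrow> (real \<Rightarrow> real) \<Rightarrow> bool" where
  "gls_admissible \<beta> a b f \<longleftrightarrow>
     set_borel_measurable lborel {a..b} f \<and> frac_norm \<beta> a b f < \<infinity>"

text \<open>The two complex phase factors multiply to \<open>-1\<close>, so the integral is in fact real.\<close>

definition has_gls_integral ::
  "real \<Rightarrow> real \<Rightarrow> real \<Rightarrow> (real \<Rightarrow> real) \<Rightarrow> (real \<Rightarrow> real) \<Rightarrow> real \<Rightarrow> bool" where
  "has_gls_integral \<beta> a b f g I \<longleftrightarrow>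
     gls_admissible \<beta> a b f \<and> gls_integrable \<beta> a b f g \<and>
     gls_integral \<beta> a b f g = complex_of_real I"


section \<open>The Ito integral over \<open>[0,1]\<close>\<close>

definition ito_integrand ::
  "'a measure \<Rightarrow> (real \<Rightarrow> 'a measure) \<Rightarrow> (real \<Rightarrow> 'a \<Rightarrow> real) \<Rightarrow> bool" where
  "ito_integrand M F \<psi> \<longleftrightarrow>
     adapted F \<psi> \<and>
     (\<lambda>(t, \<omega>). \<psi> t \<omega>) \<in> borel_measurable (restrict_space borel {0..1} \<Otimes>\<^sub>M M) \<and>
     (AE \<omega> in M. (\<integral>\<^sup>+t\<in>{0..1}. ennreal ((\<psi> t \<omega>)\<^sup>2) \<partial>lborel) < \<infinity>)"

text \<open>
  The triple \<open>(n, \<tau>, \<eta>)\<close> encodes the simple process equal to \<open>\<eta> k\<close> on \<open>(\<tau> k, \<tau> (k+1)]\<close>, \<open>k < n\<close>,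
  and to \<open>0\<close> elsewhere.
\<close>

definition simple_integrand ::
  "(real \<Rightarrow> 'a measure) \<Rightarrow> nat \<Rightarrow> (nat \<Rightarrow> real) \<Rightarrow> (nat \<Rightarrow> 'a \<Rightarrow> real) \<Rightarrow> bool" where
  "simple_integrand F n \<tau> \<eta> \<longleftrightarrow>
     (\<forall>k\<le>n. 0 \<le> \<tau> k \<and> \<tau> k \<le> 1) \<and> (\<forall>k<n. \<tau> k < \<tau> (Suc k)) \<and>
     (\<forall>k<n. \<eta> k \<in> borel_measurable (F (\<tau> k)) \<and>
            (\<exists>C. \<forall>\<omega>\<in>space (F (\<tau> k)). \<bar>\<eta> k \<omega>\<bar> \<le> C))"

definition simple_process ::
  "nat \<Rightarrow> (nat \<Rightarrow> real) \<Rightarrow> (nat \<Rightarrow> 'a \<Rightarrow> real) \<Rightarrow> real \<Rightarrow> 'a \<Rightarrow> real" where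
  "simple_process n \<tau> \<eta> t \<omega> = (\<Sum>k<n. \<eta> k \<omega> * indicator {\<tau> k<..\<tau> (Suc k)} t)"

definition simple_ito_integral ::
  "(real \<Rightarrow> 'a \<Rightarrow> real) \<Rightarrow> nat \<Rightarrow> (nat \<Rightarrow> real) \<Rightarrow> (nat \<Rightarrow> 'a \<Rightarrow> real) \<Rightarrow> 'a \<Rightarrow> real" where
  "simple_ito_integral W n \<tau> \<eta> \<omega> = (\<Sum>k<n. \<eta> k \<omega> * (W (\<tau> (Suc k)) \<omega> - W (\<tau> k) \<omega>))"

text \<open>
  \<open>J\<close> is a version of the integral of \<open>\<psi>\<close> with respect to \<open>W\<close>: the limit in probability of the
  integrals of simple processes that approximate \<open>\<psi>\<close> in \<open>L\<^sup>2[0,1]\<close> in probability.  This determines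
  \<open>J\<close> up to null sets.
\<close>

definition has_ito_integral ::
  "'a measure \<Rightarrow> (real \<Rightarrow> 'a measure) \<Rightarrow> (real \<Rightarrow> 'a \<Rightarrow> real) \<Rightarrow>
   (real \<Rightarrow> 'a \<Rightarrow> real) \<Rightarrow> ('a \<Rightarrow> real) \<Rightarrow> bool" where
  "has_ito_integral M F W \<psi> J \<longleftrightarrow>
     ito_integrand M F \<psi> \<and> J \<in> borel_measurable M \<and>
     (\<exists>n \<tau> \<eta>.
        (\<forall>m. simple_integrand F (n m) (\<tau> m) (\<eta> m)) \<and>
        (\<forall>\<epsilon>>0. (\<lambda>m. measure M {\<omega> \<in> space M.
            (\<integral>\<^sup>+t\<in>{0..1}. ennreal ((simple_process (n m) (\<tau> m) (\<eta> m) t \<omega> - \<psi> t \<omega>)\<^sup>2) \<partial>lborel)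
              > ennreal \<epsilon>}) \<longlonglongrightarrow> 0) \<and>
        (\<forall>\<epsilon>>0. (\<lambda>m. measure M {\<omega> \<in> space M.
            \<bar>simple_ito_integral W (n m) (\<tau> m) (\<eta> m) \<omega> - J \<omega>\<bar> > \<epsilon>}) \<longlonglongrightarrow> 0))"


section \<open>The integral with respect to the sum\<close>

text \<open>
  \<open>I\<close> is a version of \<open>\<integral>\<psi> d(B + W)\<close> over \<open>[0,1]\<close>.  The order \<open>\<beta>\<close> is one and the same number in
  \<open>(1 - H, 1)\<close> for all paths; the value of the pathwise integral does not depend on it.
\<close>

definition has_mixed_integral ::
  "'a measure \<Rightarrow> (real \<Rightarrow> 'a measure) \<Rightarrow> real \<Rightarrow> (real \<Rightarrow> 'a \<Rightarrow> real) \<Rightarrow> (real \<Rightarrow> 'a \<Rightarrow> real) \<Rightarrow>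
   (real \<Rightarrow> 'a \<Rightarrow> real) \<Rightarrow> ('a \<Rightarrow> real) \<Rightarrow> bool" where
  "has_mixed_integral M F H B W \<psi> I \<longleftrightarrow>
     (\<exists>\<beta>\<in>{1 - H<..<1}. \<exists>K J.
        (AE \<omega> in M. has_gls_integral \<beta> 0 1 (\<lambda>t. \<psi> t \<omega>) (\<lambda>t. B t \<omega>) (K \<omega>)) \<and>
        has_ito_integral M F W \<psi> J \<and>
        (AE \<omega> in M. I \<omega> = K \<omega> + J \<omega>))"

end

theory Submission
  imports Defs
begin

text \<open>
  The integrand is piecewise constant. Let \<open>X = B + W\<close>, choose times \<open>a\<^sub>n\<close> tending to \<open>1\<close> and, by left
  continuity of the filtration, approximations \<open>Z\<^sub>n\<close> of \<open>\<xi>\<close> that are known at time \<open>a\<^sub>n\<close>. In a window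
  \<open>[a\<^sub>n, a\<^sub>n + h]\<close> a position of size \<open>\<Lambda> \<approx> D / (\<delta> \<surd>h)\<close> is held until the gain \<open>\<Lambda> (X\<^sub>t - X\<^bsub>a\<^sub>n\<^esub>)\<close> is close
  to the deficit \<open>D\<close> between \<open>Z\<^sub>n\<close> and the previous gains. With high probability \<open>W\<close> moves by more than
  \<open>\<delta> \<surd>h\<close> in both directions within the window, whereas \<open>B\<close>, which is Hoelder continuous of an order
  \<open>\<alpha> > 1/2\<close>, contributes only \<open>\<Lambda> h\<^sup>\<alpha> \<rightarrow> 0\<close>; so the target is hit, and by Borel--Cantelli all but finitely
  many windows succeed. For \<open>\<beta> < 1/2\<close> the fractional norm of the position is of order
  \<open>\<Lambda> h\<^bsup>1 - \<beta>\<^esup> \<approx> h\<^bsup>1/2 - \<beta>\<^esup>\<close>, which is made summable by the choice of \<open>h\<close>, and \<open>\<Lambda>\<^sup>2 h \<approx> (D / \<delta>)\<^sup>2\<close> is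
  summable since \<open>\<delta>\<close> depends on the failure probability only and \<open>D\<close> can be made small compared to it.
  The total gain converges to \<open>\<xi>\<close> and its \<open>B\<close>-part converges absolutely, so the \<open>W\<close>-part converges
  too, without any theory of stochastic integration.
\<close>

section \<open>The Wiener process on small time intervals\<close>

text \<open>The joint law of \<open>B\<close> and \<open>W\<close> is arbitrary, so \<open>B\<close>
  can enter only through pathwise bounds. Window length, grid and cap of the position have to be
  fixed before \<open>\<omega>\<close> is seen. This is why tightness, Hoelder continuity and the
  hitting estimate are stated with deterministic constants outside an event of prescribed small
  probability, and not merely almost surely. The constants depend on each other in a fixed order:
  failure probability, \<open>\<delta>\<close>, accuracy \<open>\<theta>\<close>, and then, window
  by window, length and grid. Since the deficit of a window is inherited from the accuracy of the
  window before it, \<open>\<theta> n\<close> has to be small compared with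
  \<open>\<delta> (Suc n)\<close> as well. A position is given up at a point of a deterministic
  grid, so that every partial sum is literally a simple process and its Ito integral a finite sum.
  The pathwise integral is defined through fractional derivatives; that it yields increments for
  step functions amounts to an Abel inversion, and the infinitely many steps are summed under the
  Lebesgue integral.\<close>

locale filtered_prob_space = prob_space M for M :: "'a measure" +
  fixes F :: "real \<Rightarrow> 'a measure"
  assumes basis: "stochastic_basis M F"
begin

lemma subalgebra_F: "t \<in> {0..1} \<Longrightarrow> subalgebra M (F t)"
  using basis by (auto simp: stochastic_basis_def)

lemma space_F: "t \<in> {0..1} \<Longrightarrow> space (F t) = space M"
  using subalgebra_F by (auto simp: subalgebra_def)

lemma sets_F_mono: "0 \<le> s \<Longrightarrow> s \<le> t \<Longrightarrow> t \<le> 1 \<Longrightarrow> sets (F s) \<subseteq> sets (F t)"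
  using basis by (auto simp: stochastic_basis_def)

lemma measurable_F_mono:
  "f \<in> measurable (F s) N \<Longrightarrow> 0 \<le> s \<Longrightarrow> s \<le> t \<Longrightarrow> t \<le> 1 \<Longrightarrow> f \<in> measurable (F t) N"
  using measurable_mono[of N N "F t" "F s"] sets_F_mono[of s t] space_F[of s] space_F[of t]
  by (auto simp: measurable_def)

lemma measurable_F_M: "f \<in> measurable (F t) N \<Longrightarrow> t \<in> {0..1} \<Longrightarrow> f \<in> measurable M N"
  using measurable_from_subalg subalgebra_F by blast

lemma sets_F_M: "A \<in> sets (F t) \<Longrightarrow> t \<in> {0..1} \<Longrightarrow> A \<in> sets M"
  using subalgebra_F[of t] by (auto simp: subalgebra_def)

end

section \<open>Normal increments and the size of the moves of \<open>W\<close>\<close>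

lemma (in prob_space) normal_even_moment:
  assumes X: "distributed M lborel X (normal_density 0 \<sigma>)" and \<sigma>: "\<sigma> > 0"
  shows "integrable M (\<lambda>\<omega>. X \<omega> ^ (2 * k))"
    and "expectation (\<lambda>\<omega>. X \<omega> ^ (2 * k)) = fact (2 * k) / (2 ^ k * fact k) * \<sigma> ^ (2 * k)"
proof -
  note moment = normal_moment_even[OF \<sigma>, of 0 k, simplified]
  show "integrable M (\<lambda>\<omega>. X \<omega> ^ (2 * k))"
    using distributed_integrable[OF X, of "\<lambda>x. x ^ (2 * k)"] moment by (auto simp: has_bochner_integral_iff)
  show "expectation (\<lambda>\<omega>. X \<omega> ^ (2 * k)) = fact (2 * k) / (2 ^ k * fact k) * \<sigma> ^ (2 * k)"
    using distributed_integral[OF X, of "\<lambda>x. x ^ (2 * k)"] moment \<sigma>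
    by (simp add: has_bochner_integral_iff power_divide power_mult[symmetric] field_simps)
qed

text \<open>The chance that an increment of \<open>W\<close> stays below one standard deviation;
  later only the decay of its powers matters.\<close>

definition normal_cdf_1 :: real where
  "normal_cdf_1 = measure (density lborel std_normal_density) {..1}"

lemma normal_cdf_1_less: "normal_cdf_1 < 1"
proof -
  interpret N: prob_space "density lborel std_normal_density"
    by (rule prob_space_normal_density) simp
  have "emeasure (density lborel std_normal_density) {1<..} \<noteq> 0"
  proof
    assume "emeasure (density lborel std_normal_density) {1<..} = 0"
    then have "{1<..} \<in> null_sets (density lborel std_normal_density)"
      by (simp add: null_sets_def)
    then have "AE x in lborel. x \<in> {1<..} \<longrightarrow> ennreal (std_normal_density x) = 0"
      by (subst (asm) null_sets_density_iff) auto
    moreover have "ennreal (std_normal_density x) \<noteq> 0" for x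
      using normal_density_pos[of 1 0 x] by (simp add: ennreal_eq_0_iff not_le)
    ultimately have "AE x in lborel. x \<notin> {1<..<2::real}" by auto
    then have "{1<..<2::real} \<in> null_sets lborel"
      by (subst AE_iff_null_sets) auto
    then show False using emeasure_lborel_Ioo[of 1 "2::real"] by (simp add: null_sets_def del: emeasure_lborel_Ioo)
  qed
  then have "N.prob {1<..} \<noteq> 0"
    by (simp add: N.emeasure_eq_measure)
  moreover have "N.prob {..1} = 1 - N.prob {1<..}"
    using N.prob_compl[of "{1<..}"] by (simp add: Compl_eq_Diff_UNIV[symmetric] Compl_greaterThan)
  ultimately show ?thesis
    unfolding normal_cdf_1_def using measure_nonneg[of "density lborel std_normal_density" "{1<..}"]
    by linarith
qed

context filtered_prob_space
begin

context
  fixes W assumes W: "wiener_process M F W"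
begin

lemma wiener_measurable: "t \<in> {0..1} \<Longrightarrow> W t \<in> borel_measurable (F t)"
  using W by (auto simp: wiener_process_def adapted_def)

lemma wiener_measurable_M: "t \<in> {0..1} \<Longrightarrow> W t \<in> borel_measurable M"
  using wiener_measurable measurable_F_M by blast

lemma wiener_increment:
  assumes "0 \<le> s" "s < t" "t \<le> 1"
  shows "distributed M lborel (\<lambda>\<omega>. W t \<omega> - W s \<omega>) (normal_density 0 (sqrt (t - s)))"
  using W assms by (auto simp: wiener_process_def)

lemma prob_wiener_increment_le:
  assumes "0 \<le> s" "s < t" "t \<le> 1"
  shows "prob {\<omega> \<in> space M. W t \<omega> - W s \<omega> \<le> sqrt (t - s)} = normal_cdf_1"
proof -
  have D: "distributed M lborel (\<lambda>\<omega>. (W t \<omega> - W s \<omega> - 0) / sqrt (t - s)) std_normal_density"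
    using wiener_increment[OF assms] assms
    by (subst normal_standard_normal_convert[symmetric]) auto
  have "{\<omega> \<in> space M. W t \<omega> - W s \<omega> \<le> sqrt (t - s)} =
      (\<lambda>\<omega>. (W t \<omega> - W s \<omega> - 0) / sqrt (t - s)) -` {..1} \<inter> space M"
    using assms by (auto simp: field_simps)
  moreover have "(\<lambda>\<omega>. (W t \<omega> - W s \<omega> - 0) / sqrt (t - s)) \<in> measurable M lborel"
    using D by (rule distributed_measurable)
  ultimately show ?thesis
    unfolding normal_cdf_1_def using measure_distr[of "\<lambda>\<omega>. (W t \<omega> - W s \<omega> - 0) / sqrt (t - s)" M lborel "{..1}"]
      distributed_distr_eq_density[OF D] by simp
qed

text \<open>Induction along the times: the event for the first \<open>j\<close> increments is known
  at time \<open>s j\<close>, and the next increment is independent of that sigma-algebra, so each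
  step contributes exactly one factor, whatever the spacing. Measurability is part of the claim
  because the induction needs it.\<close>

lemma wiener_increments_small:
  assumes s: "\<And>i. i \<le> m \<Longrightarrow> s i \<in> {0..1}" "\<And>i. i < m \<Longrightarrow> s i < s (Suc i)" and "j \<le> m"
  defines "A \<equiv> \<lambda>j. {\<omega> \<in> space M. \<forall>i<j. W (s (Suc i)) \<omega> - W (s i) \<omega> \<le> sqrt (s (Suc i) - s i)}"
  shows "A j \<in> sets (F (s j)) \<and> prob (A j) = normal_cdf_1 ^ j"
  using \<open>j \<le> m\<close>
proof (induction j)
  case 0
  have "A 0 = space (F (s 0))" using space_F s by (auto simp: A_def)
  then show ?case using space_F[of "s 0"] s(1)[of 0] prob_space sets.top[of "F (s 0)"] by simp
next
  case (Suc j)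
  let ?E = "{\<omega> \<in> space M. W (s (Suc j)) \<omega> - W (s j) \<omega> \<le> sqrt (s (Suc j) - s j)}"
  have sj: "0 \<le> s j" "s j < s (Suc j)" "s (Suc j) \<le> 1" "s j \<in> {0..1}" "s (Suc j) \<in> {0..1}"
    using s(1)[of j] s(1)[of "Suc j"] s(2)[of j] Suc.prems by auto
  have IH: "A j \<in> sets (F (s j))" "prob (A j) = normal_cdf_1 ^ j" using Suc by auto
  have eq: "A (Suc j) = A j \<inter> ?E" by (auto simp: A_def less_Suc_eq)
  have [measurable]: "W (s (Suc j)) \<in> borel_measurable (F (s (Suc j)))"
      "W (s j) \<in> borel_measurable (F (s (Suc j)))"
    using wiener_measurable sj measurable_F_mono[of "W (s j)" "s j" borel "s (Suc j)"] by auto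
  have "{\<omega> \<in> space (F (s (Suc j))). W (s (Suc j)) \<omega> - W (s j) \<omega> \<le> sqrt (s (Suc j) - s j)}
      \<in> sets (F (s (Suc j)))"
    by measurable
  then have "?E \<in> sets (F (s (Suc j)))" using space_F sj by simp
  moreover have "A j \<in> sets (F (s (Suc j)))" using IH sets_F_mono[of "s j" "s (Suc j)"] sj by auto
  ultimately have "A (Suc j) \<in> sets (F (s (Suc j)))" unfolding eq by auto
  moreover have "prob (A j \<inter> ?E) = prob (A j) * prob ?E"
  proof (rule indep_setD)
    show "indep_set (sets (F (s j)))
        {(\<lambda>\<omega>. W (s (Suc j)) \<omega> - W (s j) \<omega>) -` A \<inter> space M | A. A \<in> sets borel}"
      using W sj by (auto simp: wiener_process_def)
    show "?E \<in> {(\<lambda>\<omega>. W (s (Suc j)) \<omega> - W (s j) \<omega>) -` A \<inter> space M | A. A \<in> sets borel}"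
      by (rule CollectI, rule exI[of _ "{..sqrt (s (Suc j) - s j)}"]) auto
  qed (rule IH)
  ultimately show ?case
    using prob_wiener_increment_le[of "s j" "s (Suc j)"] sj IH by (simp add: eq)
qed

lemma wiener_chebyshev:
  assumes "0 \<le> s" "s < t" "t \<le> 1" "x > 0"
  shows "prob {\<omega> \<in> space M. \<bar>W t \<omega> - W s \<omega>\<bar> \<ge> x} \<le> (t - s) / x\<^sup>2"
proof -
  note m = normal_even_moment[OF wiener_increment[OF assms(1-3)], of 1]
  have "{\<omega> \<in> space M. \<bar>W t \<omega> - W s \<omega>\<bar> \<ge> x} = {\<omega> \<in> space M. (W t \<omega> - W s \<omega>) ^ 2 \<ge> x\<^sup>2}"
    using assms(4) by (auto simp flip: abs_le_square_iff)
  also have "prob \<dots> \<le> expectation (\<lambda>\<omega>. (W t \<omega> - W s \<omega>) ^ 2) / x\<^sup>2"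
    using m assms by (intro integral_Markov_inequality_measure[of _ _ "{}"]) auto
  also have "expectation (\<lambda>\<omega>. (W t \<omega> - W s \<omega>) ^ 2) = t - s"
    using m(2) assms by simp
  finally show ?thesis .
qed

text \<open>
  At the times \<open>a + h q\<^sup>i\<close> with small \<open>q\<close>, the increment between two consecutive scales dominates the
  value at the smaller one, and the increments are independent; so one of many scales produces a
  large value with high probability.
\<close>

lemma wiener_exceeds_aux:
  fixes m :: nat and q :: real
  assumes ah: "0 \<le> a" "0 < h" "a + h \<le> 1" and q: "0 < q" "q \<le> 1 / 2"
  defines "\<delta> \<equiv> sqrt (q ^ m / 2) / 2"
  shows "\<exists>E\<in>sets M. prob E \<le> normal_cdf_1 ^ m + real m * (8 * q) \<and>
    (\<forall>\<omega>\<in>space M - E. \<exists>t\<in>{a..a+h}. W t \<omega> - W a \<omega> \<ge> \<delta> * sqrt h)"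
proof -
  \<comment> \<open>The exponent \<open>m - i\<close> makes the times increase with
    \<open>i\<close>, from \<open>a + h * q ^ m\<close> up to \<open>s m = a + h\<close>.\<close>
  define s where "s i = a + h * q ^ (m - i)" for i
  have q1: "0 < q ^ k" "q ^ k \<le> 1" for k using q by (auto intro: power_le_one)
  have s_range: "s i \<in> {a<..a+h}" for i
    using ah q1[of "m - i"] by (auto simp: s_def mult_left_le)
  have s_mono: "s i < s (Suc i)" if "i < m" for i
  proof -
    have "m - i = Suc (m - Suc i)" using that by simp
    then have "q ^ (m - i) < q ^ (m - Suc i)" using q q1[of "m - Suc i"] by simp
    then show ?thesis using ah by (simp add: s_def)
  qed
  have s01: "s i \<in> {0..1}" for i using s_range[of i] ah by auto
  define A where "A = {\<omega> \<in> space M. \<forall>i<m. W (s (Suc i)) \<omega> - W (s i) \<omega> \<le> sqrt (s (Suc i) - s i)}"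
  \<comment> \<open>Failure of domination at scale \<open>i\<close>. The variance at the smaller
    scale divided by that of the increment is \<open>q / (1 - q)\<close>, so the Chebyshev bound is
    the same for all scales and all \<open>h\<close>.\<close>
  define C where "C i = {\<omega> \<in> space M. \<bar>W (s i) \<omega> - W a \<omega>\<bar> \<ge> sqrt (s (Suc i) - s i) / 2}" for i
  have A: "A \<in> sets M" "prob A = normal_cdf_1 ^ m"
    unfolding A_def using wiener_increments_small[of m s m, OF s01 s_mono order_refl] sets_F_M[OF _ s01, of _ m]
    by blast+
  have [measurable]: "W (s i) \<in> borel_measurable M" "W a \<in> borel_measurable M" for i
    using wiener_measurable_M s01 ah by auto
  have C[measurable]: "C i \<in> sets M" for i unfolding C_def by measurable
  have diff: "s (Suc i) - s i = h * (q ^ (m - Suc i) * (1 - q))" if "i < m" for i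
  proof -
    have "m - i = Suc (m - Suc i)" using that by simp
    then show ?thesis by (simp add: s_def algebra_simps)
  qed
  have PC: "prob (C i) \<le> 8 * q" if i: "i < m" for i
  proof -
    have d: "s (Suc i) - s i > 0" using s_mono[OF i] by simp
    have "prob (C i) \<le> (s i - a) / (sqrt (s (Suc i) - s i) / 2)\<^sup>2"
      unfolding C_def using d s_range[of i] ah by (intro wiener_chebyshev) auto
    also have "\<dots> = 4 * (s i - a) / (s (Suc i) - s i)"
      using d by (simp add: power_divide)
    also have "s i - a = h * (q ^ (m - Suc i) * q)"
      using i by (simp add: s_def flip: power_Suc2 Suc_diff_Suc)
    also have "4 * (h * (q ^ (m - Suc i) * q)) / (s (Suc i) - s i) = 4 * q / (1 - q)"
      unfolding diff[OF i] using ah q by simp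
    also have "\<dots> \<le> 8 * q" using q by (simp add: field_simps)
    finally show ?thesis .
  qed
  have PU: "prob (\<Union>i<m. C i) \<le> real m * (8 * q)"
  proof -
    have "prob (\<Union>i<m. C i) \<le> (\<Sum>i<m. prob (C i))"
      by (intro finite_measure_subadditive_finite) auto
    also have "\<dots> \<le> (\<Sum>i<m. 8 * q)" by (intro sum_mono PC) auto
    finally show ?thesis by simp
  qed
  show ?thesis
  proof (intro bexI[of _ "A \<union> (\<Union>i<m. C i)"] conjI ballI)
    show "A \<union> (\<Union>i<m. C i) \<in> sets M" using A C by auto
    have "prob (A \<union> (\<Union>i<m. C i)) \<le> prob A + prob (\<Union>i<m. C i)"
      using A C by (intro measure_Un_le) auto
    then show "prob (A \<union> (\<Union>i<m. C i)) \<le> normal_cdf_1 ^ m + real m * (8 * q)"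
      using PU A by simp
  next
    fix \<omega> assume \<omega>: "\<omega> \<in> space M - (A \<union> (\<Union>i<m. C i))"
    then obtain i where i: "i < m" "W (s (Suc i)) \<omega> - W (s i) \<omega> > sqrt (s (Suc i) - s i)"
      by (auto simp: A_def not_le)
    have "\<bar>W (s i) \<omega> - W a \<omega>\<bar> < sqrt (s (Suc i) - s i) / 2"
      using \<omega> i by (auto simp: C_def not_le)
    then have *: "W (s (Suc i)) \<omega> - W a \<omega> \<ge> sqrt (s (Suc i) - s i) / 2"
      using i by linarith
    \<comment> \<open>Every increment has length at least \<open>h * q ^ m / 2\<close>, because
      \<open>1 - q \<ge> 1 / 2\<close>; this is the origin of \<open>\<delta>\<close>.\<close>
    have "q ^ m \<le> q ^ (m - Suc i)" using q by (intro power_decreasing) auto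
    then have "q ^ m * (1 / 2) \<le> q ^ (m - Suc i) * (1 - q)"
      using q q1[of m] by (intro mult_mono) auto
    then have "sqrt (h * (q ^ m / 2)) \<le> sqrt (s (Suc i) - s i)"
      unfolding diff[OF i(1)] using ah by (intro real_sqrt_le_mono mult_left_mono) auto
    moreover have "sqrt (h * (q ^ m / 2)) = sqrt (q ^ m / 2) * sqrt h"
      by (simp only: real_sqrt_mult mult.commute)
    ultimately have "\<delta> * sqrt h \<le> sqrt (s (Suc i) - s i) / 2"
      unfolding \<delta>_def by linarith
    then show "\<exists>t\<in>{a..a+h}. W t \<omega> - W a \<omega> \<ge> \<delta> * sqrt h"
      using * s_range[of "Suc i"] by (intro bexI[of _ "s (Suc i)"]) auto
  qed
qed

text \<open>A large \<open>m\<close> makes it improbable that all increments are small; then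
  \<open>q\<close>, chosen for this \<open>m\<close>, makes the \<open>m\<close> failures of
  domination improbable. Both depend on \<open>\<epsilon>\<close> only, so one
  \<open>\<delta>\<close> serves all windows, in accordance with Brownian scaling.\<close>

lemma wiener_exceeds:
  assumes "\<epsilon> > 0"
  shows "\<exists>\<delta>>0. \<forall>a h. 0 \<le> a \<longrightarrow> 0 < h \<longrightarrow> a + h \<le> 1 \<longrightarrow> (\<exists>E\<in>sets M. prob E \<le> \<epsilon> \<and>
    (\<forall>\<omega>\<in>space M - E. \<exists>t\<in>{a..a+h}. W t \<omega> - W a \<omega> \<ge> \<delta> * sqrt h))"
proof -
  obtain m where m: "normal_cdf_1 ^ m < \<epsilon> / 2"
    using real_arch_pow_inv[OF _ normal_cdf_1_less, of "\<epsilon> / 2"] assms by auto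
  define q where "q = min (1 / 2) (\<epsilon> / (16 * (real m + 1)))"
  have q: "0 < q" "q \<le> 1 / 2" using assms min.cobounded1[of "1 / 2" "\<epsilon> / (16 * (real m + 1))"]
    unfolding q_def by (auto simp del: min.cobounded1)
  have "real m * (8 * q) \<le> real m * (8 * (\<epsilon> / (16 * (real m + 1))))"
    by (intro mult_left_mono) (auto simp: q_def)
  also have "\<dots> \<le> \<epsilon> / 2" using assms by (simp add: field_simps)
  finally have le: "normal_cdf_1 ^ m + real m * (8 * q) \<le> \<epsilon>" using m by simp
  show ?thesis
  proof (intro exI[of _ "sqrt (q ^ m / 2) / 2"] conjI allI impI)
    fix a h :: real assume "0 \<le> a" "0 < h" "a + h \<le> 1"
    from wiener_exceeds_aux[OF this q, of m] le
    show "\<exists>E\<in>sets M. prob E \<le> \<epsilon> \<and>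
        (\<forall>\<omega>\<in>space M - E. \<exists>t\<in>{a..a+h}. W t \<omega> - W a \<omega> \<ge> sqrt (q ^ m / 2) / 2 * sqrt h)"
      by (meson order_trans)
  qed (use q in auto)
qed

text \<open>Allows the estimate for upward moves to be applied to downward moves.\<close>

lemma wiener_uminus: "wiener_process M F (\<lambda>t \<omega>. - W t \<omega>)"
  unfolding wiener_process_def
proof (intro conjI allI impI)
  show "adapted F (\<lambda>t \<omega>. - W t \<omega>)" using wiener_measurable by (auto simp: adapted_def)
  show "AE \<omega> in M. - W 0 \<omega> = 0" using W by (auto simp: wiener_process_def)
  show "ae_continuous_paths M (\<lambda>t \<omega>. - W t \<omega>)"
    using W by (auto simp: wiener_process_def ae_continuous_paths_def intro: continuous_on_minus)
  fix s t :: real assume st: "0 \<le> s" "s < t" "t \<le> 1"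
  show "distributed M lborel (\<lambda>\<omega>. - W t \<omega> - - W s \<omega>) (normal_density 0 (sqrt (t - s)))"
    using normal_density_affine[OF wiener_increment[OF st], of "-1" 0] st by simp
  \<comment> \<open>A preimage under the negated increment is the preimage of the reflected Borel
    set under the increment itself, so independence is inherited by the subfamily.\<close>
  have "{(\<lambda>\<omega>. - W t \<omega> - - W s \<omega>) -` A \<inter> space M |A. A \<in> sets borel}
      \<subseteq> {(\<lambda>\<omega>. W t \<omega> - W s \<omega>) -` A \<inter> space M | A. A \<in> sets borel}"
  proof safe
    fix A :: "real set" assume "A \<in> sets borel"
    then have "uminus -` A \<inter> space borel \<in> sets borel" by (intro measurable_sets[of _ _ borel]) auto
    then show "\<exists>B. (\<lambda>\<omega>. - W t \<omega> - - W s \<omega>) -` A \<inter> space M = (\<lambda>\<omega>. W t \<omega> - W s \<omega>) -` B \<inter> space M \<and> B \<in> sets borel"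
      by (intro exI[of _ "uminus -` A"]) (auto simp: vimage_def)
  qed
  moreover have "indep_set (sets (F s)) {(\<lambda>\<omega>. W t \<omega> - W s \<omega>) -` A \<inter> space M | A. A \<in> sets borel}"
    using W st by (auto simp: wiener_process_def)
  ultimately show "indep_set (sets (F s)) {(\<lambda>\<omega>. - W t \<omega> - - W s \<omega>) -` A \<inter> space M | A. A \<in> sets borel}"
    unfolding indep_sets2_eq by (meson subset_eq)
qed

end

end

section \<open>Hoelder continuity of the paths\<close>

lemma dyadic_floor_step:
  fixes x :: real
  assumes "0 \<le> x"
  shows "\<lfloor>2 ^ Suc n * x\<rfloor> = 2 * \<lfloor>2 ^ n * x\<rfloor> \<or> \<lfloor>2 ^ Suc n * x\<rfloor> = 2 * \<lfloor>2 ^ n * x\<rfloor> + 1"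
proof -
  have "2 ^ Suc n * x = 2 * (2 ^ n * x)" by simp
  then show ?thesis by linarith
qed

text \<open>Let \<open>d n x\<close> be the dyadic point of level \<open>n\<close> to the left of
  \<open>x\<close>. Passing to the next level moves it by at most one interval of that level, so a
  geometric tail bounds \<open>f x - f (d n x)\<close>, where continuity is used to reach
  \<open>x\<close>. For the two given points, \<open>d n x\<close> and \<open>d n y\<close> coincide
  or are neighbours. The constant is one neighbour step plus two tails.\<close>

lemma dyadic_chaining:
  fixes f :: "real \<Rightarrow> real"
  assumes cont: "continuous_on {0..1} f" and r: "0 < r" "r < 1" and L: "0 \<le> L"
    and inc: "\<And>n k. k < 2 ^ n \<Longrightarrow> \<bar>f ((real k + 1) / 2 ^ n) - f (real k / 2 ^ n)\<bar> \<le> L * r ^ n"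
    and xy: "x \<in> {0..1}" "y \<in> {0..1}" "\<bar>x - y\<bar> \<le> 1 / 2 ^ n"
  shows "\<bar>f x - f y\<bar> \<le> L * (1 + 2 * r / (1 - r)) * r ^ n"
proof -
  define d where "d n x = real_of_int \<lfloor>2 ^ n * x\<rfloor> / 2 ^ n" for n :: nat and x :: real
  have incz: "\<bar>f ((real_of_int k + 1) / 2 ^ n) - f (real_of_int k / 2 ^ n)\<bar> \<le> L * r ^ n"
    if "0 \<le> k" "real_of_int k < 2 ^ n" for k :: int and n
  proof -
    have "nat k < 2 ^ n" using that by (simp add: nat_less_iff)
    then show ?thesis using inc[of "nat k" n] that by simp
  qed
  have d_bounds: "d n x \<le> x" "x - d n x < 1 / 2 ^ n" for n x
  proof -
    have "real_of_int \<lfloor>2 ^ n * x\<rfloor> \<le> 2 ^ n * x" "2 ^ n * x < real_of_int \<lfloor>2 ^ n * x\<rfloor> + 1"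
      by linarith+
    then show "d n x \<le> x" by (simp add: d_def field_simps)
    have "x - d n x = (2 ^ n * x - real_of_int \<lfloor>2 ^ n * x\<rfloor>) / 2 ^ n" by (simp add: d_def field_simps)
    also have "\<dots> < 1 / 2 ^ n"
      by (intro divide_strict_right_mono) (linarith, simp)
    finally show "x - d n x < 1 / 2 ^ n" .
  qed
  have d01: "d n x \<in> {0..1}" if "x \<in> {0..1}" for n x
  proof -
    have "0 \<le> d n x" using that by (simp add: d_def)
    then show ?thesis using d_bounds(1)[of n x] that by auto
  qed
  have step: "\<bar>f (d (Suc n) x) - f (d n x)\<bar> \<le> L * r ^ Suc n" if x: "x \<in> {0..1}" for n x
  proof -
    define k where "k = \<lfloor>2 ^ n * x\<rfloor>"
    have k0: "0 \<le> k" using x by (simp add: k_def)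
    consider "\<lfloor>2 ^ Suc n * x\<rfloor> = 2 * k" | "\<lfloor>2 ^ Suc n * x\<rfloor> = 2 * k + 1"
      using dyadic_floor_step[of x n] x by (auto simp: k_def)
    then show ?thesis
    proof cases
      case 1
      then have "d (Suc n) x = d n x" unfolding d_def by (simp add: k_def)
      then show ?thesis using L r by simp
    next
      case 2
      have "real_of_int (2 * k + 1) \<le> 2 ^ Suc n * x" unfolding 2[symmetric] by linarith
      also have "\<dots> \<le> 2 ^ Suc n" using x by (simp add: mult_left_le)
      finally have "real_of_int (2 * k) < 2 ^ Suc n" by linarith
      from incz[OF _ this] k0
      have "\<bar>f ((real_of_int (2 * k) + 1) / 2 ^ Suc n) - f (real_of_int (2 * k) / 2 ^ Suc n)\<bar> \<le> L * r ^ Suc n"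
        by simp
      moreover have "(real_of_int (2 * k) + 1) / 2 ^ Suc n = d (Suc n) x" unfolding d_def 2 by simp
      moreover have "real_of_int (2 * k) / 2 ^ Suc n = d n x" unfolding d_def k_def by simp
      ultimately show ?thesis by simp
    qed
  qed
  have chain: "\<bar>f (d (n + j) x) - f (d n x)\<bar> \<le> (\<Sum>i<j. L * r ^ (n + Suc i))" if "x \<in> {0..1}" for n j x
  proof (induction j)
    case (Suc j)
    then show ?case using step[OF that, of "n + j"] by simp
  qed simp
  have geo: "(\<Sum>i<j. L * r ^ (n + Suc i)) \<le> L * (r / (1 - r)) * r ^ n" for n j
  proof -
    have "(\<Sum>i<j. L * r ^ (n + Suc i)) = L * r ^ Suc n * (\<Sum>i<j. r ^ i)"
      by (simp add: sum_distrib_left power_add mult_ac)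
    also have "(\<Sum>i<j. r ^ i) = (1 - r ^ j) / (1 - r)" using r by (simp add: sum_gp_strict)
    also have "L * r ^ Suc n * ((1 - r ^ j) / (1 - r)) \<le> L * r ^ Suc n * (1 / (1 - r))"
      using r L by (intro mult_left_mono divide_right_mono) auto
    finally show ?thesis by (simp add: mult_ac)
  qed
  have close: "\<bar>f x - f (d n x)\<bar> \<le> L * (r / (1 - r)) * r ^ n" if x: "x \<in> {0..1}" for n x
  proof (rule LIMSEQ_le_const2)
    have "(\<lambda>j. d (n + j) x) \<longlonglongrightarrow> x"
    proof (rule tendsto_sandwich[of "\<lambda>j. x - 1 / 2 ^ (n + j)" _ _ "\<lambda>_. x"])
      show "\<forall>\<^sub>F j in sequentially. x - 1 / 2 ^ (n + j) \<le> d (n + j) x"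
        using d_bounds(2)[of x "n + _"] by (intro always_eventually allI) (smt (verit))
      show "\<forall>\<^sub>F j in sequentially. d (n + j) x \<le> x"
        using d_bounds(1) by auto
      have "(\<lambda>j. (1 / 2 :: real) ^ (n + j)) \<longlonglongrightarrow> 0"
        by (subst add.commute, rule LIMSEQ_ignore_initial_segment, rule LIMSEQ_realpow_zero) auto
      then have "(\<lambda>j. x - (1 / 2) ^ (n + j)) \<longlonglongrightarrow> x - 0" by (intro tendsto_intros)
      then show "(\<lambda>j. x - 1 / 2 ^ (n + j)) \<longlonglongrightarrow> x" by (simp add: power_one_over)
    qed simp
    then have "(\<lambda>j. f (d (n + j) x)) \<longlonglongrightarrow> f x"
      using continuous_on_tendsto_compose[OF cont, of "\<lambda>j. d (n + j) x"] d01[OF x] x by auto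
    then show "(\<lambda>j. \<bar>f (d (n + j) x) - f (d n x)\<bar>) \<longlonglongrightarrow> \<bar>f x - f (d n x)\<bar>"
      by (intro tendsto_intros)
    show "\<exists>N. \<forall>j\<ge>N. \<bar>f (d (n + j) x) - f (d n x)\<bar> \<le> L * (r / (1 - r)) * r ^ n"
      using chain[OF x] geo order_trans by blast
  qed
  have neighbour: "\<bar>f (d n x) - f (d n y)\<bar> \<le> L * r ^ n"
    if xy: "x \<in> {0..1}" "y \<in> {0..1}" "x \<le> y" "y - x \<le> 1 / 2 ^ n" for x y
  proof -
    define k where "k = \<lfloor>2 ^ n * x\<rfloor>"
    have "2 ^ n * y \<le> 2 ^ n * x + 1" using xy by (simp add: field_simps)
    moreover have "2 ^ n * x \<le> 2 ^ n * y" using xy by simp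
    ultimately consider "\<lfloor>2 ^ n * y\<rfloor> = k" | "\<lfloor>2 ^ n * y\<rfloor> = k + 1"
      unfolding k_def by linarith
    then show ?thesis
    proof cases
      case 1
      then have "d n y = d n x" by (simp add: d_def k_def)
      then show ?thesis using L r by simp
    next
      case 2
      have "real_of_int (k + 1) \<le> 2 ^ n * y" unfolding 2[symmetric] by linarith
      also have "\<dots> \<le> 2 ^ n" using xy by (simp add: mult_left_le)
      finally have "real_of_int k < 2 ^ n" by linarith
      from incz[OF _ this] xy
      have "\<bar>f ((real_of_int k + 1) / 2 ^ n) - f (real_of_int k / 2 ^ n)\<bar> \<le> L * r ^ n"
        by (simp add: k_def)
      moreover have "d n y = (real_of_int k + 1) / 2 ^ n" unfolding d_def 2 by simp
      moreover have "d n x = real_of_int k / 2 ^ n" unfolding d_def k_def by simp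
      ultimately show ?thesis by (simp add: abs_minus_commute)
    qed
  qed
  have "\<bar>f (d n x) - f (d n y)\<bar> \<le> L * r ^ n"
    using neighbour[of x y] neighbour[of y x] xy by (cases "x \<le> y") (auto simp: abs_minus_commute)
  moreover have "L * (1 + 2 * r / (1 - r)) * r ^ n = L * r ^ n + 2 * (L * (r / (1 - r)) * r ^ n)"
    by (simp add: algebra_simps)
  ultimately show ?thesis
    using close[OF xy(1), of n] close[OF xy(2), of n] by linarith
qed

text \<open>Powers of \<open>2 powr - \<alpha>\<close> turn into powers of the distance by chaining
  from the level \<open>n\<close> with
  \<open>1 / 2 ^ Suc n < \<bar>x - y\<bar> \<le> 1 / 2 ^ n\<close>; the mismatch of scales costs the
  factor \<open>2 powr \<alpha>\<close>.\<close>

lemma dyadic_holder: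
  fixes f :: "real \<Rightarrow> real"
  assumes cont: "continuous_on {0..1} f" and \<alpha>: "0 < \<alpha>" and L: "0 \<le> L"
    and inc: "\<And>n k. k < 2 ^ n \<Longrightarrow>
      \<bar>f ((real k + 1) / 2 ^ n) - f (real k / 2 ^ n)\<bar> \<le> L * (2 powr - \<alpha>) ^ n"
    and xy: "x \<in> {0..1}" "y \<in> {0..1}"
  defines "c \<equiv> 1 + 2 * 2 powr - \<alpha> / (1 - 2 powr - \<alpha>)"
  shows "\<bar>f x - f y\<bar> \<le> L * (c * 2 powr \<alpha>) * \<bar>x - y\<bar> powr \<alpha>"
proof (cases "x = y")
  case False
  define r :: real where "r = 2 powr - \<alpha>"
  have r: "0 < r" "r < 1" using \<alpha> by (auto simp: r_def powr_less_one)
  have "\<exists>n. (1 / 2 :: real) ^ n < \<bar>x - y\<bar>"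
    using real_arch_pow_inv[of "\<bar>x - y\<bar>" "1 / 2"] False by auto
  define m where "m = (LEAST n. (1 / 2 :: real) ^ n < \<bar>x - y\<bar>)"
  have m: "(1 / 2) ^ m < \<bar>x - y\<bar>" unfolding m_def using \<open>\<exists>n. _\<close> by (rule LeastI_ex)
  have "m \<noteq> 0" using m xy by (cases m) auto
  then obtain n where n: "m = Suc n" by (cases m) auto
  have "\<not> (1 / 2) ^ n < \<bar>x - y\<bar>" using not_less_Least[of n "\<lambda>n. (1 / 2) ^ n < \<bar>x - y\<bar>"] n unfolding m_def by simp
  then have le: "\<bar>x - y\<bar> \<le> 1 / 2 ^ n" by (simp add: power_one_over)
  have "r ^ n = 2 powr \<alpha> * (((1 / 2) ^ m) powr \<alpha>)"
  proof -
    have "(1 / 2 :: real) ^ m = 2 powr (- real m)" by (simp add: powr_minus powr_realpow power_one_over inverse_eq_divide)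
    moreover have "r ^ n = 2 powr (- \<alpha> * real n)" by (simp add: r_def powr_power mult.commute)
    ultimately show ?thesis by (simp add: powr_powr powr_add[symmetric] n algebra_simps)
  qed
  also have "\<dots> \<le> 2 powr \<alpha> * \<bar>x - y\<bar> powr \<alpha>"
    using m \<alpha> by (intro mult_left_mono powr_mono2) auto
  finally have rn: "r ^ n \<le> 2 powr \<alpha> * \<bar>x - y\<bar> powr \<alpha>" .
  have "\<bar>f x - f y\<bar> \<le> L * c * r ^ n"
    unfolding c_def using dyadic_chaining[OF cont r L inc[folded r_def] xy le] by (simp add: r_def)
  also have "\<dots> \<le> L * c * (2 powr \<alpha> * \<bar>x - y\<bar> powr \<alpha>)"
    using rn L r by (intro mult_left_mono) (auto simp: c_def r_def)
  finally show ?thesis by (simp add: mult_ac)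
qed simp

definition holder_on :: "real set \<Rightarrow> real \<Rightarrow> real \<Rightarrow> (real \<Rightarrow> real) \<Rightarrow> bool" where
  "holder_on S \<alpha> L f \<longleftrightarrow> 0 \<le> L \<and> (\<forall>x\<in>S. \<forall>y\<in>S. \<bar>f x - f y\<bar> \<le> L * \<bar>x - y\<bar> powr \<alpha>)"

lemma holder_onD: "holder_on S \<alpha> L f \<Longrightarrow> x \<in> S \<Longrightarrow> y \<in> S \<Longrightarrow> \<bar>f x - f y\<bar> \<le> L * \<bar>x - y\<bar> powr \<alpha>"
  by (auto simp: holder_on_def)

text \<open>Quantitative Kolmogorov criterion. The Markov inequality for the \<open>p\<close>-th
  power at the threshold \<open>L * r ^ n\<close> costs \<open>C / L * (\<rho> / 2) ^ n\<close> per
  dyadic interval, hence \<open>C / L * \<rho> ^ n\<close> per level, which is summable since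
  \<open>1 < real p * (\<gamma> - \<alpha>)\<close>. A large \<open>L\<close> makes the total at
  most \<open>\<epsilon>\<close>. That \<open>L\<close> does not depend on \<open>\<omega>\<close>
  is what the choice of window lengths requires.\<close>

lemma (in prob_space) kolmogorov_holder:
  fixes X :: "real \<Rightarrow> 'a \<Rightarrow> real"
  assumes meas: "\<And>t. t \<in> {0..1} \<Longrightarrow> random_variable borel (X t)"
    and cont: "AE \<omega> in M. continuous_on {0..1} (\<lambda>t. X t \<omega>)"
    and p: "even p" and \<alpha>: "0 < \<alpha>" "1 < real p * (\<gamma> - \<alpha>)" and C: "0 \<le> C"
    and int: "\<And>s t. s \<in> {0..1} \<Longrightarrow> t \<in> {0..1} \<Longrightarrow> s < t \<Longrightarrow> integrable M (\<lambda>\<omega>. (X t \<omega> - X s \<omega>) ^ p)"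
    and moment: "\<And>s t. s \<in> {0..1} \<Longrightarrow> t \<in> {0..1} \<Longrightarrow> s < t \<Longrightarrow>
      expectation (\<lambda>\<omega>. (X t \<omega> - X s \<omega>) ^ p) \<le> C * (t - s) powr (real p * \<gamma>)"
    and \<epsilon>: "\<epsilon> > 0"
  shows "\<exists>L. \<exists>E\<in>sets M. prob E \<le> \<epsilon> \<and> (\<forall>\<omega>\<in>space M - E. holder_on {0..1} \<alpha> L (\<lambda>t. X t \<omega>))"
proof -
  define r :: real where "r = 2 powr - \<alpha>"
  define \<rho> :: real where "\<rho> = 2 powr (1 - real p * (\<gamma> - \<alpha>))"
  have r: "0 < r" "r < 1" using \<alpha> by (auto simp: r_def powr_less_one)
  have \<rho>: "0 < \<rho>" "\<rho> < 1" using \<alpha> by (auto simp: \<rho>_def powr_less_one)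
  have p0: "p \<noteq> 0" using \<alpha> by (cases p) auto
  \<comment> \<open>The bound \<open>1 \<le> L\<close> allows \<open>L ^ p\<close> to be replaced by
    \<open>L\<close>; the other one makes the total \<open>C / L * (1 / (1 - \<rho>))\<close> at
    most \<open>\<epsilon>\<close>.\<close>
  define L where "L = max 1 (C / ((1 - \<rho>) * \<epsilon>))"
  have L: "1 \<le> L" "C / ((1 - \<rho>) * \<epsilon>) \<le> L" by (auto simp: L_def)
  obtain N where N: "N \<in> null_sets M" "\<And>\<omega>. \<omega> \<in> space M - N \<Longrightarrow> continuous_on {0..1} (\<lambda>t. X t \<omega>)"
    using AE_E3[OF cont] by blast
  define t where "t n k = real k / 2 ^ n" for n k :: nat
  have t01: "t n k \<in> {0..1}" if "k \<le> 2 ^ n" for n k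
    using that by (auto simp: t_def)
  define A where "A n k = {\<omega> \<in> space M. (X (t n (Suc k)) \<omega> - X (t n k) \<omega>) ^ p \<ge> (L * r ^ n) ^ p}" for n k
  define U where "U n = (\<Union>k<2^n. A n k)" for n
  have A[measurable]: "A n k \<in> sets M" if "k < 2 ^ n" for n k
  proof -
    have [measurable]: "random_variable borel (X (t n (Suc k)))" "random_variable borel (X (t n k))"
      using meas t01[of "Suc k" n] t01[of k n] that by auto
    show ?thesis unfolding A_def by measurable
  qed
  have U[measurable]: "U n \<in> sets M" for n unfolding U_def using A by auto
  have PA: "prob (A n k) \<le> C / L * (\<rho> / 2) ^ n" if k: "k < 2 ^ n" for n k
  proof -
    have tt: "t n (Suc k) \<in> {0..1}" "t n k \<in> {0..1}" "t n k < t n (Suc k)"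
      using t01[of "Suc k" n] t01[of k n] k by (auto simp: t_def divide_strict_right_mono)
    have "prob (A n k) \<le> expectation (\<lambda>\<omega>. (X (t n (Suc k)) \<omega> - X (t n k) \<omega>) ^ p) / (L * r ^ n) ^ p"
      unfolding A_def using int[OF tt(2,1,3)] r L p
      by (intro integral_Markov_inequality_measure[of _ _ "{}"]) (auto simp: zero_le_even_power)
    also have "\<dots> \<le> C * (t n (Suc k) - t n k) powr (real p * \<gamma>) / (L * r ^ n) ^ p"
      using moment[OF tt(2,1,3)] r L by (intro divide_right_mono) auto
    also have "t n (Suc k) - t n k = 2 powr (- real n)"
      by (simp add: t_def powr_minus powr_realpow field_simps)
    also have "(2 powr (- real n)) powr (real p * \<gamma>) = 2 powr (- real n * real p * \<gamma>)"
      by (simp add: powr_powr mult_ac)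
    also have "C * 2 powr (- real n * real p * \<gamma>) / (L * r ^ n) ^ p
        = C / L ^ p * (2 powr (- real n * real p * \<gamma>) / 2 powr (- \<alpha> * real n * real p))"
      by (simp add: r_def power_mult_distrib powr_power mult_ac flip: power_mult)
    also have "2 powr (- real n * real p * \<gamma>) / 2 powr (- \<alpha> * real n * real p) = (\<rho> / 2) ^ n"
    proof -
      have "\<rho> / 2 = 2 powr (- (real p * (\<gamma> - \<alpha>)))" by (simp add: \<rho>_def powr_diff powr_minus powr_add field_simps)
      then have "(\<rho> / 2) ^ n = 2 powr (- (real p * (\<gamma> - \<alpha>)) * real n)" by (simp add: powr_power mult.commute)
      then show ?thesis by (simp add: powr_diff[symmetric] algebra_simps)
    qed
    also have "C / L ^ p * (\<rho> / 2) ^ n \<le> C / L * (\<rho> / 2) ^ n"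
      using L C \<rho> p0 self_le_power[of L p] by (intro mult_right_mono divide_left_mono) auto
    finally show ?thesis .
  qed
  have PU: "prob (U n) \<le> C / L * \<rho> ^ n" for n
  proof -
    have "prob (U n) \<le> (\<Sum>k<2^n. prob (A n k))"
      unfolding U_def using A by (intro finite_measure_subadditive_finite) auto
    also have "\<dots> \<le> (\<Sum>k<2^n::nat. C / L * (\<rho> / 2) ^ n)" by (intro sum_mono PA) auto
    also have "\<dots> = C / L * \<rho> ^ n" by (simp add: power_divide)
    finally show ?thesis .
  qed
  have summ: "summable (\<lambda>n. C / L * \<rho> ^ n)" using \<rho> by (intro summable_mult summable_geometric) auto
  have summU: "summable (\<lambda>n. prob (U n))" by (rule summable_comparison_test'[OF summ, of 0]) (use PU in auto)
  have "prob (\<Union>n. U n) \<le> (\<Sum>n. prob (U n))"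
    using summU U by (intro finite_measure_subadditive_countably) auto
  also have "\<dots> \<le> (\<Sum>n. C / L * \<rho> ^ n)" using PU by (intro suminf_le summU summ) auto
  also have "\<dots> = C / L * (1 / (1 - \<rho>))" using \<rho> by (subst suminf_mult) (auto simp: suminf_geometric summable_geometric)
  also have "\<dots> \<le> \<epsilon>" using L \<rho> \<epsilon> by (simp add: field_simps)
  finally have PUU: "prob (\<Union>n. U n) \<le> \<epsilon>" .
  show ?thesis
  proof (intro exI bexI conjI ballI)
    show "(\<Union>n. U n) \<union> N \<in> sets M" using U N by auto
    show "prob ((\<Union>n. U n) \<union> N) \<le> \<epsilon>"
      using PUU N U by (subst measure_Un_null_set) auto
    fix \<omega> assume \<omega>: "\<omega> \<in> space M - ((\<Union>n. U n) \<union> N)"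
    show "holder_on {0..1} \<alpha> (L * ((1 + 2 * 2 powr - \<alpha> / (1 - 2 powr - \<alpha>)) * 2 powr \<alpha>)) (\<lambda>t. X t \<omega>)"
      unfolding holder_on_def
    proof (intro conjI ballI dyadic_holder)
      show "0 \<le> L * ((1 + 2 * 2 powr - \<alpha> / (1 - 2 powr - \<alpha>)) * 2 powr \<alpha>)"
        using L r by (auto simp: r_def[symmetric])
      show "continuous_on {0..1} (\<lambda>t. X t \<omega>)" using N \<omega> by auto
      fix n k :: nat assume k: "k < 2 ^ n"
      have "\<omega> \<notin> A n k" using \<omega> k by (auto simp: U_def)
      then have "\<bar>X (t n (Suc k)) \<omega> - X (t n k) \<omega>\<bar> ^ p < (L * r ^ n) ^ p"
        using \<omega> p by (auto simp: A_def power_even_abs)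
      then have "\<bar>X (t n (Suc k)) \<omega> - X (t n k) \<omega>\<bar> < L * r ^ n"
        by (rule power_less_imp_less_base) (use L r in auto)
      then show "\<bar>X ((real k + 1) / 2 ^ n) \<omega> - X (real k / 2 ^ n) \<omega>\<bar> \<le> L * (2 powr - \<alpha>) ^ n"
        by (simp add: t_def r_def add.commute)
    qed (use \<alpha> L in auto)
  qed
qed

text \<open>Serves for path continuity and for the oscillation between grid points, where any
  positive order suffices. Fourth moments reach the order \<open>1 / 8\<close> because
  \<open>4 * (1 / 2 - 1 / 8) = 3 / 2 > 1\<close>.\<close>

lemma (in filtered_prob_space) wiener_holder:
  assumes W: "wiener_process M F W" and \<epsilon>: "\<epsilon> > 0"
  shows "\<exists>L. \<exists>E\<in>sets M. prob E \<le> \<epsilon> \<and> (\<forall>\<omega>\<in>space M - E. holder_on {0..1} (1 / 8) L (\<lambda>t. W t \<omega>))"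
proof (rule kolmogorov_holder[where p = 4 and \<gamma> = "1 / 2" and C = 3])
  show "AE \<omega> in M. continuous_on {0..1} (\<lambda>t. W t \<omega>)"
    using W by (auto simp: wiener_process_def ae_continuous_paths_def)
  fix s t :: real assume st: "s \<in> {0..1}" "t \<in> {0..1}" "s < t"
  note m = normal_even_moment[OF wiener_increment[OF W, of s t], of 2]
  show "integrable M (\<lambda>\<omega>. (W t \<omega> - W s \<omega>) ^ 4)" using m(1) st by simp
  have "sqrt (t - s) ^ 4 = (t - s) powr (real 4 * (1 / 2))"
    using st by (simp add: power4_eq_xxxx power2_eq_square powr_numeral)
  then show "expectation (\<lambda>\<omega>. (W t \<omega> - W s \<omega>) ^ 4) \<le> 3 * (t - s) powr (real 4 * (1 / 2))"
    using m(2) st by (simp add: fact_numeral)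
qed (use wiener_measurable_M[OF W] \<epsilon> in auto)

text \<open>A Bochner integral that does not converge has value 0, so the prescribed covariances of
  \<open>B\<close> carry information only once square integrability is known. It follows from
  Gaussianity by expanding the square around the mean.\<close>

lemma (in prob_space) gaussian_rv_second_moment: 
  assumes "gaussian_rv M X"
  shows "integrable M (\<lambda>\<omega>. (X \<omega>)\<^sup>2)"
proof -
  have [measurable]: "random_variable borel X" using assms by (auto simp: gaussian_rv_def)
  from assms consider \<mu> \<sigma> where "\<sigma> > 0" "distributed M lborel X (normal_density \<mu> \<sigma>)"
    | \<mu> where "AE \<omega> in M. X \<omega> = \<mu>" by (auto simp: gaussian_rv_def)
  then show ?thesis
  proof cases
    case 1
    have "integrable lborel (\<lambda>x. normal_density \<mu> \<sigma> x * (x - \<mu>)\<^sup>2 + 2 * \<mu> * (normal_density \<mu> \<sigma> x * x) - \<mu>\<^sup>2 * normal_density \<mu> \<sigma> x)"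
      using integrable_normal_moment[OF 1(1), of \<mu> 2] integrable_normal_moment_nz_1[OF 1(1), of \<mu>]
      by (intro Bochner_Integration.integrable_add Bochner_Integration.integrable_diff
          Bochner_Integration.integrable_mult_right integrable_normal_density 1) auto
    also have "(\<lambda>x. normal_density \<mu> \<sigma> x * (x - \<mu>)\<^sup>2 + 2 * \<mu> * (normal_density \<mu> \<sigma> x * x) - \<mu>\<^sup>2 * normal_density \<mu> \<sigma> x)
        = (\<lambda>x. normal_density \<mu> \<sigma> x * x\<^sup>2)"
      by (auto simp: power2_eq_square algebra_simps)
    finally show ?thesis using distributed_integrable[OF 1(2), of "\<lambda>x. x\<^sup>2"] by simp
  next
    case 2
    then show ?thesis by (subst integrable_cong_AE[where g = "\<lambda>_. \<mu>\<^sup>2"]) auto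
  qed
qed

text \<open>Mean zero turns a degenerate variable into 0, so both cases of
  \<open>gaussian_rv\<close> obey one formula, with the second moment in the role of the variance
  parameter.\<close>

lemma (in prob_space) gaussian_rv_even_moment:
  assumes X: "gaussian_rv M X" and mean: "expectation X = 0"
  shows "integrable M (\<lambda>\<omega>. X \<omega> ^ (2 * k))"
    and "expectation (\<lambda>\<omega>. X \<omega> ^ (2 * k)) = fact (2 * k) / (2 ^ k * fact k) * expectation (\<lambda>\<omega>. (X \<omega>)\<^sup>2) ^ k"
proof -
  have [measurable]: "random_variable borel X" using X by (auto simp: gaussian_rv_def)
  from X consider \<mu> \<sigma> where "\<sigma> > 0" "distributed M lborel X (normal_density \<mu> \<sigma>)"
    | \<mu> where "AE \<omega> in M. X \<omega> = \<mu>" by (auto simp: gaussian_rv_def)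
  then have "integrable M (\<lambda>\<omega>. X \<omega> ^ (2 * k)) \<and> 
    expectation (\<lambda>\<omega>. X \<omega> ^ (2 * k)) = fact (2 * k) / (2 ^ k * fact k) * expectation (\<lambda>\<omega>. (X \<omega>)\<^sup>2) ^ k"
  proof cases
    case 1
    have "\<mu> = 0"
      using distributed_integral[OF 1(2), of "\<lambda>x. x"] integral_normal_moment_nz_1[OF 1(1), of \<mu>] mean by simp
    with 1 have D: "distributed M lborel X (normal_density 0 \<sigma>)" by simp
    show ?thesis
      using normal_even_moment[OF D 1(1), of k] normal_even_moment[OF D 1(1), of 1]
      by (simp add: power_mult)
  next
    case 2
    have "expectation X = \<mu>" using 2 prob_space by (subst integral_cong_AE[where g = "\<lambda>_. \<mu>"]) auto
    with mean 2 have 0: "AE \<omega> in M. X \<omega> = 0" by simp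
    \<comment> \<open>All exponents at once; for \<open>j = 0\<close> the value is
      \<open>0 ^ 0 = 1\<close>.\<close>
    have "integrable M (\<lambda>\<omega>. X \<omega> ^ j) \<and> expectation (\<lambda>\<omega>. X \<omega> ^ j) = 0 ^ j" for j
    proof
      have ae: "AE \<omega> in M. X \<omega> ^ j = 0 ^ j" using 0 by auto
      show "integrable M (\<lambda>\<omega>. X \<omega> ^ j)" using ae by (subst integrable_cong_AE[where g = "\<lambda>_. 0 ^ j"]) auto
      show "expectation (\<lambda>\<omega>. X \<omega> ^ j) = 0 ^ j"
        using ae prob_space by (subst integral_cong_AE[where g = "\<lambda>_. 0 ^ j"]) auto
    qed
    from this[of "2 * k"] this[of 2] show ?thesis
      by (cases k) (simp_all add: prob_space)
  qed
  then show "integrable M (\<lambda>\<omega>. X \<omega> ^ (2 * k))"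
    "expectation (\<lambda>\<omega>. X \<omega> ^ (2 * k)) = fact (2 * k) / (2 ^ k * fact k) * expectation (\<lambda>\<omega>. (X \<omega>)\<^sup>2) ^ k"
    by auto
qed

text \<open>The covariances give Gaussian increments of variance
  \<open>(t - s) powr (2 * H)\<close>, so the moment of order \<open>2 * k\<close> scales with the
  exponent \<open>2 * k * H\<close>. A large \<open>k\<close> brings every order below
  \<open>H\<close> within reach of the Kolmogorov criterion.\<close>

lemma (in prob_space) fbm_holder:
  assumes B: "fractional_brownian_motion M H B" and \<alpha>: "0 < \<alpha>" "\<alpha> < H" and \<epsilon>: "\<epsilon> > 0"
  shows "\<exists>L. \<exists>E\<in>sets M. prob E \<le> \<epsilon> \<and> (\<forall>\<omega>\<in>space M - E. holder_on {0..1} \<alpha> L (\<lambda>t. B t \<omega>))"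
proof -
  have rv: "gaussian_rv M (\<lambda>\<omega>. \<Sum>t\<in>T. c t * B t \<omega>)" if "finite T" "T \<subseteq> {0..1}" for T c
    using B that by (auto simp: fractional_brownian_motion_def gaussian_process_def)
  have rv1: "gaussian_rv M (B t)" if "t \<in> {0..1}" for t
    using rv[of "{t}" "\<lambda>_. 1"] that by simp
  have meas[measurable]: "random_variable borel (B t)" if "t \<in> {0..1}" for t
    using rv1[OF that] by (auto simp: gaussian_rv_def)
  have sq: "integrable M (\<lambda>\<omega>. (B t \<omega>)\<^sup>2)" if "t \<in> {0..1}" for t
    using gaussian_rv_second_moment[OF rv1[OF that]] .
  have int1: "integrable M (B t)" if "t \<in> {0..1}" for t
    using square_integrable_imp_integrable[OF meas[OF that] sq[OF that]] .
  have prod: "integrable M (\<lambda>\<omega>. B s \<omega> * B t \<omega>)" if st: "s \<in> {0..1}" "t \<in> {0..1}" for s t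
  proof (rule Bochner_Integration.integrable_bound)
    show "integrable M (\<lambda>\<omega>. (B s \<omega>)\<^sup>2 + (B t \<omega>)\<^sup>2)" using sq st by auto
    have "\<bar>x * y\<bar> \<le> x\<^sup>2 + y\<^sup>2" for x y :: real
      using sum_squares_bound[of x y] sum_squares_bound[of x "-y"] by (simp add: abs_le_iff)
    then show "AE \<omega> in M. norm (B s \<omega> * B t \<omega>) \<le> norm ((B s \<omega>)\<^sup>2 + (B t \<omega>)\<^sup>2)" by auto
  qed (use st in measurable)
  have cov: "expectation (\<lambda>\<omega>. B s \<omega> * B t \<omega>) = (s powr (2 * H) + t powr (2 * H) - \<bar>t - s\<bar> powr (2 * H)) / 2"
    if "s \<in> {0..1}" "t \<in> {0..1}" for s t
    using B that by (auto simp: fractional_brownian_motion_def)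
  have H: "H > 0" using \<alpha> by simp
  have inc: "gaussian_rv M (\<lambda>\<omega>. B t \<omega> - B s \<omega>)" "expectation (\<lambda>\<omega>. B t \<omega> - B s \<omega>) = 0"
    "expectation (\<lambda>\<omega>. (B t \<omega> - B s \<omega>)\<^sup>2) = (t - s) powr (2 * H)"
    if st: "s \<in> {0..1}" "t \<in> {0..1}" "s < t" for s t
  proof -
    show "gaussian_rv M (\<lambda>\<omega>. B t \<omega> - B s \<omega>)"
      using rv[of "{s, t}" "\<lambda>u. if u = t then 1 else -1"] st by simp
    show "expectation (\<lambda>\<omega>. B t \<omega> - B s \<omega>) = 0"
      using int1 st B by (subst Bochner_Integration.integral_diff) (auto simp: fractional_brownian_motion_def)
    have "(\<lambda>\<omega>. (B t \<omega> - B s \<omega>)\<^sup>2) = (\<lambda>\<omega>. B t \<omega> * B t \<omega> + B s \<omega> * B s \<omega> - 2 * (B s \<omega> * B t \<omega>))"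
      by (auto simp: power2_eq_square algebra_simps)
    then show "expectation (\<lambda>\<omega>. (B t \<omega> - B s \<omega>)\<^sup>2) = (t - s) powr (2 * H)"
      using prod st cov[of s s] cov[of t t] cov[of s t] H by simp
  qed
  obtain k :: nat where k: "1 / (2 * (H - \<alpha>)) < real k" using reals_Archimedean2 by blast
  show ?thesis
  proof (rule kolmogorov_holder[where p = "2 * k" and \<gamma> = H and C = "fact (2 * k) / (2 ^ k * fact k)"])
    show "AE \<omega> in M. continuous_on {0..1} (\<lambda>t. B t \<omega>)"
      using B by (auto simp: fractional_brownian_motion_def ae_continuous_paths_def)
    show "1 < real (2 * k) * (H - \<alpha>)" using k \<alpha> by (simp add: field_simps)
    fix s t :: real assume st: "s \<in> {0..1}" "t \<in> {0..1}" "s < t"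
    note m = gaussian_rv_even_moment[OF inc(1,2)[OF st], of k]
    show "integrable M (\<lambda>\<omega>. (B t \<omega> - B s \<omega>) ^ (2 * k))" by (rule m)
    show "expectation (\<lambda>\<omega>. (B t \<omega> - B s \<omega>) ^ (2 * k)) \<le> fact (2 * k) / (2 ^ k * fact k) * (t - s) powr (real (2 * k) * H)"
      unfolding m(2) inc(3)[OF st] using st by (simp add: powr_power mult_ac)
  qed (use \<alpha> \<epsilon> meas in auto)
qed

section \<open>Approximation of random variables along the filtration\<close>

context filtered_prob_space
begin

text \<open>The sets that can be approximated from times before 1 form a sigma-algebra: a complement
  has the same symmetric difference, a countable union is cut down to a finite one, and finitely
  many times below 1 have a maximum below 1.\<close>

lemma approximable_event:
  assumes lc: "left_continuous_at_1 M F" and A: "A \<in> sets (F 1)" and "\<epsilon> > 0"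
  shows "\<exists>t\<in>{0..<1}. \<exists>A'\<in>sets (F t). prob ((A - A') \<union> (A' - A)) \<le> \<epsilon>"
proof -
  have "A \<in> sigma_sets (space M) (\<Union>t\<in>{0..<1}. sets (F t))"
    using lc A by (simp add: left_continuous_at_1_def)
  then show ?thesis using \<open>\<epsilon> > 0\<close>
  proof (induction A arbitrary: \<epsilon>)
    case (Basic A)
    then obtain t where "t \<in> {0..<1}" "A \<in> sets (F t)" by auto
    then show ?case using Basic by (intro bexI[of _ t] bexI[of _ A]) auto
  next
    case Empty
    then show ?case by (intro bexI[of _ 0] bexI[of _ "{}"]) auto
  next
    case (Compl A)
    from Compl.IH[OF Compl.prems] obtain t A' where
      t: "t \<in> {0..<1}" "A' \<in> sets (F t)" "prob ((A - A') \<union> (A' - A)) \<le> \<epsilon>" by auto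
    have "A \<subseteq> space M"
      using sigma_sets_into_sp[OF _ Compl.hyps] sets.sets_into_space subalgebra_F
      by (force simp: subalgebra_def)
    moreover have "A' \<subseteq> space M" using sets.sets_into_space[OF t(2)] space_F[of t] t by auto
    ultimately have "(space M - A - (space M - A')) \<union> (space M - A' - (space M - A)) = (A - A') \<union> (A' - A)"
      by auto
    moreover have "space M - A' \<in> sets (F t)"
    proof -
      have "space (F t) = space M" using space_F[of t] t by simp
      from sets.compl_sets[OF t(2), unfolded this] show ?thesis .
    qed
    ultimately show ?case using t by (metis (no_types, lifting))
  next
    case (Union a)
    have a: "a i \<in> sets M" for i
    proof -
      have "a i \<in> sets (F 1)" using Union.hyps[of i] lc by (simp add: left_continuous_at_1_def)
      then show ?thesis using sets_F_M by simp
    qed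
    \<comment> \<open>What the first \<open>n\<close> sets leave uncovered gets one half of
      \<open>\<epsilon>\<close>, the approximations of these \<open>n\<close> sets share the other
      half.\<close>
    define R where "R n = (\<Union>i. a i) - (\<Union>i<n. a i)" for n
    have "(\<lambda>n. prob (R n)) \<longlonglongrightarrow> prob (\<Inter>n. R n)"
      using a by (intro finite_Lim_measure_decseq) (auto simp: R_def decseq_def)
    also have "(\<Inter>n. R n) = {}" by (auto simp: R_def)
    finally have "(\<lambda>n. prob (R n)) \<longlonglongrightarrow> 0" by simp
    from order_tendstoD(2)[OF this, of "\<epsilon> / 2"] Union.prems obtain n where n: "prob (R n) < \<epsilon> / 2"
      by (auto simp: eventually_sequentially)
    have "\<forall>i. \<exists>t A'. t \<in> {0..<1} \<and> A' \<in> sets (F t) \<and> prob ((a i - A') \<union> (A' - a i)) \<le> \<epsilon> / (2 * (real n + 1))"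
      using Union.IH Union.prems by (metis (no_types, lifting) add_pos_nonneg divide_pos_pos mult_pos_pos of_nat_0_le_iff zero_less_numeral zero_less_one add.commute)
    then obtain t A' where tA: "\<And>i. t i \<in> {0..<1}" "\<And>i. A' i \<in> sets (F (t i))"
      "\<And>i. prob ((a i - A' i) \<union> (A' i - a i)) \<le> \<epsilon> / (2 * (real n + 1))" by metis
    \<comment> \<open>Inserting 0 covers the empty family.\<close>
    define u where "u = Max (insert 0 (t ` {..<n}))"
    have u: "u \<in> {0..<1}" using tA(1) by (auto simp: u_def)
    have tu: "t i \<le> u" if "i < n" for i unfolding u_def by (rule Max_ge) (simp, use that in blast)
    define B where "B = (\<Union>i<n. A' i)"
    have "B \<in> sets (F u)"
      unfolding B_def using tA sets_F_mono[OF _ tu] u by (intro sets.finite_UN) force+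
    moreover have "prob ((\<Union>(range a) - B) \<union> (B - \<Union>(range a))) \<le> \<epsilon>"
    proof -
      have A': "A' i \<in> sets M" for i using sets_F_M[OF tA(2)[of i]] tA(1)[of i] by auto
      have "prob ((\<Union>(range a) - B) \<union> (B - \<Union>(range a))) \<le> prob (R n \<union> (\<Union>i<n. (a i - A' i) \<union> (A' i - a i)))"
        using a A' by (intro finite_measure_mono) (auto simp: R_def B_def)
      also have "\<dots> \<le> prob (R n) + prob (\<Union>i<n. (a i - A' i) \<union> (A' i - a i))"
        using a A' by (intro measure_Un_le) (auto simp: R_def)
      also have "prob (\<Union>i<n. (a i - A' i) \<union> (A' i - a i)) \<le> (\<Sum>i<n. prob ((a i - A' i) \<union> (A' i - a i)))"
        using a A' by (intro finite_measure_subadditive_finite) auto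
      also have "\<dots> \<le> (\<Sum>i<n. \<epsilon> / (2 * (real n + 1)))" by (intro sum_mono tA)
      also have "\<dots> \<le> \<epsilon> / 2" using Union.prems by (simp add: field_simps)
      finally show ?thesis using n by simp
    qed
    ultimately show ?case using u by auto
  qed
qed

text \<open>Round \<open>\<xi>\<close> down to multiples of \<open>\<epsilon>\<close>, cut off the
  large levels and replace each of the finitely many level sets by an event known earlier. Where the
  cut-off is inactive and all replacements are exact, just one indicator in \<open>Z\<close> is
  active and \<open>Z\<close> is the rounded value.\<close>

lemma approximable_rv:
  assumes lc: "left_continuous_at_1 M F" and \<xi>: "\<xi> \<in> borel_measurable (F 1)" and \<epsilon>: "\<epsilon> > 0"
  shows "\<exists>t\<in>{0..<1}. \<exists>Z\<in>borel_measurable (F t). prob {\<omega>\<in>space M. \<bar>Z \<omega> - \<xi> \<omega>\<bar> > \<epsilon>} \<le> \<epsilon>"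
proof -
  have \<xi>M[measurable]: "\<xi> \<in> borel_measurable M" using measurable_F_M[OF \<xi>] by simp
  define A where "A k = {\<omega>\<in>space M. \<lfloor>\<xi> \<omega> / \<epsilon>\<rfloor> = k}" for k
  have "A k \<in> sets (F 1)" for k
  proof -
    note \<xi>[measurable]
    have "{\<omega>\<in>space (F 1). \<lfloor>\<xi> \<omega> / \<epsilon>\<rfloor> = k} \<in> sets (F 1)" by measurable
    then show ?thesis using space_F[of 1] by (simp add: A_def)
  qed
  note A1 = this
  then have A[measurable]: "A k \<in> sets M" for k using sets_F_M by simp
  define R where "R n = {\<omega>\<in>space M. \<bar>\<lfloor>\<xi> \<omega> / \<epsilon>\<rfloor>\<bar> > int n}" for n
  have R_eq: "R n = space M - (\<Union>k\<in>{- int n..int n}. A k)" for n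
    by (auto simp: R_def A_def)
  have R[measurable]: "R n \<in> sets M" for n unfolding R_eq using A by auto
  have "(\<lambda>n. prob (R n)) \<longlonglongrightarrow> prob (\<Inter>n. R n)"
    using R by (intro finite_Lim_measure_decseq) (auto simp: R_def decseq_def)
  also have "(\<Inter>n. R n) = {}"
  proof -
    have "\<omega> \<notin> R (nat \<bar>\<lfloor>\<xi> \<omega> / \<epsilon>\<rfloor>\<bar>)" for \<omega> by (simp add: R_def)
    then show ?thesis by blast
  qed
  finally have "(\<lambda>n. prob (R n)) \<longlonglongrightarrow> 0" by simp
  from order_tendstoD(2)[OF this, of "\<epsilon> / 2"] \<epsilon> obtain n where n: "prob (R n) < \<epsilon> / 2"
    by (auto simp: eventually_sequentially)
  let ?I = "{- int n..int n}"
  \<comment> \<open>The levels share half of \<open>\<epsilon>\<close>; the other half pays for the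
    cut-off.\<close>
  define \<eta> where "\<eta> = \<epsilon> / (2 * (real (card ?I) + 1))"
  have "\<eta> > 0" using \<epsilon> by (auto simp: \<eta>_def intro!: divide_pos_pos add_nonneg_pos)
  have "\<forall>k. \<exists>t A'. t \<in> {0..<1} \<and> A' \<in> sets (F t) \<and> prob ((A k - A') \<union> (A' - A k)) \<le> \<eta>"
    using approximable_event[OF lc A1 \<open>\<eta> > 0\<close>] by blast
  then obtain t A' where tA: "\<And>i. t i \<in> {0..<1}" "\<And>i. A' i \<in> sets (F (t i))"
    "\<And>i. prob ((A i - A' i) \<union> (A' i - A i)) \<le> \<eta>" by metis
  define u where "u = Max (insert 0 (t ` ?I))"
  have u: "u \<in> {0..<1}" using tA(1) by (auto simp: u_def)
  have tu: "t i \<le> u" if "i \<in> ?I" for i unfolding u_def by (rule Max_ge) (simp, use that in blast)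
  have A'u: "A' i \<in> sets (F u)" if "i \<in> ?I" for i
    using tA(1,2)[of i] sets_F_mono[OF _ tu[OF that]] u by (meson atLeastLessThan_iff less_imp_le subsetD)
  have A': "A' i \<in> sets M" for i using sets_F_M[OF tA(2)[of i]] tA(1)[of i] by auto
  define Z where "Z \<omega> = (\<Sum>k\<in>?I. \<epsilon> * real_of_int k * indicator (A' k) \<omega>)" for \<omega>
  have "Z \<in> borel_measurable (F u)"
    unfolding Z_def using A'u by (intro borel_measurable_sum borel_measurable_times borel_measurable_const borel_measurable_indicator) auto
  moreover have "prob {\<omega>\<in>space M. \<bar>Z \<omega> - \<xi> \<omega>\<bar> > \<epsilon>} \<le> \<epsilon>"
  proof -
    let ?U = "\<Union>k\<in>?I. (A k - A' k) \<union> (A' k - A k)"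
    have "{\<omega>\<in>space M. \<bar>Z \<omega> - \<xi> \<omega>\<bar> > \<epsilon>} \<subseteq> R n \<union> ?U"
    proof (rule subsetI, rule ccontr)
      fix \<omega> assume \<omega>: "\<omega> \<in> {\<omega>\<in>space M. \<bar>Z \<omega> - \<xi> \<omega>\<bar> > \<epsilon>}" "\<omega> \<notin> R n \<union> ?U"
      have "Z \<omega> = (\<Sum>k\<in>?I. if k = \<lfloor>\<xi> \<omega> / \<epsilon>\<rfloor> then \<epsilon> * real_of_int k else 0)"
        unfolding Z_def
      proof (intro sum.cong refl)
        fix k assume k: "k \<in> ?I"
        then have "\<omega> \<in> A' k \<longleftrightarrow> \<omega> \<in> A k" using \<omega>(2) by blast
        then show "\<epsilon> * real_of_int k * indicator (A' k) \<omega> = (if k = \<lfloor>\<xi> \<omega> / \<epsilon>\<rfloor> then \<epsilon> * real_of_int k else 0)"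
          using \<omega>(1) by (simp add: A_def indicator_def eq_commute)
      qed
      also have "\<dots> = \<epsilon> * real_of_int \<lfloor>\<xi> \<omega> / \<epsilon>\<rfloor>"
      proof -
        have "\<bar>\<lfloor>\<xi> \<omega> / \<epsilon>\<rfloor>\<bar> \<le> int n" using \<omega> by (simp add: R_def)
        then have "\<lfloor>\<xi> \<omega> / \<epsilon>\<rfloor> \<in> ?I" by (simp add: abs_le_iff)
        then show ?thesis by (simp only: sum.delta finite_atLeastAtMost_int if_True)
      qed
      finally have "Z \<omega> = \<epsilon> * real_of_int \<lfloor>\<xi> \<omega> / \<epsilon>\<rfloor>" .
      moreover have "\<bar>real_of_int \<lfloor>\<xi> \<omega> / \<epsilon>\<rfloor> - \<xi> \<omega> / \<epsilon>\<bar> \<le> 1" by linarith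
      then have "\<epsilon> * \<bar>real_of_int \<lfloor>\<xi> \<omega> / \<epsilon>\<rfloor> - \<xi> \<omega> / \<epsilon>\<bar> \<le> \<epsilon> * 1" using \<epsilon> by (intro mult_left_mono) auto
      then have "\<bar>\<epsilon> * real_of_int \<lfloor>\<xi> \<omega> / \<epsilon>\<rfloor> - \<xi> \<omega>\<bar> \<le> \<epsilon>"
      proof -
        have "\<bar>\<epsilon> * (real_of_int \<lfloor>\<xi> \<omega> / \<epsilon>\<rfloor> - \<xi> \<omega> / \<epsilon>)\<bar> \<le> \<epsilon>"
          using \<open>\<epsilon> * \<bar>_\<bar> \<le> \<epsilon> * 1\<close> \<epsilon> by (simp only: abs_mult abs_of_pos mult_1_right)
        moreover have "\<epsilon> * (real_of_int \<lfloor>\<xi> \<omega> / \<epsilon>\<rfloor> - \<xi> \<omega> / \<epsilon>) = \<epsilon> * real_of_int \<lfloor>\<xi> \<omega> / \<epsilon>\<rfloor> - \<xi> \<omega>"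
          using \<epsilon> by (simp add: right_diff_distrib)
        ultimately show ?thesis by simp
      qed
      ultimately show False using \<omega> by auto
    qed
    then have "prob {\<omega>\<in>space M. \<bar>Z \<omega> - \<xi> \<omega>\<bar> > \<epsilon>} \<le> prob (R n \<union> ?U)"
      using A A' by (intro finite_measure_mono) auto
    also have "\<dots> \<le> prob (R n) + prob ?U" using A A' by (intro measure_Un_le) auto
    also have "prob ?U \<le> (\<Sum>k\<in>?I. prob ((A k - A' k) \<union> (A' k - A k)))"
      using A A' by (intro finite_measure_subadditive_finite) auto
    also have "\<dots> \<le> (\<Sum>k\<in>?I. \<eta>)" by (intro sum_mono tA)
    also have "\<dots> \<le> \<epsilon> / 2" using \<epsilon> by (simp add: \<eta>_def field_simps)
    finally show ?thesis using n by simp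
  qed
  ultimately show ?thesis using u by blast
qed

end

section \<open>Abel inversion for the Marchaud derivative\<close>

lemma set_integrable_cmult:
  fixes f :: "'a \<Rightarrow> real"
  shows "set_integrable M A f \<Longrightarrow> set_integrable M A (\<lambda>x. c * f x)"
  by (cases "c = 0") (simp add: set_integrable_def, rule set_integrable_mult_right)

text \<open>The integrands to come are powers that may be singular at an end of the interval, so the
  primitive is differentiable only inside. Nonnegativity turns the gauge integral into a Lebesgue
  integral.\<close>

lemma nonneg_FTC_interior:
  fixes f F :: "real \<Rightarrow> real"
  assumes "a \<le> b" and cont: "continuous_on {a..b} F"
    and deriv: "\<And>x. a < x \<Longrightarrow> x < b \<Longrightarrow> (F has_real_derivative f x) (at x)"
    and nonneg: "\<And>x. a \<le> x \<Longrightarrow> x \<le> b \<Longrightarrow> 0 \<le> f x"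
    and [measurable]: "f \<in> borel_measurable borel"
  shows "set_integrable lborel {a..b} f" and "(LINT x:{a..b}|lborel. f x) = F b - F a"
proof -
  have *: "(f has_integral (F b - F a)) {a..b}"
    using assms(1) cont deriv
    by (intro fundamental_theorem_of_calculus_interior)
      (auto simp flip: has_real_derivative_iff_has_vector_derivative)
  have "0 \<le> F b - F a" using has_integral_nonneg[OF *] nonneg by auto
  moreover have "integral\<^sup>N lborel (\<lambda>x. indicator {a..b} x * f x) = ennreal (F b - F a)"
    using nonneg by (intro nn_integral_has_integral_lebesgue[OF _ *]) auto
  ultimately have "has_bochner_integral lborel (\<lambda>x. indicator {a..b} x * f x) (F b - F a)"
    using nonneg by (intro has_bochner_integral_nn_integral) (auto simp: indicator_def)
  then show "set_integrable lborel {a..b} f" "(LINT x:{a..b}|lborel. f x) = F b - F a"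
    by (auto simp: set_integrable_def set_lebesgue_integral_def has_bochner_integral_iff)
qed

section \<open>Integrals of powers\<close>

lemma powr_integral_left_end:
  fixes a b e :: real
  assumes "-1 < e" "a \<le> b"
  shows "set_integrable lborel {a..b} (\<lambda>u. (u - a) powr e)"
    and "(LINT u:{a..b}|lborel. (u - a) powr e) = (b - a) powr (e + 1) / (e + 1)"
proof -
  have cont: "continuous_on {a..b} (\<lambda>u. (u - a) powr (e + 1) / (e + 1))"
    using assms by (intro continuous_intros continuous_on_powr') auto
  have deriv: "((\<lambda>u. (u - a) powr (e + 1) / (e + 1)) has_real_derivative (x - a) powr e) (at x)" if "a < x" for x
    using that assms by (auto intro!: derivative_eq_intros)
  note * = nonneg_FTC_interior[OF assms(2) cont deriv]
  show "set_integrable lborel {a..b} (\<lambda>u. (u - a) powr e)" by (rule *) auto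
  have "(LINT u:{a..b}|lborel. (u - a) powr e) = (b - a) powr (e + 1) / (e + 1) - (a - a) powr (e + 1) / (e + 1)"
    by (rule *) auto
  then show "(LINT u:{a..b}|lborel. (u - a) powr e) = (b - a) powr (e + 1) / (e + 1)" by simp
qed

text \<open>The substitution \<open>x = c + (u - c) * t\<close> leads to the integral over the unit
  interval. For \<open>a + b = 1\<close> the dependence on the length of the interval disappears,
  which is what makes the Abel inversion work.\<close>

lemma beta_integral:
  fixes a b c u :: real
  assumes "0 < a" "0 < b" "c < u"
  shows "set_integrable lborel {c..u} (\<lambda>x. (x - c) powr (a - 1) * (u - x) powr (b - 1))"
    and "(LINT x:{c..u}|lborel. (x - c) powr (a - 1) * (u - x) powr (b - 1)) = (u - c) powr (a + b - 1) * Beta a b"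
proof -
  let ?B = "\<lambda>t::real. indicator {0..1} t *\<^sub>R (t powr (a - 1) * (1 - t) powr (b - 1))"
  let ?f = "\<lambda>x. indicator {c..u} x *\<^sub>R ((x - c) powr (a - 1) * (u - x) powr (b - 1))"
  have int: "set_integrable lborel {0..1} (\<lambda>t. t powr (a - 1) * (1 - t) powr (b - 1))"
    using integrable_Beta[OF assms(1,2)] .
  have "(LINT t:{0..1}|lborel. t powr (a - 1) * (1 - t) powr (b - 1)) = Beta a b"
    using set_borel_integral_eq_integral(2)[OF int] has_integral_Beta_real[OF assms(1,2)]
    by (simp add: integral_unique)
  with int have "has_bochner_integral lborel ?B (Beta a b)"
    by (simp add: set_integrable_def set_lebesgue_integral_def has_bochner_integral_iff)
  then have "has_bochner_integral lborel (\<lambda>t. (u - c) powr (a + b - 2) * ?B t) ((u - c) powr (a + b - 2) * Beta a b)"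
    by (rule has_bochner_integral_mult_right)
  also have "(\<lambda>t. (u - c) powr (a + b - 2) * ?B t) = (\<lambda>t. ?f (c + (u - c) * t))"
  proof
    fix t
    have "c \<le> c + (u - c) * t \<longleftrightarrow> 0 \<le> t" using assms by (simp add: zero_le_mult_iff)
    moreover have "c + (u - c) * t \<le> u \<longleftrightarrow> t \<le> 1"
    proof -
      have "c + (u - c) * t \<le> u \<longleftrightarrow> (u - c) * t \<le> (u - c) * 1" by (simp add: le_diff_eq add.commute)
      then show ?thesis using mult_le_cancel_left_pos[of "u - c" t 1] assms(3) by simp
    qed
    ultimately have ind: "c + (u - c) * t \<in> {c..u} \<longleftrightarrow> t \<in> {0..1}" by auto
    show "(u - c) powr (a + b - 2) * ?B t = ?f (c + (u - c) * t)"
    proof (cases "t \<in> {0..1}")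
      case True
      have "u - (c + (u - c) * t) = (u - c) * (1 - t)" by (simp add: algebra_simps)
      moreover have "(u - c) powr (a + b - 2) = (u - c) powr (a - 1) * (u - c) powr (b - 1)"
        by (simp add: powr_add[symmetric])
      ultimately show ?thesis using True ind assms by (simp add: powr_mult)
    qed (use ind in auto)
  qed
  finally have "has_bochner_integral lborel (\<lambda>t. ?f (c + (u - c) * t)) ((u - c) powr (a + b - 2) * Beta a b)" .
  moreover have "(u - c) powr (a + b - 2) * Beta a b = ((u - c) powr (a + b - 1) * Beta a b) /\<^sub>R \<bar>u - c\<bar>"
    using assms by (simp add: powr_diff divide_inverse[symmetric] field_simps powr_numeral power2_eq_square powr_add)
  ultimately have "has_bochner_integral lborel ?f ((u - c) powr (a + b - 1) * Beta a b)"
    using assms lborel_has_bochner_integral_real_affine_iff[of "u - c" ?f "(u - c) powr (a + b - 1) * Beta a b" c] by simp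
  then show "set_integrable lborel {c..u} (\<lambda>x. (x - c) powr (a - 1) * (u - x) powr (b - 1))"
    "(LINT x:{c..u}|lborel. (x - c) powr (a - 1) * (u - x) powr (b - 1)) = (u - c) powr (a + b - 1) * Beta a b"
    by (auto simp: set_integrable_def set_lebesgue_integral_def has_bochner_integral_iff)
qed

text \<open>The real factor of \<open>right_deriv \<gamma> 1 g\<close>.\<close>

definition marchaud :: "real \<Rightarrow> (real \<Rightarrow> real) \<Rightarrow> real \<Rightarrow> real" where
  "marchaud \<gamma> g x = g x / (1 - x) powr \<gamma> + \<gamma> * (LINT u:{x..1}|lborel. right_kernel \<gamma> g x u)"

lemma right_kernel_measurable[measurable]:
  assumes [measurable]: "g \<in> borel_measurable borel"
  shows "right_kernel \<gamma> g x \<in> borel_measurable borel"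
  unfolding right_kernel_def by measurable

lemma marchaud_measurable[measurable]:
  assumes [measurable]: "g \<in> borel_measurable borel"
  shows "marchaud \<gamma> g \<in> borel_measurable borel"
proof -
  \<comment> \<open>The moving domain \<open>{x..1}\<close> is written as the indicator of a region
    in the plane to obtain joint measurability.\<close>
  have "(\<lambda>x. LINT u|lborel. indicator {p::real\<times>real. fst p \<le> snd p \<and> snd p \<le> 1} (x, u) * ((g x - g u) / (u - x) powr (\<gamma> + 1)))
      \<in> borel_measurable borel"
    by (rule lborel.borel_measurable_lebesgue_integral) measurable
  also have "(\<lambda>x. LINT u|lborel. indicator {p::real\<times>real. fst p \<le> snd p \<and> snd p \<le> 1} (x, u) * ((g x - g u) / (u - x) powr (\<gamma> + 1)))
     = (\<lambda>x. LINT u:{x..1}|lborel. right_kernel \<gamma> g x u)"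
    unfolding set_lebesgue_integral_def right_kernel_def
    by (intro ext Bochner_Integration.integral_cong) (auto simp: indicator_def)
  finally show ?thesis unfolding marchaud_def by measurable
qed

lemma right_kernel_bound:
  assumes h: "holder_on {0..1} \<alpha> L g" and x: "x \<in> {0..1}" "u \<in> {x..1}"
  shows "\<bar>right_kernel \<gamma> g x u\<bar> \<le> L * (u - x) powr (\<alpha> - \<gamma> - 1)"
proof (cases "u = x")
  case False
  then have ux: "u > x" using x by auto
  have "\<bar>g x - g u\<bar> / (u - x) powr (\<gamma> + 1) \<le> L * \<bar>x - u\<bar> powr \<alpha> / (u - x) powr (\<gamma> + 1)"
    using holder_onD[OF h, of x u] x by (intro divide_right_mono) auto
  also have "\<dots> = L * (u - x) powr (\<alpha> - \<gamma> - 1)"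
    using ux by (simp add: powr_diff powr_add)
  finally show ?thesis by (simp add: right_kernel_def)
qed (use h in \<open>simp add: right_kernel_def holder_on_def\<close>)

lemma right_kernel_integrable:
  assumes h: "holder_on {0..1} \<alpha> L g" and x: "x \<in> {0..1}" and \<gamma>: "\<gamma> < \<alpha>"
    and [measurable]: "g \<in> borel_measurable borel"
  shows "set_integrable lborel {x..1} (right_kernel \<gamma> g x)"
proof (rule set_integrable_bound)
  show "set_integrable lborel {x..1} (\<lambda>u. L * (u - x) powr (\<alpha> - \<gamma> - 1))"
    using powr_integral_left_end(1)[of "\<alpha> - \<gamma> - 1" x 1] x \<gamma> by (intro set_integrable_cmult) auto
  show "AE u in lborel. u \<in> {x..1} \<longrightarrow> norm (right_kernel \<gamma> g x u) \<le> norm (L * (u - x) powr (\<alpha> - \<gamma> - 1))"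
    using right_kernel_bound[OF h x] h by (intro AE_I2) (auto simp: holder_on_def abs_mult)
qed (simp add: set_borel_measurable_def)

text \<open>Serves twice: as the bound on the right derivative that \<open>gls_integrable\<close>
  demands, and as the dominating constant in the passage to the limit. The condition
  \<open>g 1 = 0\<close> turns \<open>g x\<close> into an increment.\<close>

lemma marchaud_bound:
  assumes h: "holder_on {0..1} \<alpha> L g" and x: "x \<in> {0..1}" and \<gamma>: "0 < \<gamma>" "\<gamma> < \<alpha>"
    and [measurable]: "g \<in> borel_measurable borel" and g1: "g 1 = 0"
  shows "\<bar>marchaud \<gamma> g x\<bar> \<le> L + \<gamma> * (L / (\<alpha> - \<gamma>))"
proof -
  have L: "0 \<le> L" using h by (simp add: holder_on_def)
  have p1: "(1 - x) powr (\<alpha> - \<gamma>) \<le> 1" using x \<gamma> by (intro powr_le1) auto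
  have "\<bar>g x / (1 - x) powr \<gamma>\<bar> \<le> L * (1 - x) powr \<alpha> / (1 - x) powr \<gamma>"
    using holder_onD[OF h, of x 1] x g1 by (auto intro!: divide_right_mono simp: abs_divide)
  also have "\<dots> = L * (1 - x) powr (\<alpha> - \<gamma>)" by (simp add: powr_diff)
  also have "\<dots> \<le> L" using p1 L by (simp add: mult_left_le)
  finally have 1: "\<bar>g x / (1 - x) powr \<gamma>\<bar> \<le> L" .
  have int: "set_integrable lborel {x..1} (\<lambda>u. L * (u - x) powr (\<alpha> - \<gamma> - 1))"
    using powr_integral_left_end(1)[of "\<alpha> - \<gamma> - 1" x 1] x \<gamma> by (intro set_integrable_cmult) auto
  have "\<bar>LINT u:{x..1}|lborel. right_kernel \<gamma> g x u\<bar> \<le> (LINT u:{x..1}|lborel. \<bar>right_kernel \<gamma> g x u\<bar>)"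
    using set_integral_norm_bound[OF right_kernel_integrable[OF h x \<gamma>(2)]] by auto
  also have "\<dots> \<le> (LINT u:{x..1}|lborel. L * (u - x) powr (\<alpha> - \<gamma> - 1))"
    using right_kernel_bound[OF h x] right_kernel_integrable[OF h x \<gamma>(2)] int
    by (intro set_integral_mono set_integrable_abs) auto
  also have "\<dots> = L * ((1 - x) powr (\<alpha> - \<gamma>) / (\<alpha> - \<gamma>))"
    using powr_integral_left_end(2)[of "\<alpha> - \<gamma> - 1" x 1] x \<gamma> by simp
  also have "\<dots> \<le> L * (1 / (\<alpha> - \<gamma>))"
    using p1 L \<gamma> by (intro mult_left_mono divide_right_mono) auto
  finally have "\<gamma> * \<bar>LINT u:{x..1}|lborel. right_kernel \<gamma> g x u\<bar> \<le> \<gamma> * (L / (\<alpha> - \<gamma>))"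
    using \<gamma> by (intro mult_left_mono) auto
  then show ?thesis using 1 \<gamma> unfolding marchaud_def
    by (intro order_trans[OF abs_triangle_ineq] add_mono) (auto simp: abs_mult)
qed

lemma lipschitz_of_deriv:
  fixes \<phi> \<phi>' :: "real \<Rightarrow> real"
  assumes deriv: "\<And>u. (\<phi> has_real_derivative \<phi>' u) (at u)" and cont: "continuous_on UNIV \<phi>'"
  obtains K where "holder_on {0..1} 1 K \<phi>" "\<And>u. u \<in> {0..1} \<Longrightarrow> \<bar>\<phi>' u\<bar> \<le> K"
proof -
  have "bounded (\<phi>' ` {0..1})"
    by (intro compact_imp_bounded compact_continuous_image continuous_on_subset[OF cont]) auto
  then obtain K where "\<forall>u\<in>{0..1}. \<bar>\<phi>' u\<bar> \<le> K"
    by (auto simp: bounded_iff)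
  then have K: "\<bar>\<phi>' u\<bar> \<le> K" if "u \<in> {0..1}" for u using that by blast
  have "\<bar>\<phi> x - \<phi> y\<bar> \<le> K * \<bar>x - y\<bar>" if "x \<in> {0..1}" "y \<in> {0..1}" for x y
    using field_differentiable_bound[of "{0..1}" \<phi> \<phi>' K x y] K deriv that
    by (auto intro: has_field_derivative_at_within)
  then have "holder_on {0..1} 1 K \<phi>" using K[of 0] by (auto simp: holder_on_def powr_one)
  then show ?thesis using that K by blast
qed

text \<open>Integration by parts with the primitive \<open>\<Phi>\<close>. Its boundary value at
  \<open>x\<close> vanishes since \<open>\<phi>\<close> is Lipschitz and
  \<open>\<gamma> < 1\<close>; the one at 1 is \<open>- \<phi> x * (1 - x) powr - \<gamma>\<close>
  and cancels the first term of \<open>marchaud\<close>.\<close>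

lemma marchaud_smooth:
  fixes \<phi> \<phi>' :: "real \<Rightarrow> real"
  assumes deriv: "\<And>u. (\<phi> has_real_derivative \<phi>' u) (at u)" and cont: "continuous_on UNIV \<phi>'"
    and \<phi>1: "\<phi> 1 = 0" and \<gamma>: "0 < \<gamma>" "\<gamma> < 1" and x: "0 \<le> x" "x < 1"
  shows "marchaud \<gamma> \<phi> x = - (LINT u:{x..1}|lborel. \<phi>' u * (u - x) powr - \<gamma>)"
proof -
  obtain K where K: "holder_on {0..1} 1 K \<phi>" "\<And>u. u \<in> {0..1} \<Longrightarrow> \<bar>\<phi>' u\<bar> \<le> K"
    using lipschitz_of_deriv[OF deriv cont] by blast
  have K0: "0 \<le> K" using K(1) by (simp add: holder_on_def)
  have [measurable]: "\<phi> \<in> borel_measurable borel"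
    using deriv by (intro borel_measurable_continuous_onI continuous_at_imp_continuous_on) (auto intro: DERIV_isCont)
  have [measurable]: "\<phi>' \<in> borel_measurable borel"
    using cont by (rule borel_measurable_continuous_onI)
  have int1: "set_integrable lborel {x..1} (right_kernel \<gamma> \<phi> x)"
    using right_kernel_integrable[OF K(1)] x \<gamma> by auto
  have int2: "set_integrable lborel {x..1} (\<lambda>u. \<phi>' u * (u - x) powr - \<gamma>)"
  proof (rule set_integrable_bound)
    show "set_integrable lborel {x..1} (\<lambda>u. K * (u - x) powr - \<gamma>)"
      using powr_integral_left_end(1)[of "- \<gamma>" x 1] x \<gamma> by (intro set_integrable_cmult) auto
    show "AE u in lborel. u \<in> {x..1} \<longrightarrow> norm (\<phi>' u * (u - x) powr - \<gamma>) \<le> norm (K * (u - x) powr - \<gamma>)"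
      using K K0 x by (intro AE_I2) (auto simp: abs_mult intro!: mult_right_mono)
  qed (simp add: set_borel_measurable_def)
  \<comment> \<open>At \<open>u = x\<close> the value is 0, which is also the limit from the
    right.\<close>
  define \<Phi> where "\<Phi> u = (\<phi> u - \<phi> x) * (u - x) powr - \<gamma>" for u
  have "((\<lambda>u. \<phi>' u * (u - x) powr - \<gamma> + \<gamma> * right_kernel \<gamma> \<phi> x u) has_integral (\<Phi> 1 - \<Phi> x)) {x..1}"
  proof (rule fundamental_theorem_of_calculus_interior)
    show "continuous_on {x..1} \<Phi>"
      unfolding continuous_on_eq_continuous_within
    proof
      fix u assume u: "u \<in> {x..1}"
      show "continuous (at u within {x..1}) \<Phi>"
      proof (cases "u = x")
        case True
        have "(\<Phi> \<longlongrightarrow> 0) (at x within {x..1})"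
        proof (rule Lim_null_comparison)
          show "\<forall>\<^sub>F u in at x within {x..1}. norm (\<Phi> u) \<le> K * (u - x) powr (1 - \<gamma>)"
            unfolding eventually_at_filter
          proof (intro always_eventually allI impI)
            fix v assume v: "v \<noteq> x" "v \<in> {x..1}"
            have "\<bar>\<phi> v - \<phi> x\<bar> \<le> K * (v - x)"
              using holder_onD[OF K(1), of v x] v x by (auto simp: powr_one)
            then have "\<bar>\<phi> v - \<phi> x\<bar> * (v - x) powr - \<gamma> \<le> K * (v - x) * (v - x) powr - \<gamma>"
              by (intro mult_right_mono) auto
            also have "\<dots> = K * (v - x) powr (1 - \<gamma>)"
              using v by (simp add: powr_diff powr_minus powr_one divide_inverse)
            finally show "norm (\<Phi> v) \<le> K * (v - x) powr (1 - \<gamma>)" by (simp add: \<Phi>_def abs_mult)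
          qed
          have "continuous_on {x..1} (\<lambda>u. K * (u - x) powr (1 - \<gamma>))"
            using \<gamma> by (intro continuous_intros continuous_on_powr') auto
          then have "((\<lambda>u. K * (u - x) powr (1 - \<gamma>)) \<longlongrightarrow> K * (x - x) powr (1 - \<gamma>)) (at x within {x..1})"
            using x unfolding continuous_on_def by (meson atLeastAtMost_iff less_imp_le order_refl)
          then show "((\<lambda>u. K * (u - x) powr (1 - \<gamma>)) \<longlongrightarrow> 0) (at x within {x..1})" by simp
        qed
        then show ?thesis using True by (simp add: continuous_within \<Phi>_def)
      next
        case False
        have "isCont \<Phi> u" unfolding \<Phi>_def
          using False DERIV_isCont[OF deriv[of u]] by (intro continuous_intros) auto
        then show ?thesis by (rule continuous_at_imp_continuous_within)
      qed
    qed
    fix u assume u: "u \<in> {x<..<1}"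
    have "(\<Phi> has_real_derivative (\<phi>' u * (u - x) powr - \<gamma> + (\<phi> u - \<phi> x) * (- \<gamma> * (u - x) powr (- \<gamma> - 1)))) (at u)"
      unfolding \<Phi>_def using u by (auto intro!: derivative_eq_intros deriv)
    also have "(\<phi> u - \<phi> x) * (- \<gamma> * (u - x) powr (- \<gamma> - 1)) = \<gamma> * right_kernel \<gamma> \<phi> x u"
    proof -
      have "(u - x) powr (- \<gamma> - 1) = 1 / (u - x) powr (\<gamma> + 1)"
        using powr_minus_divide[of "u - x" "\<gamma> + 1"] by simp
      then show ?thesis by (simp add: right_kernel_def divide_inverse algebra_simps)
    qed
    finally show "(\<Phi> has_vector_derivative \<phi>' u * (u - x) powr - \<gamma> + \<gamma> * right_kernel \<gamma> \<phi> x u) (at u)"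
      by (simp add: has_real_derivative_iff_has_vector_derivative)
  qed (use x in auto)
  moreover have int3: "set_integrable lborel {x..1} (\<lambda>u. \<gamma> * right_kernel \<gamma> \<phi> x u)"
    using int1 \<gamma> by simp
  ultimately have "(LINT u:{x..1}|lborel. \<phi>' u * (u - x) powr - \<gamma> + \<gamma> * right_kernel \<gamma> \<phi> x u) = \<Phi> 1 - \<Phi> x"
    using set_borel_integral_eq_integral(2)[OF set_integral_add(1)[OF int2 int3]] by (simp add: integral_unique)
  then have "(LINT u:{x..1}|lborel. \<phi>' u * (u - x) powr - \<gamma>) + \<gamma> * (LINT u:{x..1}|lborel. right_kernel \<gamma> \<phi> x u)
      = - \<phi> x * (1 - x) powr - \<gamma>"
    using set_integral_add(2)[OF int2 int3] by (simp add: \<Phi>_def \<phi>1)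
  then show ?thesis unfolding marchaud_def by (simp add: powr_minus divide_inverse)
qed

text \<open>Insert \<open>marchaud_smooth\<close> and exchange the integrals over the triangle
  \<open>c \<le> x \<le> u \<le> 1\<close>. The inner integral is the constant
  \<open>Beta \<gamma> (1 - \<gamma>)\<close>; what remains is the integral of
  \<open>\<phi>'\<close>, that is \<open>- \<phi> c\<close>, and the two signs cancel.\<close>

lemma abel_inversion_smooth:
  fixes \<phi> \<phi>' :: "real \<Rightarrow> real"
  assumes deriv: "\<And>u. (\<phi> has_real_derivative \<phi>' u) (at u)" and cont: "continuous_on UNIV \<phi>'"
    and \<phi>1: "\<phi> 1 = 0" and \<gamma>: "0 < \<gamma>" "\<gamma> < 1" and c: "0 \<le> c" "c < 1"
  shows "(LINT x:{c..1}|lborel. (x - c) powr (\<gamma> - 1) * marchaud \<gamma> \<phi> x) = Gamma \<gamma> * Gamma (1 - \<gamma>) * \<phi> c"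
proof -
  obtain K where K: "\<And>u. u \<in> {0..1} \<Longrightarrow> \<bar>\<phi>' u\<bar> \<le> K"
    using lipschitz_of_deriv[OF deriv cont] by metis
  have [measurable]: "\<phi> \<in> borel_measurable borel"
    using deriv by (intro borel_measurable_continuous_onI continuous_at_imp_continuous_on) (auto intro: DERIV_isCont)
  have [measurable]: "\<phi>' \<in> borel_measurable borel"
    using cont by (rule borel_measurable_continuous_onI)
  define h where "h u x = indicator {p. c \<le> snd p \<and> snd p \<le> fst p \<and> fst p \<le> 1} (u, x) *
      (\<phi>' u * ((x - c) powr (\<gamma> - 1) * (u - x) powr - \<gamma>))" for u x :: real
  have h_meas[measurable]: "case_prod h \<in> borel_measurable (borel \<Otimes>\<^sub>M borel)"
    unfolding h_def by measurable
  define b where "b = Beta \<gamma> (1 - \<gamma>)"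
  \<comment> \<open>At \<open>u = c\<close> the slice shrinks to a point, so its integral is 0 and
    may differ from the formula; a single \<open>u\<close> is negligible.\<close>
  have slice: "integrable lborel (h u)" "(LINT x|lborel. h u x) = indicator {c..1} u * (\<phi>' u * b)"
    "(LINT x|lborel. norm (h u x)) = indicator {c..1} u * (\<bar>\<phi>' u\<bar> * b)" if "u \<noteq> c" for u
  proof -
    have "integrable lborel (h u) \<and> (LINT x|lborel. h u x) = indicator {c..1} u * (\<phi>' u * b) \<and>
      (LINT x|lborel. norm (h u x)) = indicator {c..1} u * (\<bar>\<phi>' u\<bar> * b)"
    proof (cases "u \<in> {c..1}")
      case True
      then have cu: "c < u" using that by auto
      note bi = beta_integral[OF \<gamma>(1) _ cu, of "1 - \<gamma>", simplified]
      have eq: "h u = (\<lambda>x. \<phi>' u * (indicator {c..u} x *\<^sub>R ((x - c) powr (\<gamma> - 1) * (u - x) powr - \<gamma>)))"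
        using True by (auto simp: h_def indicator_def fun_eq_iff)
      have eqn: "(\<lambda>x. norm (h u x)) = (\<lambda>x. \<bar>\<phi>' u\<bar> * (indicator {c..u} x *\<^sub>R ((x - c) powr (\<gamma> - 1) * (u - x) powr - \<gamma>)))"
        unfolding eq by (auto simp: abs_mult)
      show ?thesis
        unfolding eqn unfolding eq using bi \<gamma> True cu
        by (simp add: set_integrable_def set_lebesgue_integral_def b_def)
    next
      case False
      have "h u = (\<lambda>x. 0)" using False by (auto simp: h_def indicator_def fun_eq_iff)
      then show ?thesis using False by simp
    qed
    then show "integrable lborel (h u)" "(LINT x|lborel. h u x) = indicator {c..1} u * (\<phi>' u * b)"
      "(LINT x|lborel. norm (h u x)) = indicator {c..1} u * (\<bar>\<phi>' u\<bar> * b)" by auto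
  qed
  have ae: "AE u in lborel. u \<noteq> c" by (rule AE_lborel_singleton)
  have int\<phi>: "set_integrable lborel {c..1} (\<lambda>u. \<phi>' u)"
    by (intro borel_integrable_atLeastAtMost' continuous_on_subset[OF cont]) auto
  have "integrable (lborel \<Otimes>\<^sub>M lborel) (case_prod h)"
  proof (rule lborel_pair.Fubini_integrable)
    show "AE u in lborel. integrable lborel (\<lambda>x. case (u, x) of (u, x) \<Rightarrow> h u x)"
      using ae slice(1) by auto
    have "integrable lborel (\<lambda>u. indicator {c..1} u * (\<bar>\<phi>' u\<bar> * b))"
      using set_integrable_abs[OF int\<phi>] by (simp add: set_integrable_def mult.assoc[symmetric])
    moreover have "AE u in lborel. (LINT x|lborel. norm (h u x)) = indicator {c..1} u * (\<bar>\<phi>' u\<bar> * b)"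
      using ae slice(3) by auto
    ultimately show "integrable lborel (\<lambda>u. LINT x|lborel. norm (case (u, x) of (u, x) \<Rightarrow> h u x))"
      by (subst integrable_cong_AE[where g = "\<lambda>u. indicator {c..1} u * (\<bar>\<phi>' u\<bar> * b)"]) auto
  qed simp
  from lborel_pair.Fubini_integral[OF this]
  have "(LINT x|lborel. LINT u|lborel. h u x) = (LINT u|lborel. LINT x|lborel. h u x)" .
  also have "\<dots> = (LINT u|lborel. indicator {c..1} u * (\<phi>' u * b))"
    using ae slice(2) by (intro integral_cong_AE) auto
  also have "\<dots> = b * (LINT u:{c..1}|lborel. \<phi>' u)"
    by (simp add: set_lebesgue_integral_def mult_ac)
  also have "(LINT u:{c..1}|lborel. \<phi>' u) = \<phi> 1 - \<phi> c"
    unfolding set_lebesgue_integral_def using c deriv cont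
    by (intro integral_FTC_Icc)
      (auto simp flip: has_real_derivative_iff_has_vector_derivative
        intro: has_field_derivative_at_within continuous_on_subset)
  finally have 1: "(LINT x|lborel. LINT u|lborel. h u x) = - b * \<phi> c" by (simp add: \<phi>1)
  have 2: "(LINT u|lborel. h u x) = - (indicator {c..1} x *\<^sub>R ((x - c) powr (\<gamma> - 1) * marchaud \<gamma> \<phi> x))" if "x \<noteq> 1" for x
  proof (cases "x \<in> {c..1}")
    case True
    then have x: "0 \<le> x" "x < 1" using that c by auto
    have "(\<lambda>u. h u x) = (\<lambda>u. (x - c) powr (\<gamma> - 1) * (indicator {x..1} u *\<^sub>R (\<phi>' u * (u - x) powr - \<gamma>)))"
      using True by (auto simp: h_def indicator_def fun_eq_iff)
    then have "(LINT u|lborel. h u x) = (x - c) powr (\<gamma> - 1) * (LINT u:{x..1}|lborel. \<phi>' u * (u - x) powr - \<gamma>)"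
      by (simp add: set_lebesgue_integral_def)
    also have "\<dots> = (x - c) powr (\<gamma> - 1) * (- marchaud \<gamma> \<phi> x)"
      using marchaud_smooth[OF deriv cont \<phi>1 \<gamma> x] by simp
    finally show ?thesis using True by simp
  next
    case False
    have "(\<lambda>u. h u x) = (\<lambda>u. 0)" using False by (auto simp: h_def indicator_def fun_eq_iff)
    then show ?thesis using False by simp
  qed
  have "(LINT x|lborel. LINT u|lborel. h u x) = (LINT x|lborel. - (indicator {c..1} x *\<^sub>R ((x - c) powr (\<gamma> - 1) * marchaud \<gamma> \<phi> x)))"
  proof (rule integral_cong_AE)
    show "(\<lambda>x. LINT u|lborel. h u x) \<in> borel_measurable lborel"
      by (rule lborel.borel_measurable_lebesgue_integral) (simp add: h_def)
    show "AE x in lborel. (LINT u|lborel. h u x) = - (indicator {c..1} x *\<^sub>R ((x - c) powr (\<gamma> - 1) * marchaud \<gamma> \<phi> x))"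
      using AE_lborel_singleton[of 1] 2 by auto
  qed measurable
  then have "(LINT x:{c..1}|lborel. (x - c) powr (\<gamma> - 1) * marchaud \<gamma> \<phi> x) = b * \<phi> c"
    using 1 by (simp add: set_lebesgue_integral_def)
  then show ?thesis by (simp add: b_def Beta_def rGamma_inverse_Gamma)
qed

lemma holder_continuous:
  assumes h: "holder_on UNIV \<alpha> L g" and \<alpha>: "0 < \<alpha>"
  shows "continuous_on UNIV g"
  unfolding continuous_on_def
proof
  fix x :: real
  have "((\<lambda>u. g u - g x) \<longlongrightarrow> 0) (at x)"
  proof (rule Lim_null_comparison)
    show "\<forall>\<^sub>F u in at x. norm (g u - g x) \<le> L * \<bar>u - x\<bar> powr \<alpha>"
      using holder_onD[OF h] by auto
    have "((\<lambda>u. \<bar>u - x\<bar> powr \<alpha>) \<longlongrightarrow> 0 powr \<alpha>) (at x)"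
      using \<alpha> by (intro tendsto_powr' tendsto_eq_intros) auto
    then have "((\<lambda>u. L * \<bar>u - x\<bar> powr \<alpha>) \<longlongrightarrow> L * 0 powr \<alpha>) (at x)" by (rule tendsto_mult_left)
    then show "((\<lambda>u. L * \<bar>u - x\<bar> powr \<alpha>) \<longlongrightarrow> 0) (at x)" using \<alpha> by simp
  qed
  then show "(g \<longlongrightarrow> g x) (at x)" by (rule LIM_zero_cancel)
qed

text \<open>
  The smooth case is transferred by the moving averages \<open>x \<mapsto> (1 / p) \<integral>\<^sub>x\<^sup>x\<^sup>+\<^sup>p g\<close>: they inherit the Hoelder
  constant of \<open>g\<close>, which dominates all integrands.
\<close>

lemma abel_inversion:
  fixes g :: "real \<Rightarrow> real"
  assumes h: "holder_on UNIV \<alpha> L g" and g1: "\<And>u. 1 \<le> u \<Longrightarrow> g u = 0"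
    and \<gamma>: "0 < \<gamma>" "\<gamma> < 1" "\<gamma> < \<alpha>" and c: "0 \<le> c" "c < 1"
  shows "(LINT x:{c..1}|lborel. (x - c) powr (\<gamma> - 1) * marchaud \<gamma> g x) = Gamma \<gamma> * Gamma (1 - \<gamma>) * g c"
proof -
  have L: "0 \<le> L" using h by (simp add: holder_on_def)
  have cont: "continuous_on UNIV g" using holder_continuous[OF h] \<gamma> by simp
  have [measurable]: "g \<in> borel_measurable borel" using cont by (rule borel_measurable_continuous_onI)
  \<comment> \<open>An antiderivative on the whole line, so that the moving averages are difference
    quotients of \<open>A\<close>.\<close>
  have "\<exists>A. \<forall>x::real. -\<infinity> < ereal x \<longrightarrow> ereal x < \<infinity> \<longrightarrow> (A has_vector_derivative g x) (at x)"
    using cont by (intro einterval_antiderivative) (auto simp: continuous_on_eq_continuous_at)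
  then obtain A where A: "\<And>x. (A has_real_derivative g x) (at x)"
    by (auto simp: has_real_derivative_iff_has_vector_derivative)
  define p where "p n = 1 / (real n + 1)" for n
  have p: "0 < p n" for n by (simp add: p_def)
  define \<phi> where "\<phi> n x = (A (x + p n) - A x) / p n" for n x
  have deriv: "(\<phi> n has_real_derivative (g (x + p n) - g x) / p n) (at x)" for n x
    unfolding \<phi>_def using A p[of n]
    by (auto intro!: derivative_eq_intros DERIV_chain2[OF A])
  have cont': "continuous_on UNIV (\<lambda>x. (g (x + p n) - g x) / p n)" for n
    using p[of n] by (intro continuous_intros continuous_on_compose2[OF cont]) auto
  \<comment> \<open>An average is a value of \<open>g\<close> slightly to the right. This gives the
    convergence and, as \<open>g\<close> vanishes beyond 1, the normalisation at 1.\<close>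
  have mean: "\<exists>z. x < z \<and> z < x + p n \<and> \<phi> n x = g z" for n x
    using MVT2[of x "x + p n" A g] A p[of n] by (force simp: \<phi>_def)
  have \<phi>1: "\<phi> n 1 = 0" for n using mean[of 1 n] g1 by auto
  have \<phi>h: "holder_on UNIV \<alpha> L (\<phi> n)" for n
    unfolding holder_on_def
  proof (intro conjI ballI L)
    fix x y
    \<comment> \<open>The mean value theorem is applied to the difference of the two shifted
      antiderivatives. So the same \<open>z\<close> serves both points and the constant
      \<open>L\<close> is kept.\<close>
    have "\<exists>z. 0 < z \<and> z < p n \<and> (A (x + p n) - A (y + p n)) - (A (x + 0) - A (y + 0)) = (p n - 0) * (g (x + z) - g (y + z))"
      by (rule MVT2[OF p]) (auto intro!: derivative_eq_intros DERIV_chain2[OF A])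
    then obtain z where z: "(A (x + p n) - A (y + p n)) - (A x - A y) = p n * (g (x + z) - g (y + z))" by auto
    have "\<phi> n x - \<phi> n y = ((A (x + p n) - A (y + p n)) - (A x - A y)) / p n"
      by (simp add: \<phi>_def diff_divide_distrib)
    also have "\<dots> = g (x + z) - g (y + z)" unfolding z using p[of n] by simp
    finally show "\<bar>\<phi> n x - \<phi> n y\<bar> \<le> L * \<bar>x - y\<bar> powr \<alpha>"
      using holder_onD[OF h, of "x + z" "y + z"] by simp
  qed
  have h01: "holder_on {0..1} \<alpha> L g" "holder_on {0..1} \<alpha> L (\<phi> n)" for n
    using h \<phi>h[of n] by (auto simp: holder_on_def)
  have [measurable]: "\<phi> n \<in> borel_measurable borel" for n
    using holder_continuous[OF \<phi>h[of n]] \<gamma> by (intro borel_measurable_continuous_onI) simp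
  have conv: "(\<lambda>n. \<phi> n x) \<longlonglongrightarrow> g x" for x
  proof (rule LIM_zero_cancel, rule Lim_null_comparison)
    show "\<forall>\<^sub>F n in sequentially. norm (\<phi> n x - g x) \<le> L * p n powr \<alpha>"
    proof (intro always_eventually allI)
      fix n
      obtain z where z: "x < z" "z < x + p n" "\<phi> n x = g z" using mean[of x n] by blast
      have "\<bar>g z - g x\<bar> \<le> L * \<bar>z - x\<bar> powr \<alpha>" using holder_onD[OF h] by simp
      also have "\<dots> \<le> L * p n powr \<alpha>" using z L \<gamma> by (intro mult_left_mono powr_mono2) auto
      finally show "norm (\<phi> n x - g x) \<le> L * p n powr \<alpha>" using z by simp
    qed
    have "p \<longlonglongrightarrow> 0" unfolding p_def using lim_inverse_n' LIMSEQ_Suc[OF lim_inverse_n'] by (simp add: add.commute)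
    then have "(\<lambda>n. p n powr \<alpha>) \<longlonglongrightarrow> 0 powr \<alpha>"
      using \<gamma> p by (intro tendsto_powr') (auto simp: less_imp_le)
    then have "(\<lambda>n. L * p n powr \<alpha>) \<longlonglongrightarrow> L * 0 powr \<alpha>" by (rule tendsto_mult_left)
    then show "(\<lambda>n. L * p n powr \<alpha>) \<longlonglongrightarrow> 0" using \<gamma> by simp
  qed
  have conv_m: "(\<lambda>n. marchaud \<gamma> (\<phi> n) x) \<longlonglongrightarrow> marchaud \<gamma> g x" if x: "x \<in> {0..1}" for x
  proof -
    have "(\<lambda>n. LINT u:{x..1}|lborel. right_kernel \<gamma> (\<phi> n) x u) \<longlonglongrightarrow> (LINT u:{x..1}|lborel. right_kernel \<gamma> g x u)"
      unfolding set_lebesgue_integral_def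
    proof (rule integral_dominated_convergence[where w = "\<lambda>u. indicator {x..1} u *\<^sub>R (L * (u - x) powr (\<alpha> - \<gamma> - 1))"])
      have "set_integrable lborel {x..1} (\<lambda>u. L * (u - x) powr (\<alpha> - \<gamma> - 1))"
        using powr_integral_left_end(1)[of "\<alpha> - \<gamma> - 1" x 1] x \<gamma> by (intro set_integrable_cmult) auto
      then show "integrable lborel (\<lambda>u. indicator {x..1} u *\<^sub>R (L * (u - x) powr (\<alpha> - \<gamma> - 1)))"
        by (simp add: set_integrable_def)
      show "AE u in lborel. (\<lambda>n. indicator {x..1} u *\<^sub>R right_kernel \<gamma> (\<phi> n) x u) \<longlonglongrightarrow> indicator {x..1} u *\<^sub>R right_kernel \<gamma> g x u"
        unfolding right_kernel_def divide_inverse by (intro AE_I2 tendsto_intros conv)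
      show "AE u in lborel. norm (indicator {x..1} u *\<^sub>R right_kernel \<gamma> (\<phi> n) x u) \<le> indicator {x..1} u *\<^sub>R (L * (u - x) powr (\<alpha> - \<gamma> - 1))" for n
        using right_kernel_bound[OF h01(2)[of n] x] by (intro AE_I2) (auto simp: indicator_def)
    qed measurable
    then show ?thesis unfolding marchaud_def divide_inverse by (intro tendsto_intros conv)
  qed
  define b where "b = L + \<gamma> * (L / (\<alpha> - \<gamma>))"
  have "(\<lambda>n. LINT x:{c..1}|lborel. (x - c) powr (\<gamma> - 1) * marchaud \<gamma> (\<phi> n) x) \<longlonglongrightarrow> (LINT x:{c..1}|lborel. (x - c) powr (\<gamma> - 1) * marchaud \<gamma> g x)"
    unfolding set_lebesgue_integral_def
  proof (rule integral_dominated_convergence[where w = "\<lambda>x. indicator {c..1} x *\<^sub>R (b * (x - c) powr (\<gamma> - 1))"])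
    have "set_integrable lborel {c..1} (\<lambda>u. b * (u - c) powr (\<gamma> - 1))"
      using powr_integral_left_end(1)[of "\<gamma> - 1" c 1] c \<gamma> by (intro set_integrable_cmult) auto
    then show "integrable lborel (\<lambda>x. indicator {c..1} x *\<^sub>R (b * (x - c) powr (\<gamma> - 1)))"
      by (simp add: set_integrable_def)
    show "AE x in lborel. (\<lambda>n. indicator {c..1} x *\<^sub>R ((x - c) powr (\<gamma> - 1) * marchaud \<gamma> (\<phi> n) x)) \<longlonglongrightarrow> indicator {c..1} x *\<^sub>R ((x - c) powr (\<gamma> - 1) * marchaud \<gamma> g x)"
    proof (intro AE_I2)
      fix x show "(\<lambda>n. indicator {c..1} x *\<^sub>R ((x - c) powr (\<gamma> - 1) * marchaud \<gamma> (\<phi> n) x)) \<longlonglongrightarrow> indicator {c..1} x *\<^sub>R ((x - c) powr (\<gamma> - 1) * marchaud \<gamma> g x)"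
        using c by (cases "x \<in> {c..1}") (auto intro!: tendsto_mult_left conv_m)
    qed
    show "AE x in lborel. norm (indicator {c..1} x *\<^sub>R ((x - c) powr (\<gamma> - 1) * marchaud \<gamma> (\<phi> n) x)) \<le> indicator {c..1} x *\<^sub>R (b * (x - c) powr (\<gamma> - 1))" for n
    proof (intro AE_I2)
      fix x
      show "norm (indicator {c..1} x *\<^sub>R ((x - c) powr (\<gamma> - 1) * marchaud \<gamma> (\<phi> n) x)) \<le> indicator {c..1} x *\<^sub>R (b * (x - c) powr (\<gamma> - 1))"
      proof (cases "x \<in> {c..1}")
        case True
        then have "\<bar>marchaud \<gamma> (\<phi> n) x\<bar> \<le> b"
          unfolding b_def using c by (intro marchaud_bound[OF h01(2)[of n] _ \<gamma>(1,3) _ \<phi>1]) auto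
        then have "(x - c) powr (\<gamma> - 1) * \<bar>marchaud \<gamma> (\<phi> n) x\<bar> \<le> (x - c) powr (\<gamma> - 1) * b"
          by (intro mult_left_mono) auto
        then show ?thesis using True by (simp add: abs_mult mult.commute)
      qed simp
    qed
  qed measurable
  moreover have "(LINT x:{c..1}|lborel. (x - c) powr (\<gamma> - 1) * marchaud \<gamma> (\<phi> n) x) = Gamma \<gamma> * Gamma (1 - \<gamma>) * \<phi> n c" for n
    by (rule abel_inversion_smooth[OF deriv cont' \<phi>1 \<gamma>(1,2) c])
  ultimately have "(\<lambda>n. Gamma \<gamma> * Gamma (1 - \<gamma>) * \<phi> n c) \<longlonglongrightarrow> (LINT x:{c..1}|lborel. (x - c) powr (\<gamma> - 1) * marchaud \<gamma> g x)"
    by simp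
  moreover have "(\<lambda>n. Gamma \<gamma> * Gamma (1 - \<gamma>) * \<phi> n c) \<longlonglongrightarrow> Gamma \<gamma> * Gamma (1 - \<gamma>) * g c"
    by (intro tendsto_intros conv)
  ultimately show ?thesis by (rule LIMSEQ_unique)
qed

text \<open>Constant continuation turns a path that is Hoelder on the interval into one that is
  Hoelder, hence Borel, on the line; subtracting the value at 1 makes it vanish to the right of 1,
  as \<open>abel_inversion\<close> asks. On \<open>{0..1}\<close> it is the shifted function of the
  pathwise integral.\<close>

definition clamp01 :: "(real \<Rightarrow> real) \<Rightarrow> real \<Rightarrow> real" where
  "clamp01 g u = g (max 0 (min u 1)) - g 1"

text \<open>The projection onto \<open>{0..1}\<close> does not increase distances.\<close>

lemma clamp01_holder:
  assumes h: "holder_on {0..1} \<alpha> L g" and "0 < \<alpha>"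
  shows "holder_on UNIV \<alpha> L (clamp01 g)"
  unfolding holder_on_def
proof (intro conjI ballI)
  show L: "0 \<le> L" using h by (simp add: holder_on_def)
  fix x y :: real
  have "\<bar>clamp01 g x - clamp01 g y\<bar> \<le> L * \<bar>max 0 (min x 1) - max 0 (min y 1)\<bar> powr \<alpha>"
    using holder_onD[OF h, of "max 0 (min x 1)" "max 0 (min y 1)"] by (simp add: clamp01_def)
  also have "\<dots> \<le> L * \<bar>x - y\<bar> powr \<alpha>"
    using L assms(2) by (intro mult_left_mono powr_mono2) auto
  finally show "\<bar>clamp01 g x - clamp01 g y\<bar> \<le> L * \<bar>x - y\<bar> powr \<alpha>" .
qed

lemma clamp01_eq: "x \<in> {0..1} \<Longrightarrow> clamp01 g x = g x - g 1"
  by (simp add: clamp01_def)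

lemma right_kernel_clamp01:
  "x \<in> {0..1} \<Longrightarrow> u \<in> {x..1} \<Longrightarrow> right_kernel \<gamma> (\<lambda>x. g x - g 1) x u = right_kernel \<gamma> (clamp01 g) x u"
  by (simp add: right_kernel_def clamp01_eq)

lemma marchaud_clamp01:
  assumes "x \<in> {0..1}"
  shows "marchaud \<gamma> (\<lambda>x. g x - g 1) x = marchaud \<gamma> (clamp01 g) x"
proof -
  have "(LINT u:{x..1}|lborel. right_kernel \<gamma> (\<lambda>x. g x - g 1) x u) = (LINT u:{x..1}|lborel. right_kernel \<gamma> (clamp01 g) x u)"
    using right_kernel_clamp01[OF assms] by (intro set_lebesgue_integral_cong) auto
  then show ?thesis using assms by (simp add: marchaud_def clamp01_eq)
qed

lemma right_deriv_marchaud: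
  assumes "x \<in> {0..1}"
  shows "right_deriv \<gamma> 1 (\<lambda>x. g x - g 1) x =
    exp (\<i> * complex_of_real (pi * \<gamma>)) / complex_of_real (Gamma (1 - \<gamma>)) * complex_of_real (marchaud \<gamma> (clamp01 g) x)"
  unfolding marchaud_clamp01[OF assms, symmetric] by (simp add: right_deriv_def marchaud_def)

text \<open>
  Up to the factor \<open>Gamma (1 - \<beta>)\<close>, the left derivative of order \<open>\<beta>\<close> of the indicator of \<open>(c, \<infinity>)\<close>.
\<close>

definition cut_powr :: "real \<Rightarrow> real \<Rightarrow> real \<Rightarrow> real" where
  "cut_powr \<beta> c x = (if c < x then (x - c) powr - \<beta> else 0)"

lemma cut_powr_measurable[measurable]: "cut_powr \<beta> c \<in> borel_measurable borel"
  unfolding cut_powr_def by measurable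

lemma cut_powr_integral:
  assumes "0 < \<beta>" "\<beta> < 1" "0 \<le> c" "c \<le> b"
  shows "set_integrable lborel {0..b} (cut_powr \<beta> c)"
    and "(LINT x:{0..b}|lborel. cut_powr \<beta> c x) = (b - c) powr (1 - \<beta>) / (1 - \<beta>)"
proof -
  have eq: "indicator {0..b} x *\<^sub>R cut_powr \<beta> c x = indicator {c..b} x *\<^sub>R (x - c) powr - \<beta>" for x
    using assms by (cases "x = c") (auto simp: cut_powr_def indicator_def)
  show "set_integrable lborel {0..b} (cut_powr \<beta> c)"
    "(LINT x:{0..b}|lborel. cut_powr \<beta> c x) = (b - c) powr (1 - \<beta>) / (1 - \<beta>)"
    unfolding set_integrable_def set_lebesgue_integral_def eq
    using powr_integral_left_end[of "- \<beta>" c b, unfolded set_integrable_def set_lebesgue_integral_def] assms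
    by simp_all
qed

text \<open>The difference is nonnegative up to \<open>d\<close> and nonpositive beyond, where the
  nearer singularity dominates. The absolute value is thus twice the part up to \<open>d\<close>
  minus the difference, and every term has an explicit integral.\<close>

lemma cut_powr_diff_abs:
  assumes "0 < \<beta>" "c \<le> d"
  shows "\<bar>cut_powr \<beta> c x - cut_powr \<beta> d x\<bar> = 2 * (indicator {..d} x * cut_powr \<beta> c x) + cut_powr \<beta> d x - cut_powr \<beta> c x"
proof (cases "d < x")
  case True
  then have "(x - c) powr - \<beta> \<le> (x - d) powr - \<beta>"
    using assms by (intro powr_mono2') auto
  then show ?thesis using True assms by (auto simp: cut_powr_def)
qed (auto simp: cut_powr_def)

text \<open>The source of \<open>(d - c) powr (1 - \<beta>)\<close> in the cost of a position: the
  two contributions that reach up to 1 have a nonpositive sum and drop out.\<close>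

lemma cut_powr_diff_integral:
  assumes "0 < \<beta>" "\<beta> < 1" "0 \<le> c" "c \<le> d" "d \<le> 1"
  shows "set_integrable lborel {0..1} (\<lambda>x. \<bar>cut_powr \<beta> c x - cut_powr \<beta> d x\<bar>)"
    and "(LINT x:{0..1}|lborel. \<bar>cut_powr \<beta> c x - cut_powr \<beta> d x\<bar>) \<le> 2 / (1 - \<beta>) * (d - c) powr (1 - \<beta>)"
proof -
  note c = cut_powr_integral[OF assms(1,2), of c 1] and d = cut_powr_integral[OF assms(1,2), of d 1]
  note cd = cut_powr_integral[OF assms(1,2), of c d]
  have eq: "indicator {0..1} x *\<^sub>R (indicator {..d} x * cut_powr \<beta> c x) = indicator {0..d} x *\<^sub>R cut_powr \<beta> c x" for x
    using assms by (auto simp: indicator_def)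
  have i: "set_integrable lborel {0..1} (\<lambda>x. indicator {..d} x * cut_powr \<beta> c x)"
    "(LINT x:{0..1}|lborel. indicator {..d} x * cut_powr \<beta> c x) = (d - c) powr (1 - \<beta>) / (1 - \<beta>)"
    unfolding set_integrable_def set_lebesgue_integral_def eq
    using cd[unfolded set_integrable_def set_lebesgue_integral_def] assms by simp_all
  note int = set_integral_diff[OF set_integral_add(1)[OF set_integrable_cmult[OF i(1), of 2] d(1)] c(1)]
  show "set_integrable lborel {0..1} (\<lambda>x. \<bar>cut_powr \<beta> c x - cut_powr \<beta> d x\<bar>)"
    unfolding cut_powr_diff_abs[OF assms(1,4)] using int(1) assms by auto
  have "(LINT x:{0..1}|lborel. \<bar>cut_powr \<beta> c x - cut_powr \<beta> d x\<bar>) =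
      2 * ((d - c) powr (1 - \<beta>) / (1 - \<beta>)) + (1 - d) powr (1 - \<beta>) / (1 - \<beta>) - (1 - c) powr (1 - \<beta>) / (1 - \<beta>)"
    unfolding cut_powr_diff_abs[OF assms(1,4)]
    using int(2) set_integral_add(2)[OF set_integrable_cmult[OF i(1), of 2] d(1)] i c d assms by simp
  moreover have "(1 - d) powr (1 - \<beta>) / (1 - \<beta>) \<le> (1 - c) powr (1 - \<beta>) / (1 - \<beta>)"
    using assms by (intro divide_right_mono powr_mono2) auto
  ultimately show "(LINT x:{0..1}|lborel. \<bar>cut_powr \<beta> c x - cut_powr \<beta> d x\<bar>) \<le> 2 / (1 - \<beta>) * (d - c) powr (1 - \<beta>)"
    by simp
qed

lemma kernel_piece_integral:
  fixes p q x \<beta> :: real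
  assumes "0 < \<beta>" "p \<le> q" "q < x"
  shows "set_integrable lborel {p..q} (\<lambda>u. 1 / (x - u) powr (\<beta> + 1))"
    and "(LINT u:{p..q}|lborel. 1 / (x - u) powr (\<beta> + 1)) = ((x - q) powr - \<beta> - (x - p) powr - \<beta>) / \<beta>"
proof -
  have cont: "continuous_on {p..q} (\<lambda>u. (x - u) powr - \<beta> / \<beta>)"
    using assms by (intro continuous_intros) auto
  have deriv: "((\<lambda>u. (x - u) powr - \<beta> / \<beta>) has_real_derivative 1 / (x - u) powr (\<beta> + 1)) (at u)" if "u < q" for u
  proof -
    have "((\<lambda>u. (x - u) powr - \<beta> / \<beta>) has_real_derivative (x - u) powr (- \<beta> - 1)) (at u)"
      using that assms by (auto intro!: derivative_eq_intros)
    also have "- \<beta> - 1 = - (\<beta> + 1)" by simp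
    finally show ?thesis by (simp only: powr_minus_divide)
  qed
  note * = nonneg_FTC_interior[OF assms(2) cont deriv]
  show "set_integrable lborel {p..q} (\<lambda>u. 1 / (x - u) powr (\<beta> + 1))" by (rule *) auto
  have "(LINT u:{p..q}|lborel. 1 / (x - u) powr (\<beta> + 1)) = (x - q) powr - \<beta> / \<beta> - (x - p) powr - \<beta> / \<beta>"
    by (rule *) auto
  then show "(LINT u:{p..q}|lborel. 1 / (x - u) powr (\<beta> + 1)) = ((x - q) powr - \<beta> - (x - p) powr - \<beta>) / \<beta>"
    by (simp add: diff_divide_distrib)
qed

text \<open>Before the interval nothing is seen. Inside it, the kernel lives on
  \<open>{0..c}\<close>, and its end value at 0 cancels the boundary term
  \<open>f x / x powr \<beta>\<close>. Beyond it, the kernel lives on the interval with negative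
  sign. For fixed \<open>x\<close> the kernel does not change sign, so the version with absolute
  values is equally explicit.\<close>

lemma left_kernel_indicator:
  fixes c d x \<beta> :: real
  assumes \<beta>: "0 < \<beta>" "\<beta> < 1" and cd: "0 \<le> c" "c \<le> d" and x: "0 < x"
  defines "f \<equiv> indicator {c<..d} :: real \<Rightarrow> real"
  shows "set_integrable lborel {0..x} (left_kernel \<beta> f x)"
    and "f x / x powr \<beta> + \<beta> * (LINT u:{0..x}|lborel. left_kernel \<beta> f x u) = cut_powr \<beta> c x - cut_powr \<beta> d x"
    and "f x / x powr \<beta> + \<beta> * (LINT u:{0..x}|lborel. \<bar>left_kernel \<beta> f x u\<bar>) = \<bar>cut_powr \<beta> c x - cut_powr \<beta> d x\<bar>"
proof -
  define k where "k u = 1 / (x - u) powr (\<beta> + 1)" for u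
  have xb: "1 / x powr \<beta> = x powr - \<beta>" by (simp add: powr_minus divide_inverse)
  have "set_integrable lborel {0..x} (left_kernel \<beta> f x) \<and>
    f x / x powr \<beta> + \<beta> * (LINT u:{0..x}|lborel. left_kernel \<beta> f x u) = cut_powr \<beta> c x - cut_powr \<beta> d x \<and>
    f x / x powr \<beta> + \<beta> * (LINT u:{0..x}|lborel. \<bar>left_kernel \<beta> f x u\<bar>) = \<bar>cut_powr \<beta> c x - cut_powr \<beta> d x\<bar>"
  proof -
    consider "x \<le> c" | "c < x" "x \<le> d" | "d < x" by linarith
    then show ?thesis
    proof cases
      case 1
      have eq: "indicator {0..x} u *\<^sub>R left_kernel \<beta> f x u = 0" "indicator {0..x} u *\<^sub>R \<bar>left_kernel \<beta> f x u\<bar> = 0" for u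
        using 1 by (auto simp: left_kernel_def f_def indicator_def)
      show ?thesis unfolding set_integrable_def set_lebesgue_integral_def eq
        using 1 cd by (simp add: cut_powr_def f_def)
    next
      case 2
      have eq: "indicator {0..x} u *\<^sub>R left_kernel \<beta> f x u = indicator {0..c} u *\<^sub>R k u"
        "indicator {0..x} u *\<^sub>R \<bar>left_kernel \<beta> f x u\<bar> = indicator {0..c} u *\<^sub>R k u" for u
        using 2 cd by (auto simp: left_kernel_def f_def indicator_def k_def)
      note k = kernel_piece_integral[OF \<beta>(1) cd(1) 2(1), folded k_def]
      show ?thesis unfolding set_integrable_def set_lebesgue_integral_def eq
        using k 2 cd \<beta> xb unfolding set_integrable_def set_lebesgue_integral_def by (simp add: cut_powr_def f_def)
    next
      case 3
      \<comment> \<open>The exception is due to the end \<open>c\<close>, which belongs to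
        \<open>{c..d}\<close> but not to the interval of the indicator.\<close>
      have eq: "indicator {0..x} u *\<^sub>R left_kernel \<beta> f x u = - (indicator {c..d} u *\<^sub>R k u)"
        "indicator {0..x} u *\<^sub>R \<bar>left_kernel \<beta> f x u\<bar> = indicator {c..d} u *\<^sub>R k u" if "u \<noteq> c" for u
        using 3 cd that by (auto simp: left_kernel_def f_def indicator_def k_def)
      note k = kernel_piece_integral[OF \<beta>(1) cd(2) 3, folded k_def]
      have ae: "AE u in lborel. u \<noteq> c" by (rule AE_lborel_singleton)
      have [measurable]: "left_kernel \<beta> f x \<in> borel_measurable borel" "k \<in> borel_measurable borel"
        unfolding left_kernel_def f_def k_def by measurable
      have int: "integrable lborel (\<lambda>u. indicator {c..d} u *\<^sub>R k u)" using k(1) by (simp add: set_integrable_def)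
      have 1: "integrable lborel (\<lambda>u. indicator {0..x} u *\<^sub>R left_kernel \<beta> f x u)"
        by (subst integrable_cong_AE[where g = "\<lambda>u. - (indicator {c..d} u *\<^sub>R k u)"]) (use ae eq int in auto)
      have 2: "(LINT u|lborel. indicator {0..x} u *\<^sub>R left_kernel \<beta> f x u) = (LINT u|lborel. - (indicator {c..d} u *\<^sub>R k u))"
        by (rule integral_cong_AE) (use ae eq in auto)
      have 4: "(LINT u|lborel. indicator {0..x} u *\<^sub>R \<bar>left_kernel \<beta> f x u\<bar>) = (LINT u|lborel. indicator {c..d} u *\<^sub>R k u)"
        by (rule integral_cong_AE) (use ae eq in auto)
      have "(x - c) powr - \<beta> \<le> (x - d) powr - \<beta>" using 3 cd \<beta> by (intro powr_mono2') auto
      then show ?thesis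
        using 1 2 4 k(2) 3 cd \<beta> unfolding set_integrable_def set_lebesgue_integral_def
        by (simp add: cut_powr_def f_def)
    qed
  qed
  then show "set_integrable lborel {0..x} (left_kernel \<beta> f x)"
    "f x / x powr \<beta> + \<beta> * (LINT u:{0..x}|lborel. left_kernel \<beta> f x u) = cut_powr \<beta> c x - cut_powr \<beta> d x"
    "f x / x powr \<beta> + \<beta> * (LINT u:{0..x}|lborel. \<bar>left_kernel \<beta> f x u\<bar>) = \<bar>cut_powr \<beta> c x - cut_powr \<beta> d x\<bar>"
    by auto
qed

section \<open>Generalized Lebesgue--Stieltjes integrals of step functions\<close>

definition step_sum :: "(nat \<Rightarrow> real) \<Rightarrow> (nat \<Rightarrow> real) \<Rightarrow> (nat \<Rightarrow> real) \<Rightarrow> real \<Rightarrow> real" where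
  "step_sum l c d t = (\<Sum>n. l n * indicator {c n<..d n} t)"

text \<open>\<open>c_lim\<close> makes the sum finite on \<open>[0, x]\<close> for each
  \<open>x < 1\<close>, so that derivatives can be computed term by term there; \<open>summ\<close>
  is the summability of the norms of the terms and carries the integrals to the limit.\<close>

locale step_data =
  fixes \<beta> :: real and l c d :: "nat \<Rightarrow> real"
  assumes \<beta>: "0 < \<beta>" "\<beta> < 1"
    and cd: "\<And>n. 0 \<le> c n" "\<And>n. c n \<le> d n" "\<And>n. d n < 1"
    and c_lim: "c \<longlonglongrightarrow> 1"
    and summ: "summable (\<lambda>n. \<bar>l n\<bar> * (d n - c n) powr (1 - \<beta>))"
begin

text \<open>By \<open>left_kernel_indicator\<close>, this is \<open>Gamma (1 - \<beta>)\<close>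
  times the left derivative of the \<open>n\<close>-th indicator at \<open>x > 0\<close>.\<close>

definition jump :: "nat \<Rightarrow> real \<Rightarrow> real" where
  "jump n x = cut_powr \<beta> (c n) x - cut_powr \<beta> (d n) x"

lemma jump_measurable[measurable]: "jump n \<in> borel_measurable borel"
  unfolding jump_def by measurable

lemma locally_finite:
  assumes "x < 1"
  shows "\<exists>N. \<forall>n\<ge>N. x < c n"
  using order_tendstoD(1)[OF c_lim assms] by (auto simp: eventually_sequentially)

lemma step_sum_finite:
  assumes "\<forall>n\<ge>N. x < c n" and "u \<le> x"
  shows "step_sum l c d u = (\<Sum>n<N. l n * indicator {c n<..d n} u)"
  unfolding step_sum_def
proof (rule suminf_finite)
  fix n assume "n \<notin> {..<N}"
  then have "x < c n" using assms(1) by simp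
  then have "u < c n" using assms(2) by simp
  then show "l n * indicator {c n<..d n} u = 0" by simp
qed simp

lemma jump_eq_0:
  fixes x :: real
  shows "x < c n \<Longrightarrow> jump n x = 0"
  using cd(2)[of n] by (auto simp: jump_def cut_powr_def)

lemma left_kernel_sum:
  assumes N: "\<forall>n\<ge>N. x < c n" and u: "u \<in> {0..x}"
  shows "left_kernel \<beta> (step_sum l c d) x u = (\<Sum>n<N. l n * left_kernel \<beta> (indicator {c n<..d n}) x u)"
proof -
  have "step_sum l c d x - step_sum l c d u = (\<Sum>n<N. l n * (indicator {c n<..d n} x - indicator {c n<..d n} u))"
    using step_sum_finite[OF N, where u = x] step_sum_finite[OF N, where u = u] u
    by (simp add: right_diff_distrib sum_subtractf)
  then show ?thesis by (simp add: left_kernel_def sum_divide_distrib)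
qed

lemma left_kernel_step_sum:
  assumes x: "0 < x" "x < 1"
  shows "set_integrable lborel {0..x} (left_kernel \<beta> (step_sum l c d) x)"
    and "left_deriv \<beta> 0 (step_sum l c d) x = (\<Sum>n. l n * jump n x) / Gamma (1 - \<beta>)"
proof -
  obtain N where N: "\<forall>n\<ge>N. x < c n" using locally_finite[OF x(2)] by blast
  note ind = left_kernel_indicator[OF \<beta> cd(1,2) x(1)]
  have int: "set_integrable lborel {0..x} (\<lambda>u. l n * left_kernel \<beta> (indicator {c n<..d n}) x u)" for n
    by (intro set_integrable_cmult ind)
  have eq: "indicator {0..x} u *\<^sub>R left_kernel \<beta> (step_sum l c d) x u =
      (\<Sum>n<N. indicator {0..x} u *\<^sub>R (l n * left_kernel \<beta> (indicator {c n<..d n}) x u))" for u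
    using left_kernel_sum[OF N, where u = u] by (cases "u \<in> {0..x}") (auto simp: sum_distrib_left)
  show "set_integrable lborel {0..x} (left_kernel \<beta> (step_sum l c d) x)"
    unfolding set_integrable_def eq using int by (intro Bochner_Integration.integrable_sum) (simp add: set_integrable_def)
  have "(LINT u:{0..x}|lborel. left_kernel \<beta> (step_sum l c d) x u) =
      (\<Sum>n<N. LINT u:{0..x}|lborel. l n * left_kernel \<beta> (indicator {c n<..d n}) x u)"
    unfolding set_lebesgue_integral_def eq using int
    by (intro Bochner_Integration.integral_sum) (simp add: set_integrable_def)
  then have "step_sum l c d x / x powr \<beta> + \<beta> * (LINT u:{0..x}|lborel. left_kernel \<beta> (step_sum l c d) x u) =
      (\<Sum>n<N. l n * (indicator {c n<..d n} x / x powr \<beta> + \<beta> * (LINT u:{0..x}|lborel. left_kernel \<beta> (indicator {c n<..d n}) x u)))"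
    unfolding step_sum_finite[OF N order_refl]
    by (simp add: sum_distrib_left sum_divide_distrib distrib_left sum.distrib mult.left_commute del: sum_mult_indicator)
  also have "\<dots> = (\<Sum>n<N. l n * jump n x)" by (simp add: ind(2) jump_def)
  also have "\<dots> = (\<Sum>n. l n * jump n x)"
    using jump_eq_0 N by (intro suminf_finite[symmetric]) (auto simp: not_less)
  finally show "left_deriv \<beta> 0 (step_sum l c d) x = (\<Sum>n. l n * jump n x) / Gamma (1 - \<beta>)"
    by (simp add: left_deriv_def)
qed

lemma step_sum_measurable[measurable]: "step_sum l c d \<in> borel_measurable borel"
  unfolding step_sum_def by measurable

lemma jump_integral_bound:
  "set_integrable lborel {0..1} (\<lambda>x. \<bar>jump n x\<bar>)"
  "(LINT x:{0..1}|lborel. \<bar>jump n x\<bar>) \<le> 2 / (1 - \<beta>) * (d n - c n) powr (1 - \<beta>)"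
  using cut_powr_diff_integral[OF \<beta> cd(1,2)[of n] less_imp_le[OF cd(3)[of n]]] by (auto simp: jump_def)

text \<open>The triangle inequality over the finitely many active terms, followed by the absolute
  version in \<open>left_kernel_indicator\<close>. The factor \<open>1 / \<beta>\<close> arises
  because the norm gives weight 1 to the kernel integral, whereas the derivative gives it weight
  \<open>\<beta>\<close>.\<close>

lemma frac_norm_pointwise:
  assumes t: "0 < t" "t < 1"
  shows "ennreal (\<bar>step_sum l c d t\<bar> / (t - 0) powr \<beta>) +
      (\<integral>\<^sup>+s\<in>{0..t}. ennreal (\<bar>step_sum l c d t - step_sum l c d s\<bar> / (t - s) powr (\<beta> + 1)) \<partial>lborel)
    \<le> (\<Sum>n. ennreal (\<bar>l n\<bar> / \<beta> * \<bar>jump n t\<bar>))"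
proof -
  obtain N where N: "\<forall>n\<ge>N. t < c n" using locally_finite[OF t(2)] by blast
  note ind = left_kernel_indicator[OF \<beta> cd(1,2) t(1)]
  let ?k = "\<lambda>n. left_kernel \<beta> (indicator {c n<..d n}) t"
  have [measurable]: "?k n \<in> borel_measurable borel" for n unfolding left_kernel_def by measurable
  have intk: "integrable lborel (\<lambda>s. indicator {0..t} s * \<bar>?k n s\<bar>)" for n
    using set_integrable_abs[OF ind(1)[of n]] by (simp add: set_integrable_def)
  have "(\<integral>\<^sup>+s\<in>{0..t}. ennreal (\<bar>step_sum l c d t - step_sum l c d s\<bar> / (t - s) powr (\<beta> + 1)) \<partial>lborel)
      \<le> (\<integral>\<^sup>+s. (\<Sum>n<N. ennreal \<bar>l n\<bar> * ennreal (indicator {0..t} s * \<bar>?k n s\<bar>)) \<partial>lborel)"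
  proof (rule nn_integral_mono)
    fix s
    show "ennreal (\<bar>step_sum l c d t - step_sum l c d s\<bar> / (t - s) powr (\<beta> + 1)) * indicator {0..t} s
        \<le> (\<Sum>n<N. ennreal \<bar>l n\<bar> * ennreal (indicator {0..t} s * \<bar>?k n s\<bar>))"
    proof (cases "s \<in> {0..t}")
      case True
      have "\<bar>step_sum l c d t - step_sum l c d s\<bar> / (t - s) powr (\<beta> + 1) = \<bar>left_kernel \<beta> (step_sum l c d) t s\<bar>"
        by (simp add: left_kernel_def abs_divide)
      also have "\<dots> \<le> (\<Sum>n<N. \<bar>l n * ?k n s\<bar>)"
        unfolding left_kernel_sum[OF N True] by (rule sum_abs)
      finally have "ennreal (\<bar>step_sum l c d t - step_sum l c d s\<bar> / (t - s) powr (\<beta> + 1)) \<le> ennreal (\<Sum>n<N. \<bar>l n * ?k n s\<bar>)"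
        by (rule ennreal_leI)
      also have "\<dots> = (\<Sum>n<N. ennreal \<bar>l n\<bar> * ennreal \<bar>?k n s\<bar>)"
        by (subst sum_ennreal[symmetric]) (auto simp: abs_mult ennreal_mult)
      finally show ?thesis using True by simp
    qed simp
  qed
  also have "\<dots> = (\<Sum>n<N. ennreal \<bar>l n\<bar> * (\<integral>\<^sup>+s. ennreal (indicator {0..t} s * \<bar>?k n s\<bar>) \<partial>lborel))"
    by (subst nn_integral_sum) (auto simp: nn_integral_cmult)
  also have "\<dots> = (\<Sum>n<N. ennreal \<bar>l n\<bar> * ennreal (LINT s:{0..t}|lborel. \<bar>?k n s\<bar>))"
    using intk by (subst nn_integral_eq_integral) (auto simp: set_lebesgue_integral_def)
  also have "\<dots> = ennreal (\<Sum>n<N. \<bar>l n\<bar> * (LINT s:{0..t}|lborel. \<bar>?k n s\<bar>))"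
    by (subst sum_ennreal[symmetric]) (auto simp: ennreal_mult set_lebesgue_integral_def)
  finally have 1: "(\<integral>\<^sup>+s\<in>{0..t}. ennreal (\<bar>step_sum l c d t - step_sum l c d s\<bar> / (t - s) powr (\<beta> + 1)) \<partial>lborel)
    \<le> ennreal (\<Sum>n<N. \<bar>l n\<bar> * (LINT s:{0..t}|lborel. \<bar>?k n s\<bar>))" .
  have int0: "0 \<le> (LINT s:{0..t}|lborel. \<bar>?k n s\<bar>)" for n by (auto simp: set_lebesgue_integral_def)
  have "\<bar>step_sum l c d t\<bar> / (t - 0) powr \<beta> \<le> (\<Sum>n<N. \<bar>l n\<bar> * (indicator {c n<..d n} t / t powr \<beta>))"
  proof -
    have "\<bar>step_sum l c d t\<bar> \<le> (\<Sum>n<N. \<bar>l n * indicator {c n<..d n} t\<bar>)"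
      unfolding step_sum_finite[OF N order_refl] by (rule sum_abs)
    then have "\<bar>step_sum l c d t\<bar> / t powr \<beta> \<le> (\<Sum>n<N. \<bar>l n * indicator {c n<..d n} t\<bar>) / t powr \<beta>"
      by (intro divide_right_mono) auto
    then show ?thesis by (simp add: sum_divide_distrib abs_mult del: sum_mult_indicator)
  qed
  then have "\<bar>step_sum l c d t\<bar> / (t - 0) powr \<beta> + (\<Sum>n<N. \<bar>l n\<bar> * (LINT s:{0..t}|lborel. \<bar>?k n s\<bar>))
      \<le> (\<Sum>n<N. \<bar>l n\<bar> * (indicator {c n<..d n} t / t powr \<beta> + (LINT s:{0..t}|lborel. \<bar>?k n s\<bar>)))"
    by (simp add: distrib_left sum.distrib)
  also have "\<dots> \<le> (\<Sum>n<N. \<bar>l n\<bar> / \<beta> * \<bar>jump n t\<bar>)"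
  proof (rule sum_mono)
    fix n
    have "\<beta> * (indicator {c n<..d n} t / t powr \<beta>) \<le> 1 * (indicator {c n<..d n} t / t powr \<beta>)"
      using \<beta> by (intro mult_right_mono) auto
    then have "\<beta> * (indicator {c n<..d n} t / t powr \<beta> + (LINT s:{0..t}|lborel. \<bar>?k n s\<bar>)) \<le> \<bar>jump n t\<bar>"
      using ind(3)[of n] by (simp add: jump_def distrib_left)
    then have "indicator {c n<..d n} t / t powr \<beta> + (LINT s:{0..t}|lborel. \<bar>?k n s\<bar>) \<le> \<bar>jump n t\<bar> / \<beta>"
      using \<beta> by (simp add: pos_le_divide_eq mult.commute)
    from mult_left_mono[OF this, of "\<bar>l n\<bar>"]
    show "\<bar>l n\<bar> * (indicator {c n<..d n} t / t powr \<beta> + (LINT s:{0..t}|lborel. \<bar>?k n s\<bar>)) \<le> \<bar>l n\<bar> / \<beta> * \<bar>jump n t\<bar>"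
      by simp
  qed
  finally have "ennreal (\<bar>step_sum l c d t\<bar> / (t - 0) powr \<beta> + (\<Sum>n<N. \<bar>l n\<bar> * (LINT s:{0..t}|lborel. \<bar>?k n s\<bar>)))
      \<le> ennreal (\<Sum>n<N. \<bar>l n\<bar> / \<beta> * \<bar>jump n t\<bar>)" by (rule ennreal_leI)
  also have "\<dots> = (\<Sum>n<N. ennreal (\<bar>l n\<bar> / \<beta> * \<bar>jump n t\<bar>))"
    using \<beta> by (subst sum_ennreal) auto
  also have "\<dots> \<le> (\<Sum>n. ennreal (\<bar>l n\<bar> / \<beta> * \<bar>jump n t\<bar>))"
    by (rule sum_le_suminf) auto
  finally show ?thesis
    using int0 by (intro order_trans[OF add_left_mono[OF 1]]) (simp add: ennreal_plus[symmetric] sum_nonneg del: ennreal_plus)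
qed

lemma AE_interior: "AE x in lborel. x \<in> {0..1} \<longrightarrow> 0 < x \<and> x < (1::real)"
  using AE_lborel_singleton[of "0::real"] AE_lborel_singleton[of "1::real"] by eventually_elim auto

lemma step_sum_admissible: "gls_admissible \<beta> 0 1 (step_sum l c d)"
  unfolding gls_admissible_def
proof
  show "set_borel_measurable lborel {0..1} (step_sum l c d)"
    by (simp add: set_borel_measurable_def)
  have "frac_norm \<beta> 0 1 (step_sum l c d) \<le> (\<integral>\<^sup>+t. (\<Sum>n. ennreal (\<bar>l n\<bar> / \<beta> * \<bar>jump n t\<bar>) * indicator {0..1} t) \<partial>lborel)"
    unfolding frac_norm_def
  proof (rule nn_integral_mono_AE)
    show "AE t in lborel. (ennreal (\<bar>step_sum l c d t\<bar> / (t - 0) powr \<beta>) +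
        (\<integral>\<^sup>+s\<in>{0..t}. ennreal (\<bar>step_sum l c d t - step_sum l c d s\<bar> / (t - s) powr (\<beta> + 1)) \<partial>lborel)) * indicator {0..1} t
        \<le> (\<Sum>n. ennreal (\<bar>l n\<bar> / \<beta> * \<bar>jump n t\<bar>) * indicator {0..1} t)"
      using AE_interior
    proof eventually_elim
      case (elim t)
      then show ?case using frac_norm_pointwise[of t] by (cases "t \<in> {0..1}") auto
    qed
  qed
  also have "\<dots> = (\<Sum>n. \<integral>\<^sup>+t. ennreal (\<bar>l n\<bar> / \<beta> * \<bar>jump n t\<bar>) * indicator {0..1} t \<partial>lborel)"
    by (rule nn_integral_suminf) measurable
  also have "\<dots> \<le> (\<Sum>n. ennreal (2 / (\<beta> * (1 - \<beta>)) * (\<bar>l n\<bar> * (d n - c n) powr (1 - \<beta>))))"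
  proof (rule suminf_le)
    fix n
    have "(\<integral>\<^sup>+t. ennreal (\<bar>l n\<bar> / \<beta> * \<bar>jump n t\<bar>) * indicator {0..1} t \<partial>lborel)
        = (\<integral>\<^sup>+t. ennreal (\<bar>l n\<bar> / \<beta> * (indicator {0..1} t *\<^sub>R \<bar>jump n t\<bar>)) \<partial>lborel)"
      by (intro nn_integral_cong) (auto simp: indicator_def)
    also have "\<dots> = ennreal (\<bar>l n\<bar> / \<beta> * (LINT t:{0..1}|lborel. \<bar>jump n t\<bar>))"
      using jump_integral_bound(1)[of n] \<beta>
      by (subst nn_integral_eq_integral) (auto simp: set_integrable_def set_lebesgue_integral_def)
    also have "\<dots> \<le> ennreal (\<bar>l n\<bar> / \<beta> * (2 / (1 - \<beta>) * (d n - c n) powr (1 - \<beta>)))"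
      using jump_integral_bound(2)[of n] \<beta> by (intro ennreal_leI mult_left_mono) auto
    also have "\<bar>l n\<bar> / \<beta> * (2 / (1 - \<beta>) * (d n - c n) powr (1 - \<beta>)) = 2 / (\<beta> * (1 - \<beta>)) * (\<bar>l n\<bar> * (d n - c n) powr (1 - \<beta>))"
      by simp
    finally show "(\<integral>\<^sup>+t. ennreal (\<bar>l n\<bar> / \<beta> * \<bar>jump n t\<bar>) * indicator {0..1} t \<partial>lborel)
        \<le> ennreal (2 / (\<beta> * (1 - \<beta>)) * (\<bar>l n\<bar> * (d n - c n) powr (1 - \<beta>)))" .
  qed auto
  also have "\<dots> < \<infinity>"
    using \<beta> summ by (subst suminf_ennreal_eq[OF _ summable_sums]) (auto intro: summable_mult)
  finally show "frac_norm \<beta> 0 1 (step_sum l c d) < \<infinity>" .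
qed

text \<open>Termwise integration: \<open>m\<close> is bounded and the integral of
  \<open>\<bar>jump n x\<bar>\<close> is of order \<open>(d n - c n) powr (1 - \<beta>)\<close>, so
  the norms of the terms are summable. It is applied with the real factor of the right derivative as
  \<open>m\<close>, and with \<open>m = 1\<close> to integrate the left derivative.\<close>

lemma summ_jump:
  assumes m[measurable]: "m \<in> borel_measurable borel" and bound: "\<And>x. x \<in> {0..1} \<Longrightarrow> \<bar>m x\<bar> \<le> C"
  shows "set_integrable lborel {0..1} (\<lambda>x. (\<Sum>n. l n * jump n x) * m x)"
    and "set_integrable lborel {0..1} (\<lambda>x. jump n x * m x)"
    and "(\<lambda>n. l n * (LINT x:{0..1}|lborel. jump n x * m x)) sums (LINT x:{0..1}|lborel. (\<Sum>n. l n * jump n x) * m x)"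
proof -
  have C: "0 \<le> C" using bound[of 0] by (auto intro: order_trans[of 0])
  define f where "f n x = indicator {0..1} x *\<^sub>R (l n * jump n x * m x)" for n x
  have int0: "integrable lborel (\<lambda>x. indicator {0..1} x *\<^sub>R (jump n x * m x))"
    and le0: "(LINT x|lborel. norm (indicator {0..1} x *\<^sub>R (jump n x * m x))) \<le> C * (LINT x:{0..1}|lborel. \<bar>jump n x\<bar>)" for n
  proof -
    have i: "integrable lborel (\<lambda>x. C * (indicator {0..1} x *\<^sub>R \<bar>jump n x\<bar>))"
      using jump_integral_bound(1)[of n] by (simp add: set_integrable_def)
    have le: "norm (indicator {0..1} x *\<^sub>R (jump n x * m x)) \<le> C * (indicator {0..1} x *\<^sub>R \<bar>jump n x\<bar>)" for x
    proof (cases "x \<in> {0..1}")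
      case True
      have "\<bar>jump n x\<bar> * \<bar>m x\<bar> \<le> \<bar>jump n x\<bar> * C" using bound[OF True] by (intro mult_left_mono) auto
      then show ?thesis using True by (simp add: abs_mult mult.commute)
    qed simp
    show int: "integrable lborel (\<lambda>x. indicator {0..1} x *\<^sub>R (jump n x * m x))"
    proof (rule Bochner_Integration.integrable_bound[OF i])
      show "AE x in lborel. norm (indicator {0..1} x *\<^sub>R (jump n x * m x)) \<le> norm (C * (indicator {0..1} x *\<^sub>R \<bar>jump n x\<bar>))"
        using le order_trans[OF le abs_ge_self] by (intro AE_I2) simp
    qed measurable
    have "(LINT x|lborel. norm (indicator {0..1} x *\<^sub>R (jump n x * m x))) \<le> (LINT x|lborel. C * (indicator {0..1} x *\<^sub>R \<bar>jump n x\<bar>))"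
      by (rule integral_mono[OF integrable_norm[OF int] i le])
    then show "(LINT x|lborel. norm (indicator {0..1} x *\<^sub>R (jump n x * m x))) \<le> C * (LINT x:{0..1}|lborel. \<bar>jump n x\<bar>)"
      by (simp add: set_lebesgue_integral_def)
  qed
  have f_eq: "f n x = l n * (indicator {0..1} x *\<^sub>R (jump n x * m x))" for n x by (simp add: f_def)
  have intf: "integrable lborel (f n)" for n
    unfolding f_eq using int0[of n] by (intro Bochner_Integration.integrable_mult_right)
  have sf: "summable (\<lambda>n. LINT x|lborel. norm (f n x))"
  proof (rule summable_comparison_test'[where N = 0])
    show "summable (\<lambda>n. C * (2 / (1 - \<beta>)) * (\<bar>l n\<bar> * (d n - c n) powr (1 - \<beta>)))"
      by (intro summable_mult summ)
    fix n
    have "(LINT x|lborel. norm (f n x)) = \<bar>l n\<bar> * (LINT x|lborel. norm (indicator {0..1} x *\<^sub>R (jump n x * m x)))"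
      unfolding f_eq by (simp add: abs_mult)
    also have "\<dots> \<le> \<bar>l n\<bar> * (C * (LINT x:{0..1}|lborel. \<bar>jump n x\<bar>))"
      using le0[of n] by (intro mult_left_mono) auto
    also have "\<dots> \<le> \<bar>l n\<bar> * (C * (2 / (1 - \<beta>) * (d n - c n) powr (1 - \<beta>)))"
      using jump_integral_bound(2)[of n] C by (intro mult_left_mono) auto
    finally show "norm (LINT x|lborel. norm (f n x)) \<le> C * (2 / (1 - \<beta>)) * (\<bar>l n\<bar> * (d n - c n) powr (1 - \<beta>))"
      by (simp add: mult_ac)
  qed
  have fin: "\<exists>N. \<forall>n\<ge>N. jump n x = 0" if "x < 1" for x
    using locally_finite[OF that] jump_eq_0 by blast
  have ae: "AE x in lborel. summable (\<lambda>n. norm (f n x))"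
    using AE_interior
  proof eventually_elim
    case (elim x)
    show ?case
    proof (cases "x \<in> {0..1}")
      case True
      then obtain N where "\<forall>n\<ge>N. jump n x = 0" using fin[of x] elim by blast
      then show ?thesis by (intro summable_finite[of "{..<N}"]) (auto simp: f_def not_less)
    qed (simp add: f_def)
  qed
  have eq: "(\<Sum>n. f n x) = indicator {0..1} x *\<^sub>R ((\<Sum>n. l n * jump n x) * m x)" if x01: "x \<in> {0..1} \<longrightarrow> 0 < x \<and> x < 1" for x
  proof (cases "x \<in> {0..1}")
    case True
    then obtain N where N: "\<forall>n\<ge>N. jump n x = 0" using fin[of x] x01 by blast
    have "summable (\<lambda>n. l n * jump n x)" using N by (intro summable_finite[of "{..<N}"]) (auto simp: not_less)
    from suminf_mult2[OF this, of "m x"] show ?thesis using True by (simp add: f_def)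
  qed (simp add: f_def)
  have ms: "(\<lambda>x. indicator {0..1} x *\<^sub>R ((\<Sum>n. l n * jump n x) * m x)) \<in> borel_measurable lborel"
    by measurable
  have mf: "(\<lambda>x. \<Sum>n. f n x) \<in> borel_measurable lborel" unfolding f_def by measurable
  have aeq: "AE x in lborel. (\<Sum>n. f n x) = indicator {0..1} x *\<^sub>R ((\<Sum>n. l n * jump n x) * m x)"
    using AE_interior by eventually_elim (rule eq)
  show "set_integrable lborel {0..1} (\<lambda>x. (\<Sum>n. l n * jump n x) * m x)"
    unfolding set_integrable_def using integrable_suminf[OF intf ae sf] integrable_cong_AE[OF mf ms aeq] by simp
  show "set_integrable lborel {0..1} (\<lambda>x. jump n x * m x)" using int0 by (simp add: set_integrable_def)
  have "(\<lambda>n. LINT x|lborel. f n x) sums (LINT x|lborel. (\<Sum>n. f n x))"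
    using summable_sums[OF summable_integral[OF intf ae sf]] integral_suminf[OF intf ae sf] by simp
  also have "(LINT x|lborel. (\<Sum>n. f n x)) = (LINT x:{0..1}|lborel. (\<Sum>n. l n * jump n x) * m x)"
    unfolding set_lebesgue_integral_def by (rule integral_cong_AE[OF mf ms aeq])
  also have "(\<lambda>n. LINT x|lborel. f n x) = (\<lambda>n. l n * (LINT x:{0..1}|lborel. jump n x * m x))"
    unfolding f_eq by (simp add: set_lebesgue_integral_def)
  finally show "(\<lambda>n. l n * (LINT x:{0..1}|lborel. jump n x * m x)) sums (LINT x:{0..1}|lborel. (\<Sum>n. l n * jump n x) * m x)" .
qed

text \<open>The series formula is available inside the unit interval only; the two end points are
  patched with their unspecified values.\<close>

lemma left_deriv_measurable: "(\<lambda>x. indicator {0..1} x *\<^sub>R left_deriv \<beta> 0 (step_sum l c d) x) \<in> borel_measurable borel"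
proof -
  let ?D = "left_deriv \<beta> 0 (step_sum l c d)"
  have "(\<lambda>x. indicator {0..1} x *\<^sub>R ?D x) =
    (\<lambda>x. if x = 0 then ?D 0 else if x = 1 then ?D 1 else indicator {0..1} x * ((\<Sum>n. l n * jump n x) / Gamma (1 - \<beta>)))"
  proof
    fix x :: real
    consider "x = 0" | "x = 1" | "0 < x" "x < 1" | "x \<notin> {0..1}" by fastforce
    then show "indicator {0..1} x *\<^sub>R ?D x =
      (if x = 0 then ?D 0 else if x = 1 then ?D 1 else indicator {0..1} x * ((\<Sum>n. l n * jump n x) / Gamma (1 - \<beta>)))"
      by cases (auto simp: left_kernel_step_sum(2))
  qed
  also have "\<dots> \<in> borel_measurable borel" by measurable
  finally show ?thesis .
qed

lemma left_deriv_AE: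
  "AE x in lborel. indicator {0..1} x *\<^sub>R left_deriv \<beta> 0 (step_sum l c d) x =
    indicator {0..1} x *\<^sub>R ((\<Sum>n. l n * jump n x) / Gamma (1 - \<beta>))"
  using AE_interior
proof eventually_elim
  case (elim x)
  then show ?case using left_kernel_step_sum(2)[of x] by (cases "x \<in> {0..1}") auto
qed

section \<open>The integral against one Hoelder path\<close>

context
  fixes g :: "real \<Rightarrow> real" and \<alpha> L :: real
  assumes h: "holder_on {0..1} \<alpha> L g" and \<alpha>: "1 - \<beta> < \<alpha>"
begin

lemma G_holder: "holder_on UNIV \<alpha> L (clamp01 g)" "holder_on {0..1} \<alpha> L (clamp01 g)"
  using clamp01_holder[OF h] \<alpha> \<beta> by (auto simp: holder_on_def)

lemma G_measurable[measurable]: "clamp01 g \<in> borel_measurable borel"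
  using holder_continuous[OF G_holder(1)] \<alpha> \<beta> by (intro borel_measurable_continuous_onI) simp

lemma marchaud_G_bound: "x \<in> {0..1} \<Longrightarrow> \<bar>marchaud (1 - \<beta>) (clamp01 g) x\<bar> \<le> L + (1 - \<beta>) * (L / (\<alpha> - (1 - \<beta>)))"
  using \<alpha> \<beta> by (intro marchaud_bound[OF G_holder(2)]) (auto simp: clamp01_def)

text \<open>Abel inversion with \<open>\<gamma> = 1 - \<beta>\<close>, as \<open>cut_powr\<close>
  has the exponent \<open>- \<beta> = \<gamma> - 1\<close>. In this way the derivative of an
  indicator reads off the path at the jump.\<close>

lemma cut_powr_marchaud:
  assumes "0 \<le> a" "a < 1"
  shows "(LINT x:{0..1}|lborel. cut_powr \<beta> a x * marchaud (1 - \<beta>) (clamp01 g) x) = Gamma (1 - \<beta>) * Gamma \<beta> * (g a - g 1)"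
proof -
  have "(LINT x:{0..1}|lborel. cut_powr \<beta> a x * marchaud (1 - \<beta>) (clamp01 g) x) =
      (LINT x:{a..1}|lborel. (x - a) powr (1 - \<beta> - 1) * marchaud (1 - \<beta>) (clamp01 g) x)"
    unfolding set_lebesgue_integral_def using assms
    by (intro Bochner_Integration.integral_cong refl) (auto simp: cut_powr_def indicator_def)
  also have "\<dots> = Gamma (1 - \<beta>) * Gamma (1 - (1 - \<beta>)) * clamp01 g a"
    using \<alpha> \<beta> assms by (intro abel_inversion[OF G_holder(1)]) (auto simp: clamp01_def)
  also have "clamp01 g a = g a - g 1" using assms by (simp add: clamp01_eq)
  finally show ?thesis by simp
qed

lemma cut_powr_marchaud_integrable:
  assumes "0 \<le> a" "a \<le> 1"
  shows "set_integrable lborel {0..1} (\<lambda>x. cut_powr \<beta> a x * marchaud (1 - \<beta>) (clamp01 g) x)"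
proof (rule set_integrable_bound)
  let ?C = "L + (1 - \<beta>) * (L / (\<alpha> - (1 - \<beta>)))"
  show "set_integrable lborel {0..1} (\<lambda>x. ?C * cut_powr \<beta> a x)"
    using cut_powr_integral(1)[OF \<beta> assms] by (rule set_integrable_cmult)
  show "AE x in lborel. x \<in> {0..1} \<longrightarrow> norm (cut_powr \<beta> a x * marchaud (1 - \<beta>) (clamp01 g) x) \<le> norm (?C * cut_powr \<beta> a x)"
  proof (intro AE_I2 impI)
    fix x :: real assume x: "x \<in> {0..1}"
    have "\<bar>marchaud (1 - \<beta>) (clamp01 g) x\<bar> \<le> \<bar>?C\<bar>" using marchaud_G_bound[OF x] by linarith
    then show "norm (cut_powr \<beta> a x * marchaud (1 - \<beta>) (clamp01 g) x) \<le> norm (?C * cut_powr \<beta> a x)"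
      by (simp only: norm_mult real_norm_def abs_mult mult.commute[of "\<bar>cut_powr \<beta> a x\<bar>"]) (rule mult_right_mono, auto)
  qed
  show "set_borel_measurable lborel {0..1} (\<lambda>x. cut_powr \<beta> a x * marchaud (1 - \<beta>) (clamp01 g) x)"
    unfolding set_borel_measurable_def by measurable
qed

lemma phase: "exp (\<i> * complex_of_real (pi * \<beta>)) * exp (\<i> * complex_of_real (pi * (1 - \<beta>))) = -1"
proof -
  have "exp (\<i> * complex_of_real (pi * \<beta>)) * exp (\<i> * complex_of_real (pi * (1 - \<beta>))) = exp (\<i> * complex_of_real pi)"
    by (simp add: exp_add[symmetric] algebra_simps)
  then show ?thesis by simp
qed

text \<open>Each \<open>jump n\<close> integrates to
  \<open>- (Gamma (1 - \<beta>) * Gamma \<beta>)\<close> times an increment of the path. The Gamma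
  factors cancel against those of the two derivatives, the sign against the product
  \<open>-1\<close> of the phases, and \<open>summ_jump\<close> adds up the pieces.\<close>

lemma has_gls_integral_step_sum: "has_gls_integral \<beta> 0 1 (step_sum l c d) g (\<Sum>n. l n * (g (d n) - g (c n)))"
  unfolding has_gls_integral_def
proof (intro conjI step_sum_admissible)
  let ?m = "marchaud (1 - \<beta>) (clamp01 g)"
  let ?D = "left_deriv \<beta> 0 (step_sum l c d)"
  let ?R = "right_deriv (1 - \<beta>) 1 (\<lambda>x. g x - g 1)"
  define \<kappa> where "\<kappa> = exp (\<i> * complex_of_real (pi * (1 - \<beta>))) / complex_of_real (Gamma \<beta>)"
  have R: "?R x = \<kappa> * complex_of_real (?m x)" if "x \<in> {0..1}" for x
    using right_deriv_marchaud[OF that, of "1 - \<beta>" g] by (simp add: \<kappa>_def)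
  have \<Gamma>: "Gamma \<beta> > 0" "Gamma (1 - \<beta>) > 0" using \<beta> by (auto intro: Gamma_real_pos)
  note m = summ_jump[OF marchaud_measurable[OF G_measurable] marchaud_G_bound]
  have one: "set_integrable lborel {0..1} (\<lambda>x. (\<Sum>n. l n * jump n x) * 1)"
    by (rule summ_jump[where C = 1]) auto
  note lm = left_deriv_measurable
  show "gls_integrable \<beta> 0 1 (step_sum l c d) g"
    unfolding gls_integrable_def Let_def
  proof (intro conjI)
    show "AE x in lborel. x \<in> {0..1} \<longrightarrow> set_integrable lborel {0..x} (left_kernel \<beta> (step_sum l c d) x)"
      using AE_interior by eventually_elim (auto intro: left_kernel_step_sum)
    have "integrable lborel (\<lambda>x. indicator {0..1} x *\<^sub>R ((\<Sum>n. l n * jump n x) / Gamma (1 - \<beta>)))"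
      using one by (simp add: set_integrable_def)
    then show "set_integrable lborel {0..1} ?D"
      unfolding set_integrable_def using lm by (subst integrable_cong_AE[OF _ _ left_deriv_AE]) auto
    show "AE x in lborel. x \<in> {0..1} \<longrightarrow> set_integrable lborel {x..1} (right_kernel (1 - \<beta>) (\<lambda>x. g x - g 1) x)"
    proof (intro AE_I2 impI)
      fix x :: real assume x: "x \<in> {0..1}"
      have "set_integrable lborel {x..1} (right_kernel (1 - \<beta>) (clamp01 g) x)"
        using \<alpha> by (intro right_kernel_integrable[OF G_holder(2) x]) auto
      then show "set_integrable lborel {x..1} (right_kernel (1 - \<beta>) (\<lambda>x. g x - g 1) x)"
        using set_integrable_cong[OF refl refl, of "{x..1}" "right_kernel (1 - \<beta>) (\<lambda>x. g x - g 1) x" "right_kernel (1 - \<beta>) (clamp01 g) x" lborel]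
          right_kernel_clamp01[OF x] by blast
    qed
    have "(\<lambda>x. indicator {0..1} x *\<^sub>R ?R x) = (\<lambda>x. indicator {0..1} x *\<^sub>R (\<kappa> * complex_of_real (?m x)))"
      using R by (auto simp: indicator_def fun_eq_iff)
    then show "set_borel_measurable lborel {0..1} ?R"
      by (simp add: set_borel_measurable_def)
    show "\<exists>C. AE x in lborel. x \<in> {0..1} \<longrightarrow> cmod (?R x) \<le> C"
      using marchaud_G_bound
      by (intro exI[of _ "cmod \<kappa> * (L + (1 - \<beta>) * (L / (\<alpha> - (1 - \<beta>))))"] AE_I2)
        (auto simp: R norm_mult intro!: mult_left_mono)
  qed
  have jump: "(LINT x:{0..1}|lborel. jump n x * ?m x) = - (Gamma (1 - \<beta>) * Gamma \<beta> * (g (d n) - g (c n)))" for n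
  proof -
    have 0: "c n < 1" "0 \<le> d n" using cd(1-3)[of n] by auto
    have "(LINT x:{0..1}|lborel. jump n x * ?m x) = (LINT x:{0..1}|lborel. cut_powr \<beta> (c n) x * ?m x) - (LINT x:{0..1}|lborel. cut_powr \<beta> (d n) x * ?m x)"
      unfolding jump_def left_diff_distrib using 0 cd[of n]
      by (intro set_integral_diff(2) cut_powr_marchaud_integrable) auto
    then show ?thesis using 0 cd(1-3)[of n] by (simp add: cut_powr_marchaud right_diff_distrib)
  qed
  have "(LINT x:{0..1}|lborel. (\<Sum>n. l n * jump n x) * ?m x) = (\<Sum>n. l n * - (Gamma (1 - \<beta>) * Gamma \<beta> * (g (d n) - g (c n))))"
    using sums_unique[OF m(3)] by (simp add: jump)
  \<comment> \<open>Convergence of the series of gains is a by-product of the termwise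
    integration.\<close>
  moreover have S: "summable (\<lambda>n. l n * (g (d n) - g (c n)))"
  proof -
    have "summable (\<lambda>n. (- 1 / (Gamma (1 - \<beta>) * Gamma \<beta>)) * (l n * (LINT x:{0..1}|lborel. jump n x * ?m x)))"
      by (intro summable_mult sums_summable[OF m(3)])
    moreover have "(- 1 / (Gamma (1 - \<beta>) * Gamma \<beta>)) * (l n * (LINT x:{0..1}|lborel. jump n x * ?m x)) = l n * (g (d n) - g (c n))" for n
      unfolding jump using \<Gamma> by simp
    ultimately show ?thesis by simp
  qed
  ultimately have I: "(LINT x:{0..1}|lborel. (\<Sum>n. l n * jump n x) * ?m x) = - (Gamma (1 - \<beta>) * Gamma \<beta>) * (\<Sum>n. l n * (g (d n) - g (c n)))"
    by (subst suminf_mult[OF S, symmetric]) (simp add: mult_ac)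
  have "(LINT x:{0..1}|lborel. complex_of_real (?D x) * ?R x) = (LINT x|lborel. \<kappa> / complex_of_real (Gamma (1 - \<beta>)) * complex_of_real (indicator {0..1} x *\<^sub>R ((\<Sum>n. l n * jump n x) * ?m x)))"
    unfolding set_lebesgue_integral_def
  proof (rule integral_cong_AE)
    have "(\<lambda>x. indicator {0..1} x *\<^sub>R (complex_of_real (?D x) * ?R x)) =
        (\<lambda>x. complex_of_real (indicator {0..1} x *\<^sub>R ?D x) * (\<kappa> * complex_of_real (?m x)))"
      using R by (auto simp: indicator_def fun_eq_iff)
    also have "\<dots> \<in> borel_measurable lborel"
      using lm G_measurable
      by (intro borel_measurable_times borel_measurable_of_real borel_measurable_const) (simp_all del: of_real_mult scaleR_conv_of_real real_scaleR_def)
    finally show "(\<lambda>x. indicator {0..1} x *\<^sub>R (complex_of_real (?D x) * ?R x)) \<in> borel_measurable lborel" .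
    show "AE x in lborel. indicator {0..1} x *\<^sub>R (complex_of_real (?D x) * ?R x) = \<kappa> / complex_of_real (Gamma (1 - \<beta>)) * complex_of_real (indicator {0..1} x *\<^sub>R ((\<Sum>n. l n * jump n x) * ?m x))"
      using left_deriv_AE
    proof eventually_elim
      case (elim x)
      then show ?case using R[of x] by (cases "x \<in> {0..1}") simp_all
    qed
  qed measurable
  also have "\<dots> = \<kappa> / complex_of_real (Gamma (1 - \<beta>)) * complex_of_real (LINT x:{0..1}|lborel. (\<Sum>n. l n * jump n x) * ?m x)"
    unfolding set_lebesgue_integral_def by (simp only: integral_mult_right_zero integral_complex_of_real)
  also have "\<dots> = - (exp (\<i> * complex_of_real (pi * (1 - \<beta>))) * complex_of_real (\<Sum>n. l n * (g (d n) - g (c n))))"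
    unfolding I \<kappa>_def using \<Gamma> by (simp add: field_simps)
  finally have "gls_integral \<beta> 0 1 (step_sum l c d) g =
      - (exp (\<i> * complex_of_real (pi * \<beta>)) * exp (\<i> * complex_of_real (pi * (1 - \<beta>)))) * complex_of_real (\<Sum>n. l n * (g (d n) - g (c n)))"
    unfolding gls_integral_def by (simp only: mult_minus_right mult_minus_left mult.assoc)
  then show "gls_integral \<beta> 0 1 (step_sum l c d) g = complex_of_real (\<Sum>n. l n * (g (d n) - g (c n)))"
    unfolding phase by simp
qed

end

end

section \<open>Simple processes and holdings\<close>

context filtered_prob_space
begin

text \<open>Hiding the triple behind an integrand \<open>f\<close> and an integral \<open>J\<close>
  permits induction over windows; the bound \<open>u\<close> on the last grid time leaves room for a
  further block.\<close>

definition simple_upto where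
  "simple_upto W u f J \<longleftrightarrow> (\<exists>n \<tau> \<eta>. simple_integrand F n \<tau> \<eta> \<and> \<tau> n \<le> u \<and>
     simple_process n \<tau> \<eta> = f \<and> simple_ito_integral W n \<tau> \<eta> = J)"

lemma simple_upto_0: "simple_upto W 0 (\<lambda>t \<omega>. 0) (\<lambda>\<omega>. 0)"
  unfolding simple_upto_def
  by (rule exI[of _ 0], rule exI[of _ "\<lambda>_. 0"])
    (auto simp: simple_integrand_def simple_process_def simple_ito_integral_def fun_eq_iff)

lemma simple_upto_mono: "simple_upto W u f J \<Longrightarrow> u \<le> v \<Longrightarrow> simple_upto W v f J"
  unfolding simple_upto_def using order_trans by blast

text \<open>The grid of a simple process has no gaps, so a pause between its last time and
  \<open>c\<close> becomes an extra interval with position 0.\<close>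

lemma simple_upto_append:
  assumes s: "simple_upto W u f J" and c: "u \<le> c" "c < d" "d \<le> 1"
    and \<zeta>: "\<zeta> \<in> borel_measurable (F c)" "\<And>\<omega>. \<bar>\<zeta> \<omega>\<bar> \<le> C"
  shows "simple_upto W d (\<lambda>t \<omega>. f t \<omega> + \<zeta> \<omega> * indicator {c<..d} t) (\<lambda>\<omega>. J \<omega> + \<zeta> \<omega> * (W d \<omega> - W c \<omega>))"
proof -
  from s obtain n \<tau> \<eta> where s: "simple_integrand F n \<tau> \<eta>" "\<tau> n \<le> u"
    "simple_process n \<tau> \<eta> = f" "simple_ito_integral W n \<tau> \<eta> = J" by (auto simp: simple_upto_def)
  have \<tau>: "\<And>k. k \<le> n \<Longrightarrow> 0 \<le> \<tau> k \<and> \<tau> k \<le> 1" "\<And>k. k < n \<Longrightarrow> \<tau> k < \<tau> (Suc k)"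
    and \<eta>: "\<And>k. k < n \<Longrightarrow> \<eta> k \<in> borel_measurable (F (\<tau> k)) \<and> (\<exists>C. \<forall>\<omega>\<in>space (F (\<tau> k)). \<bar>\<eta> k \<omega>\<bar> \<le> C)"
    using s(1) by (auto simp: simple_integrand_def)
  have c0: "0 \<le> c" "c \<le> 1" using \<tau>(1)[of n] s(2) c by auto
  have \<zeta>_bdd: "\<exists>C. \<forall>\<omega>\<in>S. \<bar>\<zeta> \<omega>\<bar> \<le> C" for S using \<zeta>(2) by blast
  show ?thesis
  proof (cases "\<tau> n = c")
    case True
    let ?\<tau> = "\<tau>(Suc n := d)" and ?\<eta> = "\<eta>(n := \<zeta>)"
    have "simple_integrand F (Suc n) ?\<tau> ?\<eta>"
      unfolding simple_integrand_def using \<tau> \<eta> \<zeta>(1) \<zeta>_bdd c True c0 by (auto simp: le_Suc_eq less_Suc_eq)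
    moreover have "simple_process (Suc n) ?\<tau> ?\<eta> = (\<lambda>t \<omega>. f t \<omega> + \<zeta> \<omega> * indicator {c<..d} t)"
      unfolding s(3)[symmetric] by (auto simp: simple_process_def fun_eq_iff True)
    moreover have "simple_ito_integral W (Suc n) ?\<tau> ?\<eta> = (\<lambda>\<omega>. J \<omega> + \<zeta> \<omega> * (W d \<omega> - W c \<omega>))"
      unfolding s(4)[symmetric] by (auto simp: simple_ito_integral_def fun_eq_iff True)
    ultimately show ?thesis unfolding simple_upto_def by (intro exI[of _ "Suc n"] exI[of _ ?\<tau>] exI[of _ ?\<eta>]) auto
  next
    case False
    then have lt: "\<tau> n < c" using s(2) c by simp
    let ?\<tau> = "\<tau>(Suc n := c, Suc (Suc n) := d)" and ?\<eta> = "\<eta>(n := (\<lambda>_. 0), Suc n := \<zeta>)"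
    have "simple_integrand F (Suc (Suc n)) ?\<tau> ?\<eta>"
      unfolding simple_integrand_def using \<tau> \<eta> \<zeta>(1) \<zeta>_bdd c lt c0 by (auto simp: le_Suc_eq less_Suc_eq)
    moreover have "simple_process (Suc (Suc n)) ?\<tau> ?\<eta> = (\<lambda>t \<omega>. f t \<omega> + \<zeta> \<omega> * indicator {c<..d} t)"
      unfolding s(3)[symmetric] by (auto simp: simple_process_def fun_eq_iff)
    moreover have "simple_ito_integral W (Suc (Suc n)) ?\<tau> ?\<eta> = (\<lambda>\<omega>. J \<omega> + \<zeta> \<omega> * (W d \<omega> - W c \<omega>))"
      unfolding s(4)[symmetric] by (auto simp: simple_ito_integral_def fun_eq_iff)
    ultimately show ?thesis unfolding simple_upto_def by (intro exI[of _ "Suc (Suc n)"] exI[of _ ?\<tau>] exI[of _ ?\<eta>]) auto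
  qed
qed

text \<open>
  The position is \<open>\<Lambda>\<close> on \<open>(a, T]\<close>, where \<open>T\<close> takes values in a finite grid \<open>g\<close>; measurability of the
  positions \<open>\<eta> k\<close> on the grid intervals expresses that \<open>T\<close> is a stopping time.
\<close>

definition holding :: "real \<Rightarrow> real \<Rightarrow> ('a \<Rightarrow> real) \<Rightarrow> ('a \<Rightarrow> real) \<Rightarrow> bool" where
  "holding a b \<Lambda> T \<longleftrightarrow> 0 \<le> a \<and> a < b \<and> b < 1 \<and> \<Lambda> \<in> borel_measurable (F a) \<and> (\<exists>C. \<forall>\<omega>. \<bar>\<Lambda> \<omega>\<bar> \<le> C) \<and>
    (\<exists>N g \<eta> \<kappa>. g 0 = a \<and> g N = b \<and> (\<forall>k<N. g k < g (Suc k)) \<and>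
       (\<forall>k<N. \<eta> k \<in> borel_measurable (F (g k))) \<and>
       (\<forall>\<omega>. \<kappa> \<omega> \<le> N \<and> T \<omega> = g (\<kappa> \<omega>) \<and> (\<forall>k<N. \<eta> k \<omega> = (if k < \<kappa> \<omega> then \<Lambda> \<omega> else 0))))"

lemma holding_bounds: "holding a b \<Lambda> T \<Longrightarrow> 0 \<le> a \<and> a < b \<and> b < 1"
  by (simp add: holding_def)

text \<open>The form in which a holding is used: a position stopped at a random time is a sum over a
  deterministic grid, both for its value and for its gain along an arbitrary path
  \<open>Y\<close>.\<close>

definition grid_rep where
  "grid_rep a b \<Lambda> T N g \<eta> C \<longleftrightarrow> g 0 = a \<and> g N = b \<and> (\<forall>k<N. g k < g (Suc k)) \<and> (\<forall>k\<le>N. g k \<in> {a..b}) \<and>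
    (\<forall>k<N. \<eta> k \<in> borel_measurable (F (g k))) \<and> (\<forall>k<N. \<forall>\<omega>. \<bar>\<eta> k \<omega>\<bar> \<le> (C::real)) \<and>
    (\<forall>Y \<omega>. (\<Sum>k<N. \<eta> k \<omega> * (Y (g (Suc k)) - Y (g k))) = \<Lambda> \<omega> * (Y (T \<omega>) - Y a)) \<and>
    (\<forall>t \<omega>. (\<Sum>k<N. \<eta> k \<omega> * indicator {g k<..g (Suc k)} t) = \<Lambda> \<omega> * indicator {a<..T \<omega>} t) \<and>
    (\<forall>\<omega>. T \<omega> \<in> {a..b})"

lemma grid_repD:
  assumes "grid_rep a b \<Lambda> T N g \<eta> C"
  shows "g 0 = a" "g N = b" "\<And>k. k < N \<Longrightarrow> g k < g (Suc k)" "\<And>k. k \<le> N \<Longrightarrow> g k \<in> {a..b}"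
    "\<And>k. k < N \<Longrightarrow> \<eta> k \<in> borel_measurable (F (g k))" "\<And>k \<omega>. k < N \<Longrightarrow> \<bar>\<eta> k \<omega>\<bar> \<le> C"
    "\<And>Y \<omega>. (\<Sum>k<N. \<eta> k \<omega> * (Y (g (Suc k)) - Y (g k))) = \<Lambda> \<omega> * (Y (T \<omega>) - Y a)"
    "\<And>t \<omega>. (\<Sum>k<N. \<eta> k \<omega> * indicator {g k<..g (Suc k)} t) = \<Lambda> \<omega> * indicator {a<..T \<omega>} t"
    "\<And>\<omega>. T \<omega> \<in> {a..b}"
  using assms unfolding grid_rep_def by blast+

text \<open>\<open>\<eta> k\<close> equals \<open>\<Lambda>\<close> before \<open>\<kappa>\<close>
  and 0 from then on, so both sums end at \<open>\<kappa> \<omega>\<close> and telescope.\<close>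

lemma holding_grid:
  assumes "holding a b \<Lambda> T"
  shows "\<exists>N g \<eta> C. grid_rep a b \<Lambda> T N g \<eta> C"
proof -
  from assms obtain C where C: "\<And>\<omega>. \<bar>\<Lambda> \<omega>\<bar> \<le> C" unfolding holding_def by blast
  from assms obtain N g \<eta> \<kappa> where *: "g 0 = a" "g N = b" "\<forall>k<N. g k < g (Suc k)"
     "\<forall>k<N. \<eta> k \<in> borel_measurable (F (g k))"
     "\<forall>\<omega>. \<kappa> \<omega> \<le> N \<and> T \<omega> = g (\<kappa> \<omega>) \<and> (\<forall>k<N. \<eta> k \<omega> = (if k < \<kappa> \<omega> then \<Lambda> \<omega> else 0))"
    unfolding holding_def by blast
  have g: "g 0 = a" "g N = b" "\<And>k. k < N \<Longrightarrow> g k < g (Suc k)"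
    and \<kappa>: "\<And>\<omega>. \<kappa> \<omega> \<le> N" "\<And>\<omega>. T \<omega> = g (\<kappa> \<omega>)" "\<And>\<omega> k. k < N \<Longrightarrow> \<eta> k \<omega> = (if k < \<kappa> \<omega> then \<Lambda> \<omega> else 0)"
    using * by blast+
  have mono: "g i \<le> g j" if "i \<le> j" "j \<le> N" for i j
    using that
  proof (induction j rule: dec_induct)
    case (step m)
    then have "g i \<le> g m" by simp
    also have "\<dots> < g (Suc m)" using step by (intro g) simp
    finally show ?case by simp
  qed simp
  have range: "g k \<in> {a..b}" if "k \<le> N" for k using mono[of 0 k] mono[of k N] that g by auto
  have sum_\<kappa>: "(\<Sum>k<N. \<eta> k \<omega> * v k) = \<Lambda> \<omega> * (\<Sum>k<\<kappa> \<omega>. v k)" for v :: "nat \<Rightarrow> real" and \<omega>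
  proof -
    have "(\<Sum>k<N. \<eta> k \<omega> * v k) = (\<Sum>k<\<kappa> \<omega>. \<Lambda> \<omega> * v k)"
      using \<kappa>(1)[of \<omega>] \<kappa>(3)[of _ \<omega>] by (intro sum.mono_neutral_cong_right) auto
    then show ?thesis by (simp add: sum_distrib_left)
  qed
  have ind: "(\<Sum>k<j. indicator {g k<..g (Suc k)} t) = (indicator {a<..g j} t :: real)" if "j \<le> N" for j t
    using that
  proof (induction j)
    case (Suc j)
    have "g 0 \<le> g j" "g j < g (Suc j)" using mono[of 0 j] g(3)[of j] Suc.prems by auto
    then have "indicator {a<..g j} t + indicator {g j<..g (Suc j)} t = (indicator {a<..g (Suc j)} t :: real)"
      using g(1) by (auto simp: indicator_def)
    then show ?case using Suc by simp
  qed (simp add: g(1))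
  have "grid_rep a b \<Lambda> T N g \<eta> C"
    unfolding grid_rep_def
  proof (intro conjI allI impI g range)
    show "\<eta> k \<in> borel_measurable (F (g k))" if "k < N" for k using * that by blast
    show "\<bar>\<eta> k \<omega>\<bar> \<le> C" if "k < N" for k \<omega> using \<kappa>(3)[OF that, of \<omega>] C[of \<omega>] by (cases "k < \<kappa> \<omega>") auto
    show "(\<Sum>k<N. \<eta> k \<omega> * (Y (g (Suc k)) - Y (g k))) = \<Lambda> \<omega> * (Y (T \<omega>) - Y a)" for Y :: "real \<Rightarrow> real" and \<omega>
      unfolding sum_\<kappa> using sum_lessThan_telescope[of "\<lambda>k. Y (g k)" "\<kappa> \<omega>"] by (simp add: \<kappa>(2) g)
    show "(\<Sum>k<N. \<eta> k \<omega> * indicator {g k<..g (Suc k)} t) = \<Lambda> \<omega> * indicator {a<..T \<omega>} t" for t \<omega>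
      unfolding sum_\<kappa> ind[OF \<kappa>(1)] \<kappa>(2) ..
    show "T \<omega> \<in> {a..b}" for \<omega> using range \<kappa> by simp
  qed
  then show ?thesis by blast
qed

lemma holding_T: "holding a b \<Lambda> T \<Longrightarrow> T \<omega> \<in> {a..b}"
  using holding_grid grid_repD(9) by blast

lemma holding_simple_upto:
  assumes "simple_upto W u f J" "u \<le> a" "holding a b \<Lambda> T"
  shows "simple_upto W b (\<lambda>t \<omega>. f t \<omega> + \<Lambda> \<omega> * indicator {a<..T \<omega>} t) (\<lambda>\<omega>. J \<omega> + \<Lambda> \<omega> * (W (T \<omega>) \<omega> - W a \<omega>))"
proof -
  obtain N g \<eta> C where "grid_rep a b \<Lambda> T N g \<eta> C" using holding_grid[OF assms(3)] by blast
  note G = grid_repD[OF this]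
  note g = G(1-4) and \<eta> = G(5,6)
  have b1: "b < 1" using holding_bounds[OF assms(3)] by simp
  have "simple_upto W (g j) (\<lambda>t \<omega>. f t \<omega> + (\<Sum>k<j. \<eta> k \<omega> * indicator {g k<..g (Suc k)} t))
      (\<lambda>\<omega>. J \<omega> + (\<Sum>k<j. \<eta> k \<omega> * (W (g (Suc k)) \<omega> - W (g k) \<omega>)))" if "j \<le> N" for j
    using that
  proof (induction j)
    case 0
    then show ?case using simple_upto_mono[OF assms(1,2)] by (simp add: g)
  next
    case (Suc j)
    have "g (Suc j) \<le> 1" using g(4)[of "Suc j"] Suc.prems b1 by auto
    from simple_upto_append[OF Suc.IH order_refl g(3) this \<eta>(1) \<eta>(2)] Suc.prems
    show ?case by (simp add: add.assoc)
  qed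
  from this[of N] show ?thesis using G(7)[of _ "\<lambda>t. W t _"] by (simp add: G(8) g)
qed

lemma holding_value_measurable:
  assumes h: "holding a b \<Lambda> T" and Y: "\<And>t. t \<in> {0..1} \<Longrightarrow> Y t \<in> borel_measurable (F t)"
  shows "(\<lambda>\<omega>. \<Lambda> \<omega> * (Y (T \<omega>) \<omega> - Y a \<omega>)) \<in> borel_measurable (F b)"
proof -
  obtain N g \<eta> C where "grid_rep a b \<Lambda> T N g \<eta> C" using holding_grid[OF h] by blast
  note G = grid_repD[OF this]
  note g = G(1-4) and \<eta> = G(5,6)
  note ab = holding_bounds[OF h]
  have "(\<lambda>\<omega>. \<Sum>k<N. \<eta> k \<omega> * (Y (g (Suc k)) \<omega> - Y (g k) \<omega>)) \<in> borel_measurable (F b)"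
  proof (intro borel_measurable_sum borel_measurable_times borel_measurable_diff)
    fix k assume "k \<in> {..<N}"
    then have k: "g k \<in> {a..b}" "g (Suc k) \<in> {a..b}" "k < N" using g(4)[of k] g(4)[of "Suc k"] by auto
    show "\<eta> k \<in> borel_measurable (F b)"
      by (rule measurable_F_mono[OF \<eta>(1)]) (use k ab in auto)
    show "Y (g (Suc k)) \<in> borel_measurable (F b)" by (rule measurable_F_mono[OF Y]) (use k ab in auto)
    show "Y (g k) \<in> borel_measurable (F b)" by (rule measurable_F_mono[OF Y]) (use k ab in auto)
  qed
  then show ?thesis using G(7)[of _ "\<lambda>t. Y t _"] by simp
qed

lemma holding_position_adapted:
  assumes h: "holding a b \<Lambda> T" and t: "t \<in> {0..1}"
  shows "(\<lambda>\<omega>. \<Lambda> \<omega> * indicator {a<..T \<omega>} t) \<in> borel_measurable (F t)"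
proof -
  obtain N g \<eta> C where "grid_rep a b \<Lambda> T N g \<eta> C" using holding_grid[OF h] by blast
  note G = grid_repD[OF this]
  note g = G(1-4) and \<eta> = G(5,6)
  note ab = holding_bounds[OF h]
  have "(\<lambda>\<omega>. \<Sum>k<N. \<eta> k \<omega> * indicator {g k<..g (Suc k)} t) \<in> borel_measurable (F t)"
  proof (rule borel_measurable_sum)
    fix k assume "k \<in> {..<N}"
    then have k: "g k \<in> {a..b}" "k < N" using g(4)[of k] by auto
    show "(\<lambda>\<omega>. \<eta> k \<omega> * indicator {g k<..g (Suc k)} t) \<in> borel_measurable (F t)"
    \<comment> \<open>For \<open>t \<le> g k\<close> the left-open indicator vanishes; otherwise
      \<open>\<eta> k\<close> is already known at time \<open>t\<close>.\<close>
    proof (cases "g k < t")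
      case True
      have "\<eta> k \<in> borel_measurable (F t)"
        by (rule measurable_F_mono[OF \<eta>(1)]) (use k ab True t in auto)
      then show ?thesis by measurable
    qed simp
  qed
  then show ?thesis by (simp add: G(8))
qed

lemma holding_position_measurable:
  assumes h: "holding a b \<Lambda> T"
  shows "(\<lambda>(t, \<omega>). \<Lambda> \<omega> * indicator {a<..T \<omega>} t) \<in> borel_measurable (restrict_space borel {0..1} \<Otimes>\<^sub>M M)"
proof -
  obtain N g \<eta> C where "grid_rep a b \<Lambda> T N g \<eta> C" using holding_grid[OF h] by blast
  note G = grid_repD[OF this]
  note g = G(1-4) and \<eta> = G(5,6)
  note ab = holding_bounds[OF h]
  have "(\<lambda>(t, \<omega>). \<Sum>k<N. \<eta> k \<omega> * indicator {g k<..g (Suc k)} t) \<in> borel_measurable (restrict_space borel {0..1} \<Otimes>\<^sub>M M)"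
    unfolding case_prod_beta
  proof (intro borel_measurable_sum borel_measurable_times)
    fix k assume "k \<in> {..<N}"
    then have k: "g k \<in> {a..b}" "k < N" using g(4)[of k] by auto
    have [measurable]: "\<eta> k \<in> borel_measurable M"
      by (rule measurable_F_M[OF \<eta>(1)]) (use k ab in auto)
    show "(\<lambda>x. \<eta> k (snd x)) \<in> borel_measurable (restrict_space borel {0..1} \<Otimes>\<^sub>M M)" by measurable
    have "(\<lambda>t. indicator {g k<..g (Suc k)} t :: real) \<in> borel_measurable (restrict_space borel {0..1})"
      by (intro measurable_restrict_space1) simp
    then show "(\<lambda>x. indicator {g k<..g (Suc k)} (fst x) :: real) \<in> borel_measurable (restrict_space borel {0..1} \<Otimes>\<^sub>M M)"
      by (rule measurable_compose[OF measurable_fst])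
  qed
  then show ?thesis by (simp add: G(8))
qed

end

section \<open>A single hedging window\<close>

lemma holder_on_continuous_on:
  assumes h: "holder_on {0..1} \<alpha> L f" and "0 < \<alpha>"
  shows "continuous_on {0..1} f"
proof -
  have "continuous_on {0..1} (clamp01 f)"
    using holder_continuous[OF clamp01_holder[OF assms] assms(2)] by (rule continuous_on_subset) simp
  then have "continuous_on {0..1} (\<lambda>x. clamp01 f x + f 1)" by (intro continuous_intros)
  then show ?thesis by (rule continuous_on_eq) (simp add: clamp01_eq)
qed

lemma (in prob_space) rv_bounded_in_prob:
  assumes [measurable]: "random_variable borel (D :: 'a \<Rightarrow> real)" and "\<epsilon> > 0"
  shows "\<exists>C\<ge>0. prob {\<omega>\<in>space M. \<bar>D \<omega>\<bar> > C} \<le> \<epsilon>"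
proof -
  define A where "A n = {\<omega>\<in>space M. \<bar>D \<omega>\<bar> > real n}" for n :: nat
  have "(\<lambda>n. prob (A n)) \<longlonglongrightarrow> prob (\<Inter>n. A n)"
    by (intro finite_Lim_measure_decseq) (auto simp: A_def decseq_def)
  also have "(\<Inter>n. A n) = {}"
  proof -
    have "\<omega> \<notin> A (nat \<lceil>\<bar>D \<omega>\<bar>\<rceil>)" for \<omega> by (simp add: A_def not_less)
    then show ?thesis by blast
  qed
  finally have "(\<lambda>n. prob (A n)) \<longlonglongrightarrow> 0" by simp
  from order_tendstoD(2)[OF this \<open>\<epsilon> > 0\<close>] obtain n where "prob (A n) < \<epsilon>"
    by (auto simp: eventually_sequentially)
  then show ?thesis by (intro exI[of _ "real n"]) (simp add: A_def)
qed

text \<open>A window length has to meet two demands at once, one on the cost of the position and one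
  on the influence of \<open>B\<close>.\<close>

lemma small_powr_exists:
  fixes p q :: real
  assumes "0 < p" "0 < q" "0 < b" "0 < \<epsilon>1" "0 < \<epsilon>2"
  shows "\<exists>h. 0 < h \<and> h < b \<and> C1 * h powr p \<le> \<epsilon>1 \<and> C2 * h powr q \<le> \<epsilon>2"
proof -
  have lim: "((\<lambda>h. C * h powr r) \<longlongrightarrow> 0) (at_right 0)" if "0 < r" for C r :: real
  proof -
    have "((\<lambda>h. h powr r) \<longlongrightarrow> 0 powr r) (at_right 0)"
      using that by (intro tendsto_powr' tendsto_intros) (auto simp: eventually_at_right_less intro!: eventually_at_rightI[of 0 1])
    then have "((\<lambda>h. C * h powr r) \<longlongrightarrow> C * 0 powr r) (at_right 0)" by (rule tendsto_mult_left)
    then show ?thesis using that by simp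
  qed
  have "\<forall>\<^sub>F h in at_right 0. 0 < h \<and> h < b \<and> C1 * h powr p < \<epsilon>1 \<and> C2 * h powr q < \<epsilon>2"
    using assms order_tendstoD(2)[OF lim[OF assms(1), of C1] assms(4)] order_tendstoD(2)[OF lim[OF assms(2), of C2] assms(5)]
    by (intro eventually_conj) (auto intro: eventually_at_rightI[of 0 b])
  then obtain h where "0 < h \<and> h < b \<and> C1 * h powr p < \<epsilon>1 \<and> C2 * h powr q < \<epsilon>2"
    using eventually_happens'[OF trivial_limit_at_right_real] by blast
  then show ?thesis by (auto intro: less_imp_le)
qed

text \<open>
  The path \<open>f\<close> passes through \<open>D\<close> at some time, so it is within \<open>\<theta>\<close> of \<open>D\<close> at the closest grid
  point to the left.
\<close>

lemma grid_hit:
  fixes f :: "real \<Rightarrow> real"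
  assumes h: "0 < h" and N: "0 < (N::nat)" and cont: "continuous_on {a..a+h} f" and fa: "f a = 0"
    and up: "\<exists>t\<in>{a..a+h}. f t \<ge> \<bar>D\<bar>" and down: "\<exists>t\<in>{a..a+h}. f t \<le> - \<bar>D\<bar>"
    and osc: "\<And>s t. s \<in> {a..a+h} \<Longrightarrow> t \<in> {a..a+h} \<Longrightarrow> \<bar>t - s\<bar> \<le> h / real N \<Longrightarrow> \<bar>f t - f s\<bar> \<le> \<theta>"
  shows "\<exists>k\<le>N. \<bar>f (a + h * real k / real N) - D\<bar> \<le> \<theta>"
proof -
  obtain t where t: "t \<in> {a..a+h}" "f t = D"
  proof (cases "D \<ge> 0")
    case True
    from up obtain u where u: "u \<in> {a..a+h}" "f u \<ge> D" using True by auto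
    then have "\<exists>t. a \<le> t \<and> t \<le> u \<and> f t = D"
      using True fa by (intro IVT') (auto intro: continuous_on_subset[OF cont])
    then obtain t where "a \<le> t" "t \<le> u" "f t = D" by blast
    then show ?thesis using that[of t] u by auto
  next
    case False
    from down obtain u where u: "u \<in> {a..a+h}" "f u \<le> D" using False by auto
    then have "\<exists>t. a \<le> t \<and> t \<le> u \<and> f t = D"
      using False fa by (intro IVT2') (auto intro: continuous_on_subset[OF cont])
    then obtain t where "a \<le> t" "t \<le> u" "f t = D" by blast
    then show ?thesis using that[of t] u by auto
  qed
  \<comment> \<open>The hitting time in units of the mesh; its floor gives the grid point to the
    left.\<close>
  define y where "y = (t - a) * real N / h"
  define k where "k = nat \<lfloor>y\<rfloor>"
  have "(t - a) * real N / h \<le> h * real N / h"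
    using t h by (intro divide_right_mono mult_right_mono) auto
  then have y: "0 \<le> y" "y \<le> real N" using t h by (auto simp: y_def)
  have k: "real k \<le> y" "y < real k + 1" unfolding k_def using y by linarith+
  have kN: "k \<le> N" using k(1) y(2) by linarith
  have ty: "t = a + h * y / real N" using h N by (simp add: y_def)
  have "h * real k / real N \<le> h * real N / real N"
    using h N kN by (intro divide_right_mono mult_left_mono) auto
  then have "a + h * real k / real N \<in> {a..a+h}" using h N by auto
  moreover have "t - (a + h * real k / real N) = h * (y - real k) / real N"
    unfolding ty by (simp add: diff_divide_distrib right_diff_distrib)
  moreover have "0 \<le> h * (y - real k) / real N" "h * (y - real k) / real N \<le> h * 1 / real N"
    using h N k by (auto intro!: divide_right_mono mult_left_mono divide_nonneg_nonneg mult_nonneg_nonneg)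
  ultimately have "\<bar>f (a + h * real k / real N) - f t\<bar> \<le> \<theta>"
    by (intro osc t(1)) (auto simp: abs_minus_commute)
  then show ?thesis using t kN by auto
qed

context filtered_prob_space
begin

text \<open>The constants are fixed in the order \<open>K\<close>, \<open>L\<close>,
  \<open>L'\<close>, \<open>h\<close>, \<open>N\<close>, none of them depending on
  \<open>\<omega>\<close>. The factor 5 counts the exceptional events: a large \<open>D\<close>, a
  rough path of \<open>B\<close>, a rough path of \<open>W\<close>, a missing upward move, a missing
  downward move.\<close>

lemma holding_window:
  fixes B W :: "real \<Rightarrow> 'a \<Rightarrow> real"
  assumes W: "wiener_process M F W" and B: "fractional_brownian_motion M H B" and adB: "adapted F B"
    and \<alpha>: "1 / 2 < \<alpha>" "\<alpha> < H" and \<beta>: "0 < \<beta>" "\<beta> < 1 / 2"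
    and \<epsilon>: "0 < \<epsilon>" and \<delta>: "0 < \<delta>"
    and up: "\<And>a h. 0 \<le> a \<Longrightarrow> 0 < h \<Longrightarrow> a + h \<le> 1 \<Longrightarrow> \<exists>E\<in>sets M. prob E \<le> \<epsilon> \<and>
      (\<forall>\<omega>\<in>space M - E. \<exists>t\<in>{a..a+h}. W t \<omega> - W a \<omega> \<ge> \<delta> * sqrt h)"
    and down: "\<And>a h. 0 \<le> a \<Longrightarrow> 0 < h \<Longrightarrow> a + h \<le> 1 \<Longrightarrow> \<exists>E\<in>sets M. prob E \<le> \<epsilon> \<and>
      (\<forall>\<omega>\<in>space M - E. \<exists>t\<in>{a..a+h}. W a \<omega> - W t \<omega> \<ge> \<delta> * sqrt h)"
    and a: "0 \<le> a" "a < 1" and D: "D \<in> borel_measurable (F a)" and \<theta>: "0 < \<theta>" and \<epsilon>': "0 < \<epsilon>'"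
  shows "\<exists>b \<Lambda> T. holding a b \<Lambda> T \<and> (\<forall>\<omega>. 0 \<le> \<Lambda> \<omega> \<and> \<Lambda> \<omega> * (b - a) powr (1 - \<beta>) \<le> \<epsilon>') \<and>
    (\<exists>E\<in>sets M. prob E \<le> 5 * \<epsilon> \<and> (\<forall>\<omega>\<in>space M - E.
      \<bar>\<Lambda> \<omega> * (B (T \<omega>) \<omega> + W (T \<omega>) \<omega> - (B a \<omega> + W a \<omega>)) - D \<omega>\<bar> \<le> \<theta> \<and>
      (\<Lambda> \<omega>)\<^sup>2 * (b - a) \<le> ((\<bar>D \<omega>\<bar> + 2 * \<theta>) / \<delta>)\<^sup>2))"
proof -
  have DM[measurable]: "D \<in> borel_measurable M" using measurable_F_M[OF D] a by simp
  \<comment> \<open>This cut-off bounds \<open>\<Lambda>\<close> and makes a window length common to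
    all \<open>\<omega>\<close> possible.\<close>
  obtain K where K: "0 \<le> K" "prob {\<omega>\<in>space M. \<bar>D \<omega>\<bar> > K} \<le> \<epsilon>"
    using rv_bounded_in_prob[OF DM \<epsilon>] by blast
  obtain L E2 where E2: "E2 \<in> sets M" "prob E2 \<le> \<epsilon>" "\<And>\<omega>. \<omega> \<in> space M - E2 \<Longrightarrow> holder_on {0..1} \<alpha> L (\<lambda>t. B t \<omega>)"
    using fbm_holder[OF B _ \<alpha>(2) \<epsilon>] \<alpha> by (metis less_trans half_gt_zero zero_less_one)
  obtain L' E3 where E3: "E3 \<in> sets M" "prob E3 \<le> \<epsilon>" "\<And>\<omega>. \<omega> \<in> space M - E3 \<Longrightarrow> holder_on {0..1} (1 / 8) L' (\<lambda>t. W t \<omega>)"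
    using wiener_holder[OF W \<epsilon>] by metis
  define C where "C = (K + 2 * \<theta>) / \<delta>"
  have C0: "0 \<le> C" using K \<theta> \<delta> by (simp add: C_def)
  \<comment> \<open>As \<open>\<Lambda>\<close> is at most \<open>C / sqrt h\<close>, the cost is at
    most \<open>C * h powr (1 / 2 - \<beta>)\<close> and the influence of \<open>B\<close> at most
    \<open>C * L * h powr (\<alpha> - 1 / 2)\<close>. Both exponents are positive thanks to
    \<open>\<beta> < 1 / 2 < \<alpha>\<close>.\<close>
  obtain h where h: "0 < h" "h < 1 - a" "C * h powr (1 / 2 - \<beta>) \<le> \<epsilon>'" "C * L * h powr (\<alpha> - 1 / 2) \<le> \<theta>"
    using small_powr_exists[of "1 / 2 - \<beta>" "\<alpha> - 1 / 2" "1 - a" \<epsilon>' \<theta> C "C * L"] \<alpha> \<beta> a \<epsilon>' \<theta> by auto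
  have ah: "a + h \<le> 1" "{a..a+h} \<subseteq> {0..1}" using h a by auto
  obtain E4 where E4: "E4 \<in> sets M" "prob E4 \<le> \<epsilon>" "\<And>\<omega>. \<omega> \<in> space M - E4 \<Longrightarrow> \<exists>t\<in>{a..a+h}. W t \<omega> - W a \<omega> \<ge> \<delta> * sqrt h"
    using up[OF a(1) h(1) ah(1)] by blast
  obtain E5 where E5: "E5 \<in> sets M" "prob E5 \<le> \<epsilon>" "\<And>\<omega>. \<omega> \<in> space M - E5 \<Longrightarrow> \<exists>t\<in>{a..a+h}. W a \<omega> - W t \<omega> \<ge> \<delta> * sqrt h"
    using down[OF a(1) h(1) ah(1)] by blast
  have sqh: "0 < sqrt h" using h by simp
  \<comment> \<open>A move of \<open>W\<close> by \<open>\<delta> * sqrt h\<close> then gains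
    \<open>\<bar>D \<omega>\<bar> + 2 * \<theta>\<close>, whose surplus absorbs the contribution of
    \<open>B\<close>, which is at most \<open>\<theta>\<close>.\<close>
  define \<Lambda> where "\<Lambda> \<omega> = (if \<bar>D \<omega>\<bar> \<le> K then (\<bar>D \<omega>\<bar> + 2 * \<theta>) / (\<delta> * sqrt h) else 0)" for \<omega>
  have \<Lambda>0: "0 \<le> \<Lambda> \<omega>" for \<omega> using \<theta> \<delta> h by (simp add: \<Lambda>_def)
  have \<Lambda>C: "\<Lambda> \<omega> \<le> C / sqrt h" for \<omega>
  proof -
    have "(\<bar>D \<omega>\<bar> + 2 * \<theta>) / (\<delta> * sqrt h) \<le> (K + 2 * \<theta>) / (\<delta> * sqrt h)" if "\<bar>D \<omega>\<bar> \<le> K"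
      using that \<delta> sqh by (intro divide_right_mono) auto
    moreover have "0 \<le> C / sqrt h" using C0 sqh by simp
    ultimately show ?thesis by (cases "\<bar>D \<omega>\<bar> \<le> K") (simp_all add: \<Lambda>_def C_def)
  qed
  have \<Lambda>F: "\<Lambda> \<in> borel_measurable (F a)"
    using D unfolding \<Lambda>_def by measurable
  have sqrt_powr: "C / sqrt h * h powr r = C * h powr (r - 1 / 2)" for r
    using h by (simp add: powr_diff powr_half_sqrt)
  have \<Lambda>_powr: "\<Lambda> \<omega> * h powr r \<le> C * h powr (r - 1 / 2)" for \<omega> r
    unfolding sqrt_powr[symmetric] by (intro mult_right_mono \<Lambda>C) auto
  define X where "X t \<omega> = B t \<omega> + W t \<omega>" for t \<omega>
  have XF: "X t \<in> borel_measurable (F t)" if "t \<in> {0..1}" for t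
    unfolding X_def using adB wiener_measurable[OF W that] that by (intro borel_measurable_add) (auto simp: adapted_def)
  \<comment> \<open>The mesh is so fine, for the \<open>h\<close> already chosen, that the gain
    moves by at most \<open>\<theta>\<close> between neighbouring grid points.\<close>
  obtain N :: nat where N: "0 < N" "C / sqrt h * (L * (h / real N) powr \<alpha> + L' * (h / real N) powr (1 / 8)) \<le> \<theta>"
  proof -
    have z: "(\<lambda>n. h / real n) \<longlonglongrightarrow> 0" by (rule lim_const_over_n)
    have "(\<lambda>n. C / sqrt h * (L * (h / real n) powr \<alpha> + L' * (h / real n) powr (1 / 8))) \<longlonglongrightarrow> C / sqrt h * (L * 0 powr \<alpha> + L' * 0 powr (1 / 8))"
      using \<alpha> h by (intro tendsto_intros tendsto_powr'[OF z]) auto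
    then have "(\<lambda>n. C / sqrt h * (L * (h / real n) powr \<alpha> + L' * (h / real n) powr (1 / 8))) \<longlonglongrightarrow> 0" using \<alpha> by simp
    from order_tendstoD(2)[OF this \<theta>] obtain n0 where n0: "\<And>n. n \<ge> n0 \<Longrightarrow> C / sqrt h * (L * (h / real n) powr \<alpha> + L' * (h / real n) powr (1 / 8)) < \<theta>"
      unfolding eventually_sequentially by blast
    show ?thesis by (rule that[of "Suc n0"]) (use n0[of "Suc n0"] in auto)
  qed
  define g where "g k = a + h * real k / real N" for k
  have g: "g 0 = a" "g N = a + h" "g k < g (Suc k)" for k
    using N(1) h by (auto simp: g_def divide_strict_right_mono)
  have g_range: "g k \<in> {a..a+h}" if "k \<le> N" for k
  proof -
    have "h * real k / real N \<le> h * real N / real N" using h that by (intro divide_right_mono mult_left_mono) auto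
    then show ?thesis using N(1) h by (auto simp: g_def)
  qed
  define P where "P k \<omega> \<longleftrightarrow> \<bar>\<Lambda> \<omega> * (X (g k) \<omega> - X a \<omega>) - D \<omega>\<bar> \<le> \<theta>" for k \<omega>
  \<comment> \<open>The first grid point at which the gain is close to the target, with
    \<open>N\<close> as the default.\<close>
  define \<kappa> where "\<kappa> \<omega> = (LEAST k. k = N \<or> P k \<omega>)" for \<omega>
  define \<eta> where "\<eta> k \<omega> = (if k < \<kappa> \<omega> then \<Lambda> \<omega> else 0)" for k \<omega>
  have \<kappa>N: "\<kappa> \<omega> \<le> N" for \<omega> unfolding \<kappa>_def by (rule Least_le) simp
  \<comment> \<open>Whether the position is still held after \<open>g k\<close> is decided by the
    events up to time \<open>g k\<close>: the stopping time property.\<close>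
  have less_\<kappa>: "k < \<kappa> \<omega> \<longleftrightarrow> (\<forall>j\<le>k. \<not> P j \<omega>)" if "k < N" for k \<omega>
  proof
    assume "k < \<kappa> \<omega>"
    then have "\<not> (j = N \<or> P j \<omega>)" if "j \<le> k" for j
      using that not_less_Least[of j "\<lambda>k. k = N \<or> P k \<omega>"] by (simp add: \<kappa>_def)
    then show "\<forall>j\<le>k. \<not> P j \<omega>" by blast
  next
    assume *: "\<forall>j\<le>k. \<not> P j \<omega>"
    have "\<kappa> \<omega> = N \<or> P (\<kappa> \<omega>) \<omega>" unfolding \<kappa>_def by (rule LeastI[of _ N]) simp
    then show "k < \<kappa> \<omega>" using * that by (metis not_le)
  qed
  have \<eta>F: "\<eta> k \<in> borel_measurable (F (g k))" if "k < N" for k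
  proof -
    have gk: "0 \<le> g k" "g k \<le> 1" "a \<le> g k" using g_range[of k] that a h by auto
    have [measurable]: "\<Lambda> \<in> borel_measurable (F (g k))" "D \<in> borel_measurable (F (g k))" "X a \<in> borel_measurable (F (g k))"
      using measurable_F_mono[OF _ a(1) gk(3,2)] \<Lambda>F D XF[of a] a by auto
    have X[measurable]: "X (g j) \<in> borel_measurable (F (g k))" if "j \<le> k" for j
    proof (rule measurable_F_mono[OF XF])
      have "g j \<le> g k" using that h N(1) by (auto simp: g_def intro!: divide_right_mono mult_left_mono)
      moreover have "a \<le> g j" using h N(1) by (simp add: g_def)
      ultimately show "g j \<in> {0..1}" "0 \<le> g j" "g j \<le> g k" "g k \<le> 1" using gk a by auto
    qed
    have Pm: "{\<omega>\<in>space (F (g k)). P j \<omega>} \<in> sets (F (g k))" if "j \<le> k" for j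
      unfolding P_def using X[OF that] by measurable
    have "{\<omega>\<in>space (F (g k)). k < \<kappa> \<omega>} = space (F (g k)) - (\<Union>j\<in>{..k}. {\<omega>\<in>space (F (g k)). P j \<omega>})"
      using less_\<kappa>[OF that] by auto
    also have "\<dots> \<in> sets (F (g k))" using Pm by (intro sets.Diff sets.top sets.finite_UN) auto
    finally have [measurable]: "{\<omega>\<in>space (F (g k)). k < \<kappa> \<omega>} \<in> sets (F (g k))" .
    show ?thesis unfolding \<eta>_def by (rule measurable_If) measurable
  qed
  define T where "T \<omega> = g (\<kappa> \<omega>)" for \<omega>
  have hold: "holding a (a + h) \<Lambda> T"
    unfolding holding_def
  proof (intro conjI)
    show "\<exists>C. \<forall>\<omega>. \<bar>\<Lambda> \<omega>\<bar> \<le> C" using \<Lambda>C \<Lambda>0 by (intro exI[of _ "C / sqrt h"]) auto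
    show "\<exists>N g \<eta> \<kappa>. g 0 = a \<and> g N = a + h \<and> (\<forall>k<N. g k < g (Suc k)) \<and>
       (\<forall>k<N. \<eta> k \<in> borel_measurable (F (g k))) \<and>
       (\<forall>\<omega>. \<kappa> \<omega> \<le> N \<and> T \<omega> = g (\<kappa> \<omega>) \<and> (\<forall>k<N. \<eta> k \<omega> = (if k < \<kappa> \<omega> then \<Lambda> \<omega> else 0)))"
      using g \<eta>F \<kappa>N by (intro exI[of _ N] exI[of _ g] exI[of _ \<eta>] exI[of _ \<kappa>]) (simp add: T_def \<eta>_def)
  qed (use a h \<Lambda>F in auto)
  have cost: "\<Lambda> \<omega> * (a + h - a) powr (1 - \<beta>) \<le> \<epsilon>'" for \<omega>
    using \<Lambda>_powr[of \<omega> "1 - \<beta>"] h(3) by (simp add: algebra_simps)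
  let ?E1 = "{\<omega>\<in>space M. \<bar>D \<omega>\<bar> > K}"
  define E where "E = ?E1 \<union> (E2 \<union> (E3 \<union> (E4 \<union> E5)))"
  have "E \<in> sets M" unfolding E_def using E2 E3 E4 E5 by auto
  moreover have "prob E \<le> 5 * \<epsilon>"
  proof -
    have "prob E \<le> prob ?E1 + (prob E2 + (prob E3 + (prob E4 + prob E5)))"
      unfolding E_def using E2 E3 E4 E5
      by (intro order_trans[OF measure_Un_le] add_left_mono) auto
    then show ?thesis using K E2 E3 E4 E5 by linarith
  qed
  moreover have "\<bar>\<Lambda> \<omega> * (X (T \<omega>) \<omega> - X a \<omega>) - D \<omega>\<bar> \<le> \<theta> \<and> (\<Lambda> \<omega>)\<^sup>2 * h \<le> ((\<bar>D \<omega>\<bar> + 2 * \<theta>) / \<delta>)\<^sup>2"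
    if \<omega>: "\<omega> \<in> space M - E" for \<omega>
  proof
    have DK: "\<bar>D \<omega>\<bar> \<le> K" using \<omega> by (auto simp: E_def)
    then have \<Lambda>: "\<Lambda> \<omega> = (\<bar>D \<omega>\<bar> + 2 * \<theta>) / (\<delta> * sqrt h)" by (simp add: \<Lambda>_def)
    then show "(\<Lambda> \<omega>)\<^sup>2 * h \<le> ((\<bar>D \<omega>\<bar> + 2 * \<theta>) / \<delta>)\<^sup>2"
      using h by (simp add: power_divide power_mult_distrib)
    have \<Lambda>\<delta>: "\<Lambda> \<omega> * (\<delta> * sqrt h) = \<bar>D \<omega>\<bar> + 2 * \<theta>" using \<delta> sqh unfolding \<Lambda> by simp
    have hB: "holder_on {0..1} \<alpha> L (\<lambda>t. B t \<omega>)" using E2(3) \<omega> by (simp add: E_def)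
    have hW: "holder_on {0..1} (1 / 8) L' (\<lambda>t. W t \<omega>)" using E3(3) \<omega> by (simp add: E_def)
    have L0: "0 \<le> L" "0 \<le> L'" using hB hW by (auto simp: holder_on_def)
    define f where "f t = \<Lambda> \<omega> * (X t \<omega> - X a \<omega>)" for t
    have B_small: "\<Lambda> \<omega> * \<bar>B t \<omega> - B a \<omega>\<bar> \<le> \<theta>" if t: "t \<in> {a..a+h}" for t
    proof -
      have "\<bar>B t \<omega> - B a \<omega>\<bar> \<le> L * \<bar>t - a\<bar> powr \<alpha>" using t ah a by (intro holder_onD[OF hB]) auto
      also have "\<dots> \<le> L * h powr \<alpha>" using t \<alpha> L0 by (intro mult_left_mono powr_mono2) auto
      finally have "\<Lambda> \<omega> * \<bar>B t \<omega> - B a \<omega>\<bar> \<le> \<Lambda> \<omega> * (L * h powr \<alpha>)" using \<Lambda>0 by (rule mult_left_mono)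
      also have "\<dots> = L * (\<Lambda> \<omega> * h powr \<alpha>)" by simp
      also have "\<dots> \<le> L * (C * h powr (\<alpha> - 1 / 2))" using \<Lambda>_powr L0 by (intro mult_left_mono) auto
      finally show ?thesis using h(4) by (simp add: mult_ac)
    qed
    have f_eq: "f t = \<Lambda> \<omega> * (B t \<omega> - B a \<omega>) + \<Lambda> \<omega> * (W t \<omega> - W a \<omega>)" for t
      by (simp add: f_def X_def algebra_simps)
    have absB: "\<bar>\<Lambda> \<omega> * (B t \<omega> - B a \<omega>)\<bar> \<le> \<theta>" if "t \<in> {a..a+h}" for t
      using B_small[OF that] \<Lambda>0[of \<omega>] by (simp add: abs_mult)
    have "\<exists>k\<le>N. \<bar>f (a + h * real k / real N) - D \<omega>\<bar> \<le> \<theta>"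
    proof (rule grid_hit[OF h(1) N(1)])
      have "continuous_on {0..1} (\<lambda>t. B t \<omega>)" "continuous_on {0..1} (\<lambda>t. W t \<omega>)"
        using holder_on_continuous_on[OF hB] holder_on_continuous_on[OF hW] \<alpha> by auto
      then have "continuous_on {0..1} f" unfolding f_def X_def by (intro continuous_intros)
      then show "continuous_on {a..a+h} f" by (rule continuous_on_subset) (rule ah)
      show "f a = 0" by (simp add: f_def)
      obtain t where t: "t \<in> {a..a+h}" "W t \<omega> - W a \<omega> \<ge> \<delta> * sqrt h" using E4(3)[of \<omega>] \<omega> by (auto simp: E_def)
      have "\<Lambda> \<omega> * (\<delta> * sqrt h) \<le> \<Lambda> \<omega> * (W t \<omega> - W a \<omega>)" using t \<Lambda>0 by (intro mult_left_mono) auto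
      then have "\<bar>D \<omega>\<bar> \<le> f t" unfolding \<Lambda>\<delta> f_eq using absB[OF t(1)] \<theta> by linarith
      then show "\<exists>t\<in>{a..a+h}. f t \<ge> \<bar>D \<omega>\<bar>" using t by blast
      obtain s where s: "s \<in> {a..a+h}" "W a \<omega> - W s \<omega> \<ge> \<delta> * sqrt h" using E5(3)[of \<omega>] \<omega> by (auto simp: E_def)
      have "\<Lambda> \<omega> * (W s \<omega> - W a \<omega>) \<le> \<Lambda> \<omega> * (- (\<delta> * sqrt h))" using s \<Lambda>0 by (intro mult_left_mono) auto
      then have "f s \<le> - \<bar>D \<omega>\<bar>" unfolding f_eq using \<Lambda>\<delta> absB[OF s(1)] \<theta> by simp
      then show "\<exists>t\<in>{a..a+h}. f t \<le> - \<bar>D \<omega>\<bar>" using s by blast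
      fix s t assume st: "s \<in> {a..a+h}" "t \<in> {a..a+h}" "\<bar>t - s\<bar> \<le> h / real N"
      have "\<bar>B t \<omega> - B s \<omega>\<bar> \<le> L * \<bar>t - s\<bar> powr \<alpha>" using st ah by (intro holder_onD[OF hB]) auto
      also have "\<dots> \<le> L * (h / real N) powr \<alpha>" using st \<alpha> L0 by (intro mult_left_mono powr_mono2) auto
      finally have 1: "\<bar>B t \<omega> - B s \<omega>\<bar> \<le> L * (h / real N) powr \<alpha>" .
      have "\<bar>W t \<omega> - W s \<omega>\<bar> \<le> L' * \<bar>t - s\<bar> powr (1 / 8)" using st ah by (intro holder_onD[OF hW]) auto
      also have "\<dots> \<le> L' * (h / real N) powr (1 / 8)" using st L0 by (intro mult_left_mono powr_mono2) auto
      finally have 2: "\<bar>W t \<omega> - W s \<omega>\<bar> \<le> L' * (h / real N) powr (1 / 8)" .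
      have "f t - f s = \<Lambda> \<omega> * ((B t \<omega> - B s \<omega>) + (W t \<omega> - W s \<omega>))" by (simp add: f_def X_def algebra_simps)
      then have "\<bar>f t - f s\<bar> = \<Lambda> \<omega> * \<bar>(B t \<omega> - B s \<omega>) + (W t \<omega> - W s \<omega>)\<bar>" using \<Lambda>0[of \<omega>] by (simp add: abs_mult)
      also have "\<dots> \<le> C / sqrt h * (L * (h / real N) powr \<alpha> + L' * (h / real N) powr (1 / 8))"
        using 1 2 \<Lambda>C[of \<omega>] C0 sqh by (intro mult_mono) (auto intro: order_trans[OF abs_triangle_ineq])
      finally show "\<bar>f t - f s\<bar> \<le> \<theta>" using N(2) by simp
    qed
    then obtain k where k: "k \<le> N" "P k \<omega>" by (auto simp: P_def f_def g_def)
    have "\<kappa> \<omega> = N \<or> P (\<kappa> \<omega>) \<omega>" unfolding \<kappa>_def by (rule LeastI[of _ N]) simp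
    moreover have "\<kappa> \<omega> \<le> k" unfolding \<kappa>_def using k by (intro Least_le) simp
    \<comment> \<open>If the default \<open>N\<close> occurs, then \<open>k = N\<close>, so the
      target is met there as well.\<close>
    ultimately have "P (\<kappa> \<omega>) \<omega>" using k by (metis le_antisym)
    then show "\<bar>\<Lambda> \<omega> * (X (T \<omega>) \<omega> - X a \<omega>) - D \<omega>\<bar> \<le> \<theta>" by (simp add: P_def T_def)
  qed
  ultimately show ?thesis
    using hold cost \<Lambda>0 by (intro exI[of _ "a + h"] exI[of _ \<Lambda>] exI[of _ T]) (auto simp: X_def)
qed

end

section \<open>The hedging sequence\<close>

context prob_space
begin

text \<open>The points where \<open>P\<close> fails lie in every \<open>E n\<close>, and the
  intersection of these sets is null. This turns a bound with prescribed failure probability into an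
  almost sure statement.\<close>

lemma AE_of_small_exceptional_sets:
  assumes "\<And>\<epsilon>. \<epsilon> > 0 \<Longrightarrow> \<exists>E\<in>sets M. prob E \<le> \<epsilon> \<and> (\<forall>\<omega>\<in>space M - E. P \<omega>)"
  shows "AE \<omega> in M. P \<omega>"
proof -
  have "\<forall>n. \<exists>E. E \<in> sets M \<and> prob E \<le> 1 / (real n + 1) \<and> (\<forall>\<omega>\<in>space M - E. P \<omega>)"
  proof
    fix n :: nat
    show "\<exists>E. E \<in> sets M \<and> prob E \<le> 1 / (real n + 1) \<and> (\<forall>\<omega>\<in>space M - E. P \<omega>)"
    proof -
      have "0 < 1 / (real n + 1)" by (simp add: add_nonneg_pos)
      from assms[OF this] show ?thesis by blast
    qed
  qed
  then obtain E where E: "\<And>n. E n \<in> sets M" "\<And>n. prob (E n) \<le> 1 / (real n + 1)"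
    "\<And>n \<omega>. \<omega> \<in> space M - E n \<Longrightarrow> P \<omega>" by metis
  have "prob (\<Inter>n. E n) \<le> 0"
  proof (rule LIMSEQ_le_const)
    show "(\<lambda>n. 1 / (real n + 1)) \<longlonglongrightarrow> 0" using LIMSEQ_Suc[OF lim_inverse_n'] by (simp add: add.commute)
    have "prob (\<Inter>n. E n) \<le> 1 / (real n + 1)" for n
    proof -
      have "prob (\<Inter>n. E n) \<le> prob (E n)" using E(1) by (intro finite_measure_mono) auto
      then show ?thesis using E(2)[of n] by linarith
    qed
    then show "\<exists>N. \<forall>n\<ge>N. prob (\<Inter>n. E n) \<le> 1 / (real n + 1)" by blast
  qed
  then have "prob (\<Inter>n. E n) = 0" by (rule order_antisym) simp
  then have "(\<Inter>n. E n) \<in> null_sets M" using E(1) by (auto simp: null_sets_def emeasure_eq_measure)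
  moreover have "{\<omega>\<in>space M. \<not> P \<omega>} \<subseteq> (\<Inter>n. E n)" using E(3) by blast
  ultimately show ?thesis by (rule AE_I')
qed

text \<open>Dominated convergence for indicators. Working with subsets \<open>C m\<close> of
  measurable sets allows an event described by an inner integral to be handled through an upper
  bound for that integral.\<close>

lemma prob_tendsto_0:
  assumes A: "\<And>m. A m \<in> sets M" and ev: "AE \<omega> in M. eventually (\<lambda>m. \<omega> \<notin> A m) sequentially"
    and sub: "\<And>m. C m \<subseteq> A m"
  shows "(\<lambda>m. prob (C m)) \<longlonglongrightarrow> 0"
proof (rule tendsto_sandwich[of "\<lambda>_. 0" _ _ "\<lambda>m. prob (A m)"])
  have "(\<lambda>m. LINT \<omega>|M. indicator (A m) \<omega> :: real) \<longlonglongrightarrow> (LINT \<omega>|M. 0)"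
  proof (rule integral_dominated_convergence[where w = "\<lambda>_. 1"])
    show "AE \<omega> in M. (\<lambda>m. indicator (A m) \<omega> :: real) \<longlonglongrightarrow> 0"
      using ev
    proof eventually_elim
      case (elim \<omega>)
      then have "\<forall>\<^sub>F m in sequentially. (indicator (A m) \<omega> :: real) = 0" by eventually_elim simp
      then show ?case by (rule tendsto_eventually)
    qed
  qed (use A in \<open>auto simp: indicator_def\<close>)
  then show "(\<lambda>m. prob (A m)) \<longlonglongrightarrow> 0" using A by simp
  show "\<forall>\<^sub>F m in sequentially. prob (C m) \<le> prob (A m)"
  proof (intro always_eventually allI)
    fix m show "prob (C m) \<le> prob (A m)"
      using finite_measure_mono[OF sub A] .
  qed
qed auto

end

text \<open>The smaller of the two constants for \<open>W\<close> and for \<open>- W\<close> serves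
  both directions.\<close>

lemma (in filtered_prob_space) wiener_exceeds_both:
  assumes W: "wiener_process M F W" and \<epsilon>: "\<epsilon> > 0"
  shows "\<exists>\<delta>>0. (\<forall>a h. 0 \<le> a \<longrightarrow> 0 < h \<longrightarrow> a + h \<le> 1 \<longrightarrow> (\<exists>E\<in>sets M. prob E \<le> \<epsilon> \<and>
      (\<forall>\<omega>\<in>space M - E. \<exists>t\<in>{a..a+h}. W t \<omega> - W a \<omega> \<ge> \<delta> * sqrt h))) \<and>
    (\<forall>a h. 0 \<le> a \<longrightarrow> 0 < h \<longrightarrow> a + h \<le> 1 \<longrightarrow> (\<exists>E\<in>sets M. prob E \<le> \<epsilon> \<and>
      (\<forall>\<omega>\<in>space M - E. \<exists>t\<in>{a..a+h}. W a \<omega> - W t \<omega> \<ge> \<delta> * sqrt h)))"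
proof -
  obtain d1 where d1: "d1 > 0" "\<forall>a h. 0 \<le> a \<longrightarrow> 0 < h \<longrightarrow> a + h \<le> 1 \<longrightarrow> (\<exists>E\<in>sets M. prob E \<le> \<epsilon> \<and>
      (\<forall>\<omega>\<in>space M - E. \<exists>t\<in>{a..a+h}. W t \<omega> - W a \<omega> \<ge> d1 * sqrt h))"
    using wiener_exceeds[OF W \<epsilon>] by blast
  obtain d2 where d2: "d2 > 0" "\<forall>a h. 0 \<le> a \<longrightarrow> 0 < h \<longrightarrow> a + h \<le> 1 \<longrightarrow> (\<exists>E\<in>sets M. prob E \<le> \<epsilon> \<and>
      (\<forall>\<omega>\<in>space M - E. \<exists>t\<in>{a..a+h}. - W t \<omega> - - W a \<omega> \<ge> d2 * sqrt h))"
    using wiener_exceeds[OF wiener_uminus[OF W] \<epsilon>] by blast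
  have le: "min d1 d2 * sqrt h \<le> d1 * sqrt h" "min d1 d2 * sqrt h \<le> d2 * sqrt h" if "0 < h" for h
    using that by (auto intro!: mult_right_mono)
  show ?thesis
  proof (intro exI[of _ "min d1 d2"] conjI allI impI)
    fix a h :: real assume ah: "0 \<le> a" "0 < h" "a + h \<le> 1"
    obtain E where E: "E \<in> sets M" "prob E \<le> \<epsilon>" "\<forall>\<omega>\<in>space M - E. \<exists>t\<in>{a..a+h}. W t \<omega> - W a \<omega> \<ge> d1 * sqrt h"
      using d1(2)[rule_format, OF ah] by blast
    have "\<exists>t\<in>{a..a+h}. W t \<omega> - W a \<omega> \<ge> min d1 d2 * sqrt h" if \<omega>: "\<omega> \<in> space M - E" for \<omega>
    proof -
      obtain t where "t \<in> {a..a+h}" "W t \<omega> - W a \<omega> \<ge> d1 * sqrt h" using E(3) \<omega> by blast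
      then show ?thesis using le(1)[OF ah(2)] by (intro bexI[of _ t]) auto
    qed
    then show "\<exists>E\<in>sets M. prob E \<le> \<epsilon> \<and> (\<forall>\<omega>\<in>space M - E. \<exists>t\<in>{a..a+h}. W t \<omega> - W a \<omega> \<ge> min d1 d2 * sqrt h)"
      using E by blast
    obtain E where E: "E \<in> sets M" "prob E \<le> \<epsilon>" "\<forall>\<omega>\<in>space M - E. \<exists>t\<in>{a..a+h}. - W t \<omega> - - W a \<omega> \<ge> d2 * sqrt h"
      using d2(2)[rule_format, OF ah] by blast
    have "\<exists>t\<in>{a..a+h}. W a \<omega> - W t \<omega> \<ge> min d1 d2 * sqrt h" if \<omega>: "\<omega> \<in> space M - E" for \<omega>
    proof -
      obtain t where "t \<in> {a..a+h}" "- W t \<omega> - - W a \<omega> \<ge> d2 * sqrt h" using E(3) \<omega> by blast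
      then show ?thesis using le(2)[OF ah(2)] by (intro bexI[of _ t]) auto
    qed
    then show "\<exists>E\<in>sets M. prob E \<le> \<epsilon> \<and> (\<forall>\<omega>\<in>space M - E. \<exists>t\<in>{a..a+h}. W a \<omega> - W t \<omega> \<ge> min d1 d2 * sqrt h)"
      using E by blast
  qed (use d1 d2 in auto)
qed

text \<open>
  On the \<open>n\<close>-th window the squared integrand has integral at most \<open>(\<Lambda> n)\<^sup>2 * (b n - a n)\<close>.
\<close>

definition (in filtered_prob_space) hedge where
  "hedge B W \<beta> \<xi> a b \<Lambda> T \<longleftrightarrow>
     (\<forall>n. holding (a n) (b n) (\<Lambda> n) (T n)) \<and> (\<forall>n. b n \<le> a (Suc n)) \<and> a \<longlonglongrightarrow> 1 \<and>
     (\<forall>n \<omega>. 0 \<le> \<Lambda> n \<omega> \<and> \<Lambda> n \<omega> * (b n - a n) powr (1 - \<beta>) \<le> (1 / 2) ^ n) \<and>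
     (AE \<omega> in M. (\<lambda>n. \<Lambda> n \<omega> * (B (T n \<omega>) \<omega> + W (T n \<omega>) \<omega> - (B (a n) \<omega> + W (a n) \<omega>))) sums \<xi> \<omega>) \<and>
     (AE \<omega> in M. summable (\<lambda>n. (\<Lambda> n \<omega>)\<^sup>2 * (b n - a n)))"

context filtered_prob_space
begin

text \<open>The sequences \<open>\<epsilon>\<close>, \<open>\<delta>\<close>,
  \<open>\<theta>\<close> and the approximations \<open>Z\<close> are fixed in advance for all
  \<open>n\<close>; only the windows are chosen recursively, since a deficit depends on the gains so
  far.\<close>

lemma hedge_exists:
  fixes B W :: "real \<Rightarrow> 'a \<Rightarrow> real"
  assumes W: "wiener_process M F W" and B: "fractional_brownian_motion M H B" and adB: "adapted F B"
    and \<alpha>: "1 / 2 < \<alpha>" "\<alpha> < H" and \<beta>: "0 < \<beta>" "\<beta> < 1 / 2"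
    and lc: "left_continuous_at_1 M F" and \<xi>: "\<xi> \<in> borel_measurable (F 1)"
  shows "\<exists>a b \<Lambda> T. hedge B W \<beta> \<xi> a b \<Lambda> T"
proof -
  have \<xi>M[measurable]: "\<xi> \<in> borel_measurable M" using measurable_F_M[OF \<xi>] by simp
  define \<epsilon> :: "nat \<Rightarrow> real" where "\<epsilon> n = (1 / 2) ^ n" for n
  have \<epsilon>: "0 < \<epsilon> n" for n by (simp add: \<epsilon>_def)
  define hit where "hit n d \<longleftrightarrow> d > 0 \<and> (\<forall>a h. 0 \<le> a \<longrightarrow> 0 < h \<longrightarrow> a + h \<le> 1 \<longrightarrow> (\<exists>E\<in>sets M. prob E \<le> \<epsilon> n \<and>
      (\<forall>\<omega>\<in>space M - E. \<exists>t\<in>{a..a+h}. W t \<omega> - W a \<omega> \<ge> d * sqrt h))) \<and>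
    (\<forall>a h. 0 \<le> a \<longrightarrow> 0 < h \<longrightarrow> a + h \<le> 1 \<longrightarrow> (\<exists>E\<in>sets M. prob E \<le> \<epsilon> n \<and>
      (\<forall>\<omega>\<in>space M - E. \<exists>t\<in>{a..a+h}. W a \<omega> - W t \<omega> \<ge> d * sqrt h)))" for n d
  have "\<forall>n. \<exists>d. hit n d"
    unfolding hit_def by (intro allI wiener_exceeds_both[OF W \<epsilon>])
  from choice[OF this] obtain \<delta> where hit: "\<And>n. hit n (\<delta> n)" by blast
  have \<delta>: "0 < \<delta> n" for n using hit[of n] by (simp add: hit_def)
  have up: "\<exists>E\<in>sets M. prob E \<le> \<epsilon> n \<and> (\<forall>\<omega>\<in>space M - E. \<exists>t\<in>{a..a+h}. W t \<omega> - W a \<omega> \<ge> \<delta> n * sqrt h)"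
    if "0 \<le> a" "0 < h" "a + h \<le> 1" for n a h
    using hit[of n, unfolded hit_def] that by simp
  have down: "\<exists>E\<in>sets M. prob E \<le> \<epsilon> n \<and> (\<forall>\<omega>\<in>space M - E. \<exists>t\<in>{a..a+h}. W a \<omega> - W t \<omega> \<ge> \<delta> n * sqrt h)"
    if "0 \<le> a" "0 < h" "a + h \<le> 1" for n a h
    using hit[of n, unfolded hit_def] that by simp
  \<comment> \<open>Comparison with \<open>\<delta> n\<close> controls the error of window
    \<open>n\<close> in its own energy, comparison with \<open>\<delta> (Suc n)\<close> the deficit
    that it leaves to the next window.\<close>
  define \<theta> where "\<theta> n = \<epsilon> n * min 1 (min (\<delta> n) (\<delta> (Suc n)))" for n
  have \<theta>: "0 < \<theta> n" for n using \<epsilon> \<delta> by (simp add: \<theta>_def)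
  have \<theta>_le: "\<theta> n \<le> \<epsilon> n" "\<theta> n \<le> \<epsilon> n * \<delta> n" "\<theta> n \<le> \<epsilon> n * \<delta> (Suc n)" for n
    using \<epsilon>[of n] by (auto simp: \<theta>_def intro: mult_left_le)
  define appr where "appr n p \<longleftrightarrow> fst p \<in> {0..<1} \<and> snd p \<in> borel_measurable (F (fst p)) \<and>
    prob {\<omega>\<in>space M. \<bar>snd p \<omega> - \<xi> \<omega>\<bar> > \<theta> n} \<le> \<theta> n" for n and p :: "real \<times> ('a \<Rightarrow> real)"
  have "\<forall>n. \<exists>p. appr n p"
  proof
    fix n
    obtain t Z where "t \<in> {0..<1}" "Z \<in> borel_measurable (F t)" "prob {\<omega>\<in>space M. \<bar>Z \<omega> - \<xi> \<omega>\<bar> > \<theta> n} \<le> \<theta> n"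
      using approximable_rv[OF lc \<xi> \<theta>[of n]] by (elim bexE)
    then show "\<exists>p. appr n p" by (intro exI[of _ "(t, Z)"]) (simp add: appr_def)
  qed
  from choice[OF this] obtain p where p: "\<And>n. appr n (p n)" by blast
  define z Z where zZ: "z n = fst (p n)" "Z n = snd (p n)" for n
  have z: "z n \<in> {0..<1}" and Z: "Z n \<in> borel_measurable (F (z n))"
    "prob {\<omega>\<in>space M. \<bar>Z n \<omega> - \<xi> \<omega>\<bar> > \<theta> n} \<le> \<theta> n" for n
    using p[of n] by (auto simp: zZ appr_def)
  define gain where "gain a \<Lambda> T \<omega> = \<Lambda> \<omega> * (B (T \<omega>) \<omega> + W (T \<omega>) \<omega> - (B a \<omega> + W a \<omega>))"
    for a :: real and \<Lambda> T :: "'a \<Rightarrow> real" and \<omega>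
  define good where "good n a b \<Lambda> T \<longleftrightarrow> holding a b \<Lambda> T \<and> 1 - 1 / (real n + 1) \<le> a \<and>
    (\<forall>\<omega>. 0 \<le> \<Lambda> \<omega> \<and> \<Lambda> \<omega> * (b - a) powr (1 - \<beta>) \<le> \<epsilon> n)" for n :: nat and a b \<Lambda> T
  have step: "\<exists>a b \<Lambda> T. good n a b \<Lambda> T \<and> b0 \<le> a \<and> (\<lambda>\<omega>. S0 \<omega> + gain a \<Lambda> T \<omega>) \<in> borel_measurable (F b) \<and>
      (\<exists>E\<in>sets M. prob E \<le> 5 * \<epsilon> n \<and> (\<forall>\<omega>\<in>space M - E. \<bar>S0 \<omega> + gain a \<Lambda> T \<omega> - Z n \<omega>\<bar> \<le> \<theta> n \<and>
        (\<Lambda> \<omega>)\<^sup>2 * (b - a) \<le> ((\<bar>Z n \<omega> - S0 \<omega>\<bar> + 2 * \<theta> n) / \<delta> n)\<^sup>2))"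
    if b0: "0 \<le> b0" "b0 < 1" and S0: "S0 \<in> borel_measurable (F b0)" for n b0 S0
  proof -
    \<comment> \<open>After the preceding window, late enough for \<open>Z n\<close> to be known,
      and within \<open>1 / (real n + 1)\<close> of 1.\<close>
    define a where "a = max b0 (max (z n) (1 - 1 / (real n + 1)))"
    have a: "0 \<le> a" "a < 1" "b0 \<le> a" "z n \<le> a" "1 - 1 / (real n + 1) \<le> a"
      using b0 z[of n] by (auto simp: a_def)
    have S0a[measurable]: "S0 \<in> borel_measurable (F a)" using measurable_F_mono[OF S0] a b0 by auto
    have [measurable]: "Z n \<in> borel_measurable (F a)" using measurable_F_mono[OF Z(1)] a z[of n] by auto
    have D: "(\<lambda>\<omega>. Z n \<omega> - S0 \<omega>) \<in> borel_measurable (F a)" by measurable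
    obtain b \<Lambda> T E where hold: "holding a b \<Lambda> T" "\<And>\<omega>. 0 \<le> \<Lambda> \<omega> \<and> \<Lambda> \<omega> * (b - a) powr (1 - \<beta>) \<le> \<epsilon> n"
      and E: "E \<in> sets M" "prob E \<le> 5 * \<epsilon> n"
        "\<And>\<omega>. \<omega> \<in> space M - E \<Longrightarrow> \<bar>gain a \<Lambda> T \<omega> - (Z n \<omega> - S0 \<omega>)\<bar> \<le> \<theta> n \<and>
          (\<Lambda> \<omega>)\<^sup>2 * (b - a) \<le> ((\<bar>Z n \<omega> - S0 \<omega>\<bar> + 2 * \<theta> n) / \<delta> n)\<^sup>2"
      using holding_window[OF W B adB \<alpha> \<beta> \<epsilon>[of n] \<delta>[of n] up down a(1,2) D \<theta>[of n] \<epsilon>[of n]]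
      unfolding gain_def by blast
    have b: "0 \<le> a \<and> a < b \<and> b < 1" using holding_bounds[OF hold(1)] .
    have XF: "(\<lambda>\<omega>. B t \<omega> + W t \<omega>) \<in> borel_measurable (F t)" if "t \<in> {0..1}" for t
      using adB wiener_measurable[OF W that] that by (intro borel_measurable_add) (auto simp: adapted_def)
    have "gain a \<Lambda> T \<in> borel_measurable (F b)"
      using holding_value_measurable[OF hold(1), of "\<lambda>t \<omega>. B t \<omega> + W t \<omega>"] XF unfolding gain_def by simp
    moreover have "S0 \<in> borel_measurable (F b)" using measurable_F_mono[OF S0a] b by auto
    ultimately have "(\<lambda>\<omega>. S0 \<omega> + gain a \<Lambda> T \<omega>) \<in> borel_measurable (F b)" by measurable
    moreover have "\<bar>S0 \<omega> + gain a \<Lambda> T \<omega> - Z n \<omega>\<bar> \<le> \<theta> n" if "\<omega> \<in> space M - E" for \<omega>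
      using E(3)[OF that] by (simp add: algebra_simps)
    ultimately show ?thesis
      using hold E a unfolding good_def by blast
  qed
  \<comment> \<open>The state is a window with its position and the gain \<open>S\<close>
    accumulated up to its end. Success involves the gain before the window, so it is a relation
    between consecutive states and stands in \<open>?Q\<close>; it is thus recorded from the second
    window on, which is enough for limits.\<close>
  let ?P = "\<lambda>n (a, b, \<Lambda>, T, S). good n a b \<Lambda> T \<and> S \<in> borel_measurable (F b) \<and> (n = 0 \<longrightarrow> S = gain a \<Lambda> T)"
  let ?Q = "\<lambda>n (a, b, \<Lambda>, T, S) (a', b', \<Lambda>', T', S'). b \<le> a' \<and> S' = (\<lambda>\<omega>. S \<omega> + gain a' \<Lambda>' T' \<omega>) \<and>
     (\<exists>E\<in>sets M. prob E \<le> 5 * \<epsilon> (Suc n) \<and> (\<forall>\<omega>\<in>space M - E. \<bar>S' \<omega> - Z (Suc n) \<omega>\<bar> \<le> \<theta> (Suc n) \<and>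
        (\<Lambda>' \<omega>)\<^sup>2 * (b' - a') \<le> ((\<bar>Z (Suc n) \<omega> - S \<omega>\<bar> + 2 * \<theta> (Suc n)) / \<delta> (Suc n))\<^sup>2))"
  have "\<exists>f. \<forall>n. ?P n (f n) \<and> ?Q n (f n) (f (Suc n))"
  proof (rule dependent_nat_choice)
    obtain a b \<Lambda> T where "good 0 a b \<Lambda> T" "(\<lambda>\<omega>. 0 + gain a \<Lambda> T \<omega>) \<in> borel_measurable (F b)"
      using step[of 0 "\<lambda>_. 0" 0] by auto
    then show "\<exists>x. ?P 0 x" by (intro exI[of _ "(a, b, \<Lambda>, T, gain a \<Lambda> T)"]) simp
  next
    fix x n assume x: "?P n x"
    obtain a b \<Lambda> T S where x_eq: "x = (a, b, \<Lambda>, T, S)" by (cases x)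
    have S: "holding a b \<Lambda> T" "S \<in> borel_measurable (F b)" using x by (auto simp: x_eq good_def)
    have b: "0 \<le> b" "b < 1" using holding_bounds[OF S(1)] by auto
    obtain a' b' \<Lambda>' T' where new: "good (Suc n) a' b' \<Lambda>' T'" "b \<le> a'" "(\<lambda>\<omega>. S \<omega> + gain a' \<Lambda>' T' \<omega>) \<in> borel_measurable (F b')"
      "\<exists>E\<in>sets M. prob E \<le> 5 * \<epsilon> (Suc n) \<and> (\<forall>\<omega>\<in>space M - E. \<bar>S \<omega> + gain a' \<Lambda>' T' \<omega> - Z (Suc n) \<omega>\<bar> \<le> \<theta> (Suc n) \<and>
        (\<Lambda>' \<omega>)\<^sup>2 * (b' - a') \<le> ((\<bar>Z (Suc n) \<omega> - S \<omega>\<bar> + 2 * \<theta> (Suc n)) / \<delta> (Suc n))\<^sup>2)"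
      using step[OF b S(2), of "Suc n"] by blast
    then show "\<exists>y. ?P (Suc n) y \<and> ?Q n x y"
      by (intro exI[of _ "(a', b', \<Lambda>', T', \<lambda>\<omega>. S \<omega> + gain a' \<Lambda>' T' \<omega>)"]) (simp add: x_eq)
  qed
  then obtain f where f: "\<forall>n. ?P n (f n) \<and> ?Q n (f n) (f (Suc n))" by (elim exE)
  define a b \<Lambda> T S where defs: "a n = fst (f n)" "b n = fst (snd (f n))" "\<Lambda> n = fst (snd (snd (f n)))"
    "T n = fst (snd (snd (snd (f n))))" "S n = snd (snd (snd (snd (f n))))" for n
  have f_eq: "f n = (a n, b n, \<Lambda> n, T n, S n)" for n by (simp add: defs)
  have P: "good n (a n) (b n) (\<Lambda> n) (T n) \<and> S n \<in> borel_measurable (F (b n)) \<and> (n = 0 \<longrightarrow> S n = gain (a n) (\<Lambda> n) (T n))" for n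
    using f[rule_format, THEN conjunct1, of n] unfolding f_eq prod.case .
  have Q: "b n \<le> a (Suc n) \<and> S (Suc n) = (\<lambda>\<omega>. S n \<omega> + gain (a (Suc n)) (\<Lambda> (Suc n)) (T (Suc n)) \<omega>) \<and>
     (\<exists>E\<in>sets M. prob E \<le> 5 * \<epsilon> (Suc n) \<and> (\<forall>\<omega>\<in>space M - E. \<bar>S (Suc n) \<omega> - Z (Suc n) \<omega>\<bar> \<le> \<theta> (Suc n) \<and>
        (\<Lambda> (Suc n) \<omega>)\<^sup>2 * (b (Suc n) - a (Suc n)) \<le> ((\<bar>Z (Suc n) \<omega> - S n \<omega>\<bar> + 2 * \<theta> (Suc n)) / \<delta> (Suc n))\<^sup>2))" for n
    using f[rule_format, THEN conjunct2, of n] unfolding f_eq prod.case .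
  have good: "good n (a n) (b n) (\<Lambda> n) (T n)" and ba: "b n \<le> a (Suc n)"
    and S0: "S 0 = gain (a 0) (\<Lambda> 0) (T 0)" and SS: "S (Suc n) = (\<lambda>\<omega>. S n \<omega> + gain (a (Suc n)) (\<Lambda> (Suc n)) (T (Suc n)) \<omega>)" for n
    using P[of n] P[of 0] Q[of n] by blast+
  define exc where "exc n E \<longleftrightarrow> E \<in> sets M \<and> prob E \<le> 5 * \<epsilon> (Suc n) \<and> (\<forall>\<omega>\<in>space M - E. \<bar>S (Suc n) \<omega> - Z (Suc n) \<omega>\<bar> \<le> \<theta> (Suc n) \<and>
        (\<Lambda> (Suc n) \<omega>)\<^sup>2 * (b (Suc n) - a (Suc n)) \<le> ((\<bar>Z (Suc n) \<omega> - S n \<omega>\<bar> + 2 * \<theta> (Suc n)) / \<delta> (Suc n))\<^sup>2)" for n E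
  have "\<forall>n. \<exists>E. exc n E"
  proof
    fix n show "\<exists>E. exc n E" using Q[of n] unfolding exc_def by blast
  qed
  from choice[OF this] obtain E where exc: "\<And>n. exc n (E n)" by blast
  have E: "E n \<in> sets M" "prob (E n) \<le> 5 * \<epsilon> (Suc n)"
    "\<omega> \<in> space M - E n \<Longrightarrow> \<bar>S (Suc n) \<omega> - Z (Suc n) \<omega>\<bar> \<le> \<theta> (Suc n) \<and>
        (\<Lambda> (Suc n) \<omega>)\<^sup>2 * (b (Suc n) - a (Suc n)) \<le> ((\<bar>Z (Suc n) \<omega> - S n \<omega>\<bar> + 2 * \<theta> (Suc n)) / \<delta> (Suc n))\<^sup>2" for n \<omega>
    using exc[of n] by (auto simp: exc_def)
  have hold: "holding (a n) (b n) (\<Lambda> n) (T n)" and \<Lambda>: "0 \<le> \<Lambda> n \<omega>" "\<Lambda> n \<omega> * (b n - a n) powr (1 - \<beta>) \<le> (1 / 2) ^ n"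
    and an: "1 - 1 / (real n + 1) \<le> a n" for n \<omega>
    using good[of n] by (auto simp: good_def \<epsilon>_def)
  have ab: "0 \<le> a n" "a n < b n" "b n < 1" for n using holding_bounds[OF hold] by auto
  have a_lim: "a \<longlonglongrightarrow> 1"
  proof (rule tendsto_sandwich[of "\<lambda>n. 1 - 1 / (real n + 1)" _ _ "\<lambda>_. 1"])
    have "(\<lambda>n. 1 / (real n + 1)) \<longlonglongrightarrow> 0" using LIMSEQ_Suc[OF lim_inverse_n'] by (simp add: add.commute)
    then have "(\<lambda>n. 1 - 1 / (real n + 1)) \<longlonglongrightarrow> 1 - 0" by (intro tendsto_intros)
    then show "(\<lambda>n. 1 - 1 / (real n + 1)) \<longlonglongrightarrow> 1" by simp
    show "\<forall>\<^sub>F n in sequentially. a n \<le> 1" 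
    proof (intro always_eventually allI)
      show "a n \<le> 1" for n using ab(2,3)[of n] by linarith
    qed
  qed (use an in auto)
  have S_sum: "S n \<omega> = (\<Sum>k<Suc n. gain (a k) (\<Lambda> k) (T k) \<omega>)" for n \<omega>
    by (induction n) (simp_all add: S0 SS)
  \<comment> \<open>Failure of window \<open>Suc n\<close> or a bad approximation there. The
    probability is at most \<open>5 * \<epsilon> (Suc n) + \<theta> (Suc n)\<close>, hence at most
    \<open>6 * \<epsilon> (Suc n)\<close>.\<close>
  define A where "A n = E n \<union> {\<omega>\<in>space M. \<bar>Z (Suc n) \<omega> - \<xi> \<omega>\<bar> > \<theta> (Suc n)}" for n
  have [measurable]: "Z n \<in> borel_measurable M" for n using measurable_F_M[OF Z(1)[of n]] z[of n] by auto
  have AM: "A n \<in> sets M" for n unfolding A_def using E(1)[of n] by measurable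
  have "prob (A n) \<le> 6 * (1 / 2) ^ Suc n" for n
  proof -
    have "prob (A n) \<le> prob (E n) + prob {\<omega>\<in>space M. \<bar>Z (Suc n) \<omega> - \<xi> \<omega>\<bar> > \<theta> (Suc n)}"
      unfolding A_def using E(1)[of n] by (intro measure_Un_le) auto
    also have "\<dots> \<le> 5 * \<epsilon> (Suc n) + \<epsilon> (Suc n)" using E(2)[of n] Z(2)[of "Suc n"] \<theta>_le(1)[of "Suc n"] by linarith
    finally show ?thesis by (simp add: \<epsilon>_def)
  qed
  note PA = this
  have "summable (\<lambda>n. (1 / 2 :: real) ^ Suc n)" by (subst summable_Suc_iff) (rule summable_geometric, simp)
  then have "summable (\<lambda>n. 6 * (1 / 2 :: real) ^ Suc n)" by (rule summable_mult)
  then have "summable (\<lambda>n. prob (A n))"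
    by (rule summable_comparison_test'[where N = 0]) (use PA in simp)
  then have ev: "AE \<omega> in M. \<forall>\<^sub>F n in sequentially. \<omega> \<in> space M - A n"
    using AM by (intro borel_cantelli_AE1) (auto simp: emeasure_eq_measure)
  have conv: "(\<lambda>n. S n \<omega>) \<longlonglongrightarrow> \<xi> \<omega> \<and> summable (\<lambda>n. (\<Lambda> n \<omega>)\<^sup>2 * (b n - a n))"
    if "\<forall>\<^sub>F n in sequentially. \<omega> \<in> space M - A n" for \<omega>
  proof -
    from that obtain N where N: "\<And>n. n \<ge> N \<Longrightarrow> \<omega> \<in> space M - A n" by (auto simp: eventually_sequentially)
    have n1: "\<bar>S (Suc n) \<omega> - Z (Suc n) \<omega>\<bar> \<le> \<theta> (Suc n)" "\<bar>Z (Suc n) \<omega> - \<xi> \<omega>\<bar> \<le> \<theta> (Suc n)"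
        "(\<Lambda> (Suc n) \<omega>)\<^sup>2 * (b (Suc n) - a (Suc n)) \<le> ((\<bar>Z (Suc n) \<omega> - S n \<omega>\<bar> + 2 * \<theta> (Suc n)) / \<delta> (Suc n))\<^sup>2"
      if "n \<ge> N" for n
      using N[OF that] E(3)[of \<omega> n] by (auto simp: A_def)
    have close: "\<bar>S (Suc n) \<omega> - \<xi> \<omega>\<bar> \<le> 2 * \<theta> (Suc n)" if "n \<ge> N" for n
      using n1(1,2)[OF that] by linarith
    have "(\<lambda>n. S (Suc n) \<omega>) \<longlonglongrightarrow> \<xi> \<omega>"
    proof (rule LIM_zero_cancel, rule Lim_null_comparison)
      show "\<forall>\<^sub>F n in sequentially. norm (S (Suc n) \<omega> - \<xi> \<omega>) \<le> 2 * (1 / 2) ^ Suc n"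
        using close \<theta>_le(1) unfolding eventually_sequentially \<epsilon>_def
        by (intro exI[of _ N]) (smt (verit, best) real_norm_def)
      have "(\<lambda>n. (1 / 2 :: real) ^ Suc n) \<longlonglongrightarrow> 0" by (rule LIMSEQ_Suc[OF LIMSEQ_realpow_zero]) auto
      from tendsto_mult_left[OF this, of 2] show "(\<lambda>n. 2 * (1 / 2 :: real) ^ Suc n) \<longlonglongrightarrow> 0" by simp
    qed
    then have 1: "(\<lambda>n. S n \<omega>) \<longlonglongrightarrow> \<xi> \<omega>" by (rule LIMSEQ_imp_Suc)
    have energy: "(\<Lambda> (Suc (Suc n)) \<omega>)\<^sup>2 * (b (Suc (Suc n)) - a (Suc (Suc n))) \<le> 25 * (1 / 4) ^ n" if n: "n \<ge> N" for n
    proof -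
      let ?m = "Suc (Suc n)"
      \<comment> \<open>The deficit is at most \<open>\<theta> ?m + 2 * \<theta> (Suc n)\<close>,
        where the last term comes from the success of window \<open>Suc n\<close>. Hence the index
        shift by two and the comparison of \<open>\<theta> (Suc n)\<close> with
        \<open>\<delta> ?m\<close>.\<close>
      have "\<bar>Z ?m \<omega> - S (Suc n) \<omega>\<bar> + 2 * \<theta> ?m \<le> 3 * \<theta> ?m + 2 * \<theta> (Suc n)"
        using n1(2)[of "Suc n"] close[of n] n by linarith
      also have "\<dots> \<le> 3 * (\<epsilon> ?m * \<delta> ?m) + 2 * (\<epsilon> (Suc n) * \<delta> ?m)"
        using \<theta>_le(2)[of ?m] \<theta>_le(3)[of "Suc n"] by linarith
      also have "\<dots> = (3 * \<epsilon> ?m + 2 * \<epsilon> (Suc n)) * \<delta> ?m" by (simp add: algebra_simps)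
      also have "\<dots> \<le> 5 * (1 / 2) ^ n * \<delta> ?m"
        using \<delta>[of ?m] by (intro mult_right_mono) (auto simp: \<epsilon>_def)
      finally have "(\<bar>Z ?m \<omega> - S (Suc n) \<omega>\<bar> + 2 * \<theta> ?m) / \<delta> ?m \<le> 5 * (1 / 2) ^ n"
        using \<delta>[of ?m] by (simp add: pos_divide_le_eq)
      then have "((\<bar>Z ?m \<omega> - S (Suc n) \<omega>\<bar> + 2 * \<theta> ?m) / \<delta> ?m)\<^sup>2 \<le> (5 * (1 / 2) ^ n)\<^sup>2"
        using \<theta>[of ?m] \<delta>[of ?m] by (intro power_mono) auto
      also have "(5 * (1 / 2 :: real) ^ n)\<^sup>2 = 25 * (1 / 4) ^ n"
        by (induction n) (simp_all add: power2_eq_square)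
      finally show ?thesis using n1(3)[of "Suc n"] n by simp
    qed
    have "summable (\<lambda>n. (\<Lambda> (n + 2) \<omega>)\<^sup>2 * (b (n + 2) - a (n + 2)))"
    proof (rule summable_comparison_test'[of _ N])
      show "summable (\<lambda>n. 25 * (1 / 4 :: real) ^ n)" by (intro summable_mult summable_geometric) simp
      show "norm ((\<Lambda> (n + 2) \<omega>)\<^sup>2 * (b (n + 2) - a (n + 2))) \<le> 25 * (1 / 4) ^ n" if "n \<ge> N" for n
        using energy[OF that] ab(2)[of "n + 2"] by simp
    qed
    then have "summable (\<lambda>n. (\<Lambda> n \<omega>)\<^sup>2 * (b n - a n))"
      using summable_iff_shift[of "\<lambda>n. (\<Lambda> n \<omega>)\<^sup>2 * (b n - a n)" 2] by simp
    with 1 show ?thesis by simp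
  qed
  have sums: "(\<lambda>n. gain (a n) (\<Lambda> n) (T n) \<omega>) sums \<xi> \<omega>" if "(\<lambda>n. S n \<omega>) \<longlonglongrightarrow> \<xi> \<omega>" for \<omega>
    unfolding sums_def by (rule LIMSEQ_imp_Suc) (use that in \<open>simp add: S_sum\<close>)
  have "hedge B W \<beta> \<xi> a b \<Lambda> T"
    unfolding hedge_def
  proof (intro conjI allI hold ba a_lim \<Lambda>)
    show "AE \<omega> in M. (\<lambda>n. \<Lambda> n \<omega> * (B (T n \<omega>) \<omega> + W (T n \<omega>) \<omega> - (B (a n) \<omega> + W (a n) \<omega>))) sums \<xi> \<omega>"
      using ev by eventually_elim (use conv sums in \<open>auto simp: gain_def\<close>)
    show "AE \<omega> in M. summable (\<lambda>n. (\<Lambda> n \<omega>)\<^sup>2 * (b n - a n))"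
      using ev by eventually_elim (use conv in blast)
  qed
  then show ?thesis by blast
qed

end

section \<open>The integral of the hedging sequence\<close>

context filtered_prob_space
begin

text \<open>Both integrals come from the same series: the one against \<open>B\<close> path by path
  from \<open>has_gls_integral_step_sum\<close>, the one against \<open>W\<close> with the first
  \<open>m\<close> windows as approximating simple process, at a squared distance bounded by the
  tail \<open>R m\<close> of the energy.\<close>

lemma hedge_has_mixed_integral:
  fixes B W :: "real \<Rightarrow> 'a \<Rightarrow> real"
  assumes W: "wiener_process M F W" and B: "fractional_brownian_motion M H B" and adB: "adapted F B"
    and \<beta>: "0 < \<beta>" "1 - H < \<beta>" "\<beta> < 1" and \<alpha>: "1 - \<beta> < \<alpha>" "\<alpha> < H"
    and \<xi>[measurable]: "\<xi> \<in> borel_measurable M" and hedge: "hedge B W \<beta> \<xi> a b \<Lambda> T"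
  defines "\<psi> \<equiv> \<lambda>t \<omega>. \<Sum>n. \<Lambda> n \<omega> * indicator {a n<..T n \<omega>} t"
  shows "adapted F \<psi> \<and> has_mixed_integral M F H B W \<psi> \<xi>"
proof -
  have hold: "holding (a n) (b n) (\<Lambda> n) (T n)" and ba: "b n \<le> a (Suc n)" and a_lim: "a \<longlonglongrightarrow> 1"
    and \<Lambda>: "0 \<le> \<Lambda> n \<omega>" "\<Lambda> n \<omega> * (b n - a n) powr (1 - \<beta>) \<le> (1 / 2) ^ n" for n \<omega>
    using hedge by (auto simp: hedge_def)
  have gain: "AE \<omega> in M. (\<lambda>n. \<Lambda> n \<omega> * (B (T n \<omega>) \<omega> + W (T n \<omega>) \<omega> - (B (a n) \<omega> + W (a n) \<omega>))) sums \<xi> \<omega>"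
    and energy: "AE \<omega> in M. summable (\<lambda>n. (\<Lambda> n \<omega>)\<^sup>2 * (b n - a n))"
    using hedge by (auto simp: hedge_def)
  have ab: "0 \<le> a n" "a n < b n" "b n < 1" for n using holding_bounds[OF hold] by auto
  have T: "T n \<omega> \<in> {a n..b n}" for n \<omega> using holding_T[OF hold] .
  have holder: "AE \<omega> in M. \<exists>L. holder_on {0..1} \<alpha> L (\<lambda>t. B t \<omega>)"
  proof (rule AE_of_small_exceptional_sets)
    fix \<epsilon> :: real assume "\<epsilon> > 0"
    moreover have "0 < \<alpha>" using \<alpha> \<beta> by simp
    ultimately obtain L E where "E \<in> sets M" "prob E \<le> \<epsilon>" "\<forall>\<omega>\<in>space M - E. holder_on {0..1} \<alpha> L (\<lambda>t. B t \<omega>)"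
      using fbm_holder[OF B _ \<alpha>(2)] by meson
    then show "\<exists>E\<in>sets M. prob E \<le> \<epsilon> \<and> (\<forall>\<omega>\<in>space M - E. \<exists>L. holder_on {0..1} \<alpha> L (\<lambda>t. B t \<omega>))" by blast
  qed

  define gB where "gB n \<omega> = \<Lambda> n \<omega> * (B (T n \<omega>) \<omega> - B (a n) \<omega>)" for n \<omega>
  define gW where "gW n \<omega> = \<Lambda> n \<omega> * (W (T n \<omega>) \<omega> - W (a n) \<omega>)" for n \<omega>
  have gF: "gB n \<in> borel_measurable (F (b n))" "gW n \<in> borel_measurable (F (b n))" for n
    unfolding gB_def gW_def using adB wiener_measurable[OF W]
    by (auto intro!: holding_value_measurable[OF hold] simp: adapted_def)
  have gM[measurable]: "gB n \<in> borel_measurable M" "gW n \<in> borel_measurable M" for n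
    using measurable_F_M[OF gF(1)[of n]] measurable_F_M[OF gF(2)[of n]] ab[of n] by auto
  define K where "K \<omega> = (\<Sum>n. gB n \<omega>)" for \<omega>
  \<comment> \<open>The Ito integral is declared to be the remainder; \<open>V_lim\<close> shows
    that the simple integrals converge to it.\<close>
  define J where "J \<omega> = \<xi> \<omega> - K \<omega>" for \<omega>
  have [measurable]: "K \<in> borel_measurable M" unfolding K_def by measurable
  have [measurable]: "J \<in> borel_measurable M" unfolding J_def by measurable

  have len: "(T n \<omega> - a n) powr r \<le> (b n - a n) powr r" if "0 \<le> r" for n \<omega> r
    using T[of n \<omega>] that by (intro powr_mono2) auto
  have gls: "has_gls_integral \<beta> 0 1 (\<lambda>t. \<psi> t \<omega>) (\<lambda>t. B t \<omega>) (K \<omega>) \<and> summable (\<lambda>n. gB n \<omega>)"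
    if h: "\<exists>L. holder_on {0..1} \<alpha> L (\<lambda>t. B t \<omega>)" for \<omega>
  proof
    from h obtain L where h: "holder_on {0..1} \<alpha> L (\<lambda>t. B t \<omega>)" by blast
    then have L: "0 \<le> L" by (simp add: holder_on_def)
    have half: "summable (\<lambda>n. (1 / 2 :: real) ^ n)" by (intro summable_geometric) simp
    have c: "\<Lambda> n \<omega> * (T n \<omega> - a n) powr (1 - \<beta>) \<le> (1 / 2) ^ n" for n
      using \<beta> by (intro order_trans[OF mult_left_mono[OF len] \<Lambda>(2)] \<Lambda>(1)) auto
    interpret step_data \<beta> "\<lambda>n. \<Lambda> n \<omega>" a "\<lambda>n. T n \<omega>"
    proof
      show "summable (\<lambda>n. \<bar>\<Lambda> n \<omega>\<bar> * (T n \<omega> - a n) powr (1 - \<beta>))"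
        using c \<Lambda>(1) by (intro summable_comparison_test'[OF half, of 0]) auto
      show "T n \<omega> < 1" for n using T[of n \<omega>] ab(3)[of n] by simp
      show "a n \<le> T n \<omega>" for n using T[of n \<omega>] by simp
    qed (use \<beta> ab a_lim in auto)
    show "has_gls_integral \<beta> 0 1 (\<lambda>t. \<psi> t \<omega>) (\<lambda>t. B t \<omega>) (K \<omega>)"
      using has_gls_integral_step_sum[OF h \<alpha>(1)]
      by (simp add: \<psi>_def step_sum_def[abs_def] K_def gB_def)
    show "summable (\<lambda>n. gB n \<omega>)"
    proof (rule summable_comparison_test'[of _ 0])
      show "summable (\<lambda>n. L * (1 / 2 :: real) ^ n)" using half by (rule summable_mult)
      fix n
      have t01: "T n \<omega> \<in> {0..1}" "a n \<in> {0..1}" using T[of n \<omega>] ab[of n] by auto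
      have "\<bar>B (T n \<omega>) \<omega> - B (a n) \<omega>\<bar> \<le> L * \<bar>T n \<omega> - a n\<bar> powr \<alpha>" by (rule holder_onD[OF h t01])
      \<comment> \<open>The base is at most 1, so the smaller exponent gives the larger power; then
        the cost bound of the hedge applies.\<close>
      also have "\<bar>T n \<omega> - a n\<bar> powr \<alpha> \<le> \<bar>T n \<omega> - a n\<bar> powr (1 - \<beta>)"
        using t01 \<alpha> T[of n \<omega>] by (intro powr_mono') auto
      finally have "\<bar>B (T n \<omega>) \<omega> - B (a n) \<omega>\<bar> \<le> L * (T n \<omega> - a n) powr (1 - \<beta>)"
        using L T[of n \<omega>] by (simp add: mult_left_mono)
      from mult_left_mono[OF this \<Lambda>(1)[of n \<omega>]]
      have "\<Lambda> n \<omega> * \<bar>B (T n \<omega>) \<omega> - B (a n) \<omega>\<bar> \<le> L * (\<Lambda> n \<omega> * (T n \<omega> - a n) powr (1 - \<beta>))"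
        by (simp add: mult_ac)
      also have "\<dots> \<le> L * (1 / 2) ^ n" by (intro mult_left_mono c L)
      finally show "norm (gB n \<omega>) \<le> L * (1 / 2) ^ n"
        using \<Lambda>(1)[of n \<omega>] by (simp add: gB_def abs_mult)
    qed
  qed
  have gls_AE: "AE \<omega> in M. has_gls_integral \<beta> 0 1 (\<lambda>t. \<psi> t \<omega>) (\<lambda>t. B t \<omega>) (K \<omega>)"
    using holder by eventually_elim (use gls in blast)

  have a_mono: "b i \<le> a j" if "i < j" for i j
    using that
  proof (induction j)
    case (Suc j)
    then show ?case using ba[of j] ab[of j] by (cases "i = j") auto
  qed simp
  \<comment> \<open>The windows are disjoint, so at most one position is active at a time and
    squares do not mix.\<close>
  have single: "\<Lambda> k \<omega> * indicator {a k<..T k \<omega>} t = 0" if "t \<in> {a j<..b j}" "k \<noteq> j" for j k t \<omega>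
  proof -
    have "t \<notin> {a k<..T k \<omega>}"
      using that T[of k \<omega>] a_mono[of k j] a_mono[of j k] by (cases "k < j") auto
    then show ?thesis by simp
  qed
  have none: "\<Lambda> k \<omega> * indicator {a k<..T k \<omega>} t = 0" if "\<And>j. t \<notin> {a j<..b j}" for k t \<omega>
  proof -
    have "t \<notin> {a k<..T k \<omega>}" using that[of k] T[of k \<omega>] by auto
    then show ?thesis by simp
  qed
  define \<psi>m where "\<psi>m m t \<omega> = (\<Sum>k<m. \<Lambda> k \<omega> * indicator {a k<..T k \<omega>} t)" for m t \<omega>
  \<comment> \<open>The tail of the energy with every position prolonged to the end of its window.
    It dominates the squared distance to the first \<open>m\<close> windows, and its measurability
    is evident.\<close>
  define R where "R m \<omega> = (\<Sum>k. ennreal ((\<Lambda> (k + m) \<omega>)\<^sup>2 * (b (k + m) - a (k + m))))" for m \<omega>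
  have sq: "ennreal ((\<psi>m m t \<omega> - \<psi> t \<omega>)\<^sup>2) \<le> (\<Sum>k. ennreal ((\<Lambda> (k + m) \<omega>)\<^sup>2) * indicator {a (k + m)<..b (k + m)} t)" for m t \<omega>
  proof (cases "\<exists>j. t \<in> {a j<..b j}")
    case True
    then obtain j where j: "t \<in> {a j<..b j}" by blast
    define v where "v k = \<Lambda> k \<omega> * indicator {a k<..T k \<omega>} t" for k
    have v0: "v k = 0" if "k \<noteq> j" for k unfolding v_def by (rule single[OF j that])
    have "(\<Sum>k. v k) = (\<Sum>k\<in>{j}. v k)" using v0 by (intro suminf_finite) auto
    then have \<psi>: "\<psi> t \<omega> = v j" by (simp add: \<psi>_def v_def[symmetric])
    have \<psi>m: "\<psi>m m t \<omega> = (\<Sum>k<m. v k)" by (simp add: \<psi>m_def v_def)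
    show ?thesis
    proof (cases "j < m")
      case True
      have "\<psi>m m t \<omega> = (\<Sum>k\<in>{j}. v k)"
        unfolding \<psi>m using v0 True by (intro sum.mono_neutral_right) auto
      then show ?thesis by (simp add: \<psi>)
    next
      case False
      have "\<psi>m m t \<omega> = 0" unfolding \<psi>m using v0 False by (intro sum.neutral) auto
      moreover have "(v j)\<^sup>2 \<le> (\<Lambda> j \<omega>)\<^sup>2"
        by (auto simp: v_def indicator_def)
      ultimately have "ennreal ((\<psi>m m t \<omega> - \<psi> t \<omega>)\<^sup>2) \<le> ennreal ((\<Lambda> j \<omega>)\<^sup>2)"
        unfolding \<psi> by (intro ennreal_leI) simp
      also have "\<dots> = (\<Sum>k\<in>{j - m}. ennreal ((\<Lambda> (k + m) \<omega>)\<^sup>2) * indicator {a (k + m)<..b (k + m)} t)"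
        using False j by simp
      also have "\<dots> \<le> (\<Sum>k. ennreal ((\<Lambda> (k + m) \<omega>)\<^sup>2) * indicator {a (k + m)<..b (k + m)} t)"
        by (intro sum_le_suminf) auto
      finally show ?thesis .
    qed
  next
    case False
    then have "\<Lambda> k \<omega> * indicator {a k<..T k \<omega>} t = 0" for k by (intro none) blast
    then have "\<psi> t \<omega> = 0" "\<psi>m m t \<omega> = 0" by (simp_all only: \<psi>_def \<psi>m_def suminf_zero sum.neutral_const)
    then show ?thesis by simp
  qed
  have le_R: "(\<integral>\<^sup>+t\<in>{0..1}. ennreal ((\<psi>m m t \<omega> - \<psi> t \<omega>)\<^sup>2) \<partial>lborel) \<le> R m \<omega>" for m \<omega>
  proof -
    have "(\<integral>\<^sup>+t\<in>{0..1}. ennreal ((\<psi>m m t \<omega> - \<psi> t \<omega>)\<^sup>2) \<partial>lborel)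
        \<le> (\<integral>\<^sup>+t. (\<Sum>k. ennreal ((\<Lambda> (k + m) \<omega>)\<^sup>2) * indicator {a (k + m)<..b (k + m)} t) \<partial>lborel)"
      using sq by (intro nn_integral_mono) (auto simp: indicator_def)
    also have "\<dots> = (\<Sum>k. \<integral>\<^sup>+t. ennreal ((\<Lambda> (k + m) \<omega>)\<^sup>2) * indicator {a (k + m)<..b (k + m)} t \<partial>lborel)"
      by (rule nn_integral_suminf) measurable
    also have "\<dots> = R m \<omega>"
      unfolding R_def
    proof (rule suminf_cong)
      fix k
      have "a (k + m) \<le> b (k + m)" using ab(2)[of "k + m"] by simp
      then show "(\<integral>\<^sup>+t. ennreal ((\<Lambda> (k + m) \<omega>)\<^sup>2) * indicator {a (k + m)<..b (k + m)} t \<partial>lborel)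
          = ennreal ((\<Lambda> (k + m) \<omega>)\<^sup>2 * (b (k + m) - a (k + m)))"
        by (simp add: nn_integral_cmult_indicator ennreal_mult)
    qed
    finally show ?thesis .
  qed
  have \<Lambda>M[measurable]: "\<Lambda> n \<in> borel_measurable M" for n
    by (rule measurable_F_M[of _ "a n"]) (use hold[of n] ab[of n] in \<open>auto simp: holding_def\<close>)
  have [measurable]: "R m \<in> borel_measurable M" for m unfolding R_def by measurable
  have R_eq: "R m \<omega> = ennreal (\<Sum>k. (\<Lambda> (k + m) \<omega>)\<^sup>2 * (b (k + m) - a (k + m)))"
    if "summable (\<lambda>n. (\<Lambda> n \<omega>)\<^sup>2 * (b n - a n))" for m \<omega>
    unfolding R_def
  proof (rule suminf_ennreal2)
    show "0 \<le> (\<Lambda> (k + m) \<omega>)\<^sup>2 * (b (k + m) - a (k + m))" for k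
      using ab(2)[of "k + m"] by simp
  qed (rule summable_ignore_initial_segment[OF that])
  have R_lim: "(\<lambda>m. R m \<omega>) \<longlonglongrightarrow> 0" if s: "summable (\<lambda>n. (\<Lambda> n \<omega>)\<^sup>2 * (b n - a n))" for \<omega>
    unfolding R_eq[OF s] ennreal_0[symmetric] by (intro tendsto_ennrealI suminf_exist_split2[OF s])
  have adapted: "adapted F \<psi>"
    unfolding adapted_def \<psi>_def using holding_position_adapted[OF hold]
    by (intro ballI borel_measurable_suminf) auto
  have integrand: "ito_integrand M F \<psi>"
    unfolding ito_integrand_def
  proof (intro conjI adapted)
    show "(\<lambda>(t, \<omega>). \<psi> t \<omega>) \<in> borel_measurable (restrict_space borel {0..1} \<Otimes>\<^sub>M M)"
      unfolding \<psi>_def case_prod_beta using holding_position_measurable[OF hold, unfolded case_prod_beta]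
      by (intro borel_measurable_suminf) auto
    show "AE \<omega> in M. (\<integral>\<^sup>+t\<in>{0..1}. ennreal ((\<psi> t \<omega>)\<^sup>2) \<partial>lborel) < \<infinity>"
      using energy
    proof eventually_elim
      case (elim \<omega>)
      have "(\<integral>\<^sup>+t\<in>{0..1}. ennreal ((\<psi> t \<omega>)\<^sup>2) \<partial>lborel) \<le> R 0 \<omega>"
        using le_R[of 0 \<omega>] by (simp add: \<psi>m_def)
      also have "\<dots> < \<infinity>" using R_eq[OF elim, of 0] by simp
      finally show ?case .
    qed
  qed

  define V where "V m \<omega> = (\<Sum>k<m. gW k \<omega>)" for m \<omega>
  \<comment> \<open>The end of the last of the first \<open>m\<close> windows, and time 0 if there
    is none.\<close>
  define u where "u m = (case m of 0 \<Rightarrow> 0 | Suc k \<Rightarrow> b k)" for m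
  have "simple_upto W (u m) (\<psi>m m) (V m)" for m
  proof (induction m)
    case 0
    then show ?case using simple_upto_0 by (simp add: u_def \<psi>m_def[abs_def] V_def[abs_def])
  next
    case (Suc m)
    have "u m \<le> a m" using ab ba by (cases m) (auto simp: u_def)
    from holding_simple_upto[OF Suc this hold]
    show ?case by (simp add: u_def \<psi>m_def[abs_def] V_def[abs_def] gW_def del: sum_mult_indicator)
  qed
  then have "\<forall>m. \<exists>p. simple_integrand F (fst p) (fst (snd p)) (snd (snd p)) \<and>
      simple_process (fst p) (fst (snd p)) (snd (snd p)) = \<psi>m m \<and> simple_ito_integral W (fst p) (fst (snd p)) (snd (snd p)) = V m"
    unfolding simple_upto_def by fastforce
  from choice[OF this] obtain p where p: "\<And>m. simple_integrand F (fst (p m)) (fst (snd (p m))) (snd (snd (p m)))"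
    "\<And>m. simple_process (fst (p m)) (fst (snd (p m))) (snd (snd (p m))) = \<psi>m m"
    "\<And>m. simple_ito_integral W (fst (p m)) (fst (snd (p m))) (snd (snd (p m))) = V m" by blast

  have V_lim: "AE \<omega> in M. (\<lambda>m. V m \<omega>) \<longlonglongrightarrow> J \<omega>"
    using gain holder
  proof eventually_elim
    case (elim \<omega>)
    have "(\<lambda>n. gB n \<omega>) sums K \<omega>" using gls[OF elim(2)] by (simp add: K_def summable_sums)
    from sums_diff[OF elim(1) this]
    have "(\<lambda>n. gW n \<omega>) sums J \<omega>" by (simp add: gB_def gW_def J_def algebra_simps)
    then show ?case by (simp add: sums_def V_def)
  qed
  have ito: "has_ito_integral M F W \<psi> J"
    unfolding has_ito_integral_def
  proof (intro conjI integrand exI allI impI)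
    show "J \<in> borel_measurable M" by measurable
    show "simple_integrand F (fst (p m)) (fst (snd (p m))) (snd (snd (p m)))" for m by (rule p)
    fix \<epsilon> :: real assume \<epsilon>: "\<epsilon> > 0"
    show "(\<lambda>m. prob {\<omega> \<in> space M. (\<integral>\<^sup>+t\<in>{0..1}. ennreal ((simple_process (fst (p m)) (fst (snd (p m))) (snd (snd (p m))) t \<omega> - \<psi> t \<omega>)\<^sup>2) \<partial>lborel)
              > ennreal \<epsilon>}) \<longlonglongrightarrow> 0"
      unfolding p(2)
    proof (rule prob_tendsto_0[where A = "\<lambda>m. {\<omega>\<in>space M. R m \<omega> > ennreal \<epsilon>}"])
      show "AE \<omega> in M. \<forall>\<^sub>F m in sequentially. \<omega> \<notin> {\<omega>\<in>space M. R m \<omega> > ennreal \<epsilon>}"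
        using energy
      proof eventually_elim
        case (elim \<omega>)
        have "\<forall>\<^sub>F m in sequentially. R m \<omega> < ennreal \<epsilon>" using order_tendstoD(2)[OF R_lim[OF elim], of "ennreal \<epsilon>"] \<epsilon> by simp
        then show ?case by eventually_elim auto
      qed
      show "{\<omega> \<in> space M. (\<integral>\<^sup>+t\<in>{0..1}. ennreal ((\<psi>m m t \<omega> - \<psi> t \<omega>)\<^sup>2) \<partial>lborel) > ennreal \<epsilon>}
        \<subseteq> {\<omega>\<in>space M. R m \<omega> > ennreal \<epsilon>}" for m
        using le_R by (auto intro: less_le_trans)
    qed measurable
    show "(\<lambda>m. prob {\<omega> \<in> space M. \<bar>simple_ito_integral W (fst (p m)) (fst (snd (p m))) (snd (snd (p m))) \<omega> - J \<omega>\<bar> > \<epsilon>}) \<longlonglongrightarrow> 0"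
      unfolding p(3)
    proof (rule prob_tendsto_0[OF _ _ order_refl])
      show "{\<omega>\<in>space M. \<bar>V m \<omega> - J \<omega>\<bar> > \<epsilon>} \<in> sets M" for m unfolding V_def by measurable
      show "AE \<omega> in M. \<forall>\<^sub>F m in sequentially. \<omega> \<notin> {\<omega>\<in>space M. \<bar>V m \<omega> - J \<omega>\<bar> > \<epsilon>}"
        using V_lim
      proof eventually_elim
        case (elim \<omega>)
        from tendstoD[OF this \<epsilon>] show ?case by eventually_elim (auto simp: dist_real_def)
      qed
    qed
  qed
  have "has_mixed_integral M F H B W \<psi> \<xi>"
    unfolding has_mixed_integral_def
    by (rule bexI[of _ \<beta>], rule exI[of _ K], rule exI[of _ J]) (use gls_AE ito \<beta> in \<open>auto simp: J_def\<close>)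
  with adapted show ?thesis by blast
qed

end

theorem theorem4p4:
  fixes M :: "'a measure" and F :: "real \<Rightarrow> 'a measure" and H :: real
    and B W :: "real \<Rightarrow> 'a \<Rightarrow> real" and \<xi> :: "'a \<Rightarrow> real"
  assumes "1 / 2 < H" and "H < 1"
    and "stochastic_basis M F"
    and "wiener_process M F W"
    and "fractional_brownian_motion M H B" and "adapted F B"
    and "left_continuous_at_1 M F"
    and "\<xi> \<in> borel_measurable (F 1)"
  shows "\<exists>\<psi> I. adapted F \<psi> \<and> has_mixed_integral M F H B W \<psi> I \<and> (AE \<omega> in M. I \<omega> = \<xi> \<omega>)"
proof -
  interpret prob_space M using assms(3) by (simp add: stochastic_basis_def)
  interpret filtered_prob_space M F by unfold_locales (rule assms(3))
  \<comment> \<open>\<open>\<beta>\<close> is the midpoint of \<open>(1 - H, 1 / 2)\<close>, an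
    interval that is nonempty because \<open>H > 1 / 2\<close>; \<open>\<alpha>\<close> is the
    midpoint of \<open>(1 - \<beta>, H)\<close>, nonempty because \<open>\<beta> > 1 - H\<close>.
    From \<open>\<beta> < 1 / 2\<close> it follows that \<open>\<alpha> > 1 / 2\<close>.\<close>
  define \<beta> where "\<beta> = (3 / 2 - H) / 2"
  define \<alpha> where "\<alpha> = (1 - \<beta> + H) / 2"
  have \<beta>: "0 < \<beta>" "\<beta> < 1 / 2" "1 - H < \<beta>" "\<beta> < 1" using assms(1,2) by (auto simp: \<beta>_def field_simps)
  have \<alpha>: "1 / 2 < \<alpha>" "\<alpha> < H" "1 - \<beta> < \<alpha>" using assms(1,2) by (auto simp: \<alpha>_def \<beta>_def field_simps)
  obtain a b \<Lambda> T where "hedge B W \<beta> \<xi> a b \<Lambda> T"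
    using hedge_exists[OF assms(4-6) \<alpha>(1,2) \<beta>(1,2) assms(7,8)] by blast
  from hedge_has_mixed_integral[OF assms(4-6) \<beta>(1,3,4) \<alpha>(3,2) measurable_F_M[OF assms(8)] this]
  show ?thesis by (intro exI conjI) auto
qed

end
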